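(* Let $g_1,\dots,g_m\in\mathbb{R}[x]$ be polynomials such that the semialgebraic set $$S:=\{x\in\mathbb{R}^n : g_1(x)\ge 0,\dots,g_m(x)\ge 0\}$$ has nonempty interior. Let $f\in\mathbb{R}[x]$ be a polynomial nonnegative on $S$, and denote $d_f:=\lfloor \deg(f)/2\rfloor+1$ and $\theta:=1+\|x\|_2^2$. Then there exist positive constants $\bar c$ and $c$ depending on $f,g_1,\dots,g_m$ such that for all $\varepsilon>0$ and for all $k\in\mathbb{N}$ satisfying $k\ge\bar c\,\varepsilon^{-c}$, there exist SOS polynomials $\sigma_0,\dots,\sigma_m$ such that $$\deg(\sigma_0)\le 2(k+d_f)\quad\text{and}\quad \deg(\sigma_jg_j)\le 2(k+d_f),\quad j=1,\dots,m,$$ and $$\theta^{k}(f+\varepsilon\theta^{d_f})=\sigma_0+\sigma_1g_1+\dots+\sigma_mg_m .$$ Moreover, if $m=1$ and $g_1=1-\|x\|_2^2$, then one can take $c=65$.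
   Context: $\mathbb{R}[x]$ is the ring of real polynomials in $x=(x_1,\dots,x_n)$; $m$ is a positive integer; $\|x\|_2^2=x_1^2+\dots+x_n^2$. An SOS polynomial is a finite sum of squares of polynomials in $\mathbb{R}[x]$. *)

theory Defs
  imports "HOL-Analysis.Analysis" "HOL-Library.Poly_Mapping"
begin

text \<open>
  Real polynomials in the variables \<open>x\<^sub>i\<close>, \<open>i :: 'n\<close>, as finitely supported maps from exponent
  vectors to coefficients; the ring structure (convolution product) is the one of
  \<^theory>\<open>HOL-Library.Poly_Mapping\<close>. With \<open>'n\<close> finite, the number of variables is \<open>CARD('n)\<close>.
\<close>

type_synonym 'n real_mpoly = "('n \<Rightarrow>\<^sub>0 nat) \<Rightarrow>\<^sub>0 real"

definition Const :: "real \<Rightarrow> 'n real_mpoly"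
  where "Const a = Poly_Mapping.single 0 a"

definition Var :: "'n \<Rightarrow> 'n real_mpoly"
  where "Var i = Poly_Mapping.single (Poly_Mapping.single i 1) 1"

definition eval_mpoly :: "'n::finite real_mpoly \<Rightarrow> real ^ 'n \<Rightarrow> real"
  where "eval_mpoly p x =
    (\<Sum>\<alpha>\<in>Poly_Mapping.keys p.
      Poly_Mapping.lookup p \<alpha> * (\<Prod>i\<in>UNIV. (x $ i) ^ Poly_Mapping.lookup \<alpha> i))"

text \<open>The total degree, with the convention that the zero polynomial has degree \<open>0\<close>.\<close>

definition total_degree :: "'n::finite real_mpoly \<Rightarrow> nat"
  where "total_degree p =
    Max (insert 0 ((\<lambda>\<alpha>. \<Sum>i\<in>UNIV. Poly_Mapping.lookup \<alpha> i) ` Poly_Mapping.keys p))"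

definition is_sos :: "'n real_mpoly \<Rightarrow> bool"
  where "is_sos p \<longleftrightarrow> (\<exists>(r::nat) q. p = (\<Sum>i<r. (q i)\<^sup>2))"

definition norm_sq :: "'n::finite real_mpoly"
  where "norm_sq = (\<Sum>i\<in>UNIV. (Var i)\<^sup>2)"

definition theta :: "'n::finite real_mpoly"
  where "theta = 1 + norm_sq"

definition semialg_set :: "nat \<Rightarrow> (nat \<Rightarrow> 'n::finite real_mpoly) \<Rightarrow> (real ^ 'n) set"
  where "semialg_set m g = {x. \<forall>j\<in>{1..m}. eval_mpoly (g j) x \<ge> 0}"

definition half_deg :: "'n::finite real_mpoly \<Rightarrow> nat"
  where "half_deg f = total_degree f div 2 + 1"

definition has_sos_rep ::
    "nat \<Rightarrow> (nat \<Rightarrow> 'n::finite real_mpoly) \<Rightarrow> nat \<Rightarrow> 'n real_mpoly \<Rightarrow> bool"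
  where "has_sos_rep m g d p \<longleftrightarrow>
    (\<exists>\<sigma> :: nat \<Rightarrow> 'n real_mpoly.
      (\<forall>j\<in>{0..m}. is_sos (\<sigma> j)) \<and>
      total_degree (\<sigma> 0) \<le> d \<and>
      (\<forall>j\<in>{1..m}. total_degree (\<sigma> j * g j) \<le> d) \<and>
      p = \<sigma> 0 + (\<Sum>j\<in>{1..m}. \<sigma> j * g j))"

end

theory Submission
  imports Defs "HOL-Probability.Probability" "HOL-Complex_Analysis.Complex_Analysis"
begin

text \<open>
  Write \<open>\<theta> = 1 + \<bar>x\<bar>\<^sup>2\<close>. Comparing polynomials with powers of \<open>\<theta>\<close> means working on the unit sphere in
  homogeneous coordinates, which is compact. Since \<open>f\<close> has degree less than \<open>2 d\<close>, where
  \<open>d = half_deg f\<close>, its homogenization to degree \<open>2 d\<close> vanishes at infinity, so that nothing has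
  to be known about \<open>S\<close> there. The representation arises in two steps.

  The first step removes the constraints. Multiply each \<open>g\<^sub>j\<close> by the square of a polynomial in
  \<open>g\<^sub>j / \<theta>\<^sup>e\<close> that is at least \<open>1/2\<close> where \<open>g\<^sub>j \<le> 0\<close> and nearly \<open>0\<close> where \<open>g\<^sub>j\<close> is not small
  (\<open>step_polynomial\<close>), and subtract a large multiple \<open>L\<close> of the results from \<open>f + \<epsilon> \<theta>\<^sup>d\<close>, with suitable
  powers of \<open>\<theta>\<close>. This lowers the values only slightly where the constraints hold. Where \<open>f / \<theta>\<^sup>d \<le> - \<epsilon>/2\<close>, a
  Lojasiewicz inequality gives a constraint with \<open>g\<^sub>j / \<theta>\<^sup>e \<le> - c \<epsilon>\<^sup>a\<close>, and its penalty outweighs \<open>f\<close> if \<open>L\<close> is of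
  the order of \<open>\<epsilon>\<^bsup>-a\<^esup>\<close>. The result is a polynomial \<open>p\<close> between \<open>(\<epsilon>/4) \<theta>\<^sup>K\<close> and a multiple of \<open>\<epsilon>\<^bsup>-a\<^esup> \<theta>\<^sup>K\<close> on
  the whole space, with \<open>K\<close> of the order of \<open>\<epsilon>\<^bsup>-3(a+1)\<^esup>\<close>.

  The second step is Reznick's theorem on uniform denominators (\<open>sosf_positive_polynomial\<close>): if
  \<open>\<delta> \<theta>\<^sup>K \<le> p \<le> M \<theta>\<^sup>K\<close>, then \<open>\<theta>\<^sup>k p\<close> is a sum of squares for \<open>k\<close> beyond a multiple of \<open>K\<^sup>2 M / \<delta>\<close>. To a form \<open>h\<close>
  of degree \<open>2 K\<close> assign the form \<open>y \<mapsto> E (h z (z \<bullet> y)\<^bsup>2(k+K)\<^esup>)\<close> with a Gaussian vector \<open>z\<close>. For \<open>h \<ge> 0\<close> it has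
  a positive semidefinite Gram matrix, so it is a sum of squares (\<open>sosf_gexp\<close>). By Wick's formula it is
  \<open>\<bar>y\<bar>\<^bsup>2k\<^esup>\<close> times \<open>h\<close> plus terms with Laplacians of \<open>h\<close> (\<open>pairing_eq_defect\<close>), which are small for large \<open>k\<close>
  because differentiating a form costs only a factor polynomial in its degree (\<open>bounded_form_pd\<close>).
  Inverting this perturbation of the identity keeps a positive form positive.

  Together \<open>k\<close> has to be of the order of \<open>\<epsilon>\<^bsup>-7(a+1)\<^esup>\<close> (\<open>representation_from_lojasiewicz\<close>).

  The Lojasiewicz inequality with some exponent \<open>a\<close> (\<open>lojasiewicz_semialgebraic\<close>) follows from the fact
  that the infimum of a polynomial family over all its variables is an algebraic function of the
  parameter (\<open>infimum_algebraic\<close>). This is an elimination by linear algebra: after the perturbation by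
  \<open>\<delta> \<Sum> z\<^sub>i\<^sup>q\<close>, the equations for critical points express all polynomials by finitely many monomials, so that
  the powers of the critical value are linearly dependent; then \<open>\<delta>\<close> tends to \<open>0\<close>. For the unit ball a direct
  estimate gives \<open>a = 1\<close> (\<open>lojasiewicz_ball\<close>), so \<open>k\<close> of the order of \<open>\<epsilon>\<^bsup>-14\<^esup>\<close> suffices, well within the
  exponent \<open>65\<close>.
\<close>

section \<open>Polynomials, their values and their derivatives\<close>

lemma mpoly_induct [case_names single add]:
  fixes p :: "'a \<Rightarrow>\<^sub>0 'b::comm_monoid_add"
  assumes single: "\<And>a c. P (Poly_Mapping.single a c)"
    and add: "\<And>p q. P p \<Longrightarrow> P q \<Longrightarrow> P (p + q)"
  shows "P p"
proof (induction p rule: update_induct)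
  case const
  then show ?case using single[of undefined 0] by simp
next
  case (update f a b)
  have "Poly_Mapping.update a b f = Poly_Mapping.single a b + f"
    by (rule poly_mapping_eqI)
      (use update.hyps in \<open>auto simp: Poly_Mapping.lookup_update lookup_add lookup_single when_def in_keys_iff\<close>)
  then show ?case using update single add by simp
qed

text \<open>The values lie in an arbitrary commutative real algebra, because the derivative estimate on the
  sphere evaluates real polynomials at complex points.\<close>

definition ev :: "'v::finite real_mpoly \<Rightarrow> ('v \<Rightarrow> 'b::{comm_ring_1,real_algebra_1}) \<Rightarrow> 'b"
  where "ev p z = (\<Sum>\<alpha>\<in>Poly_Mapping.keys p.
      of_real (Poly_Mapping.lookup p \<alpha>) * (\<Prod>i\<in>UNIV. z i ^ Poly_Mapping.lookup \<alpha> i))"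

lemma eval_mpoly_eq_ev: "eval_mpoly p x = ev p (\<lambda>i. x $ i)"
  by (simp add: eval_mpoly_def ev_def)

lemma ev_superset:
  assumes "finite A" "Poly_Mapping.keys p \<subseteq> A"
  shows "ev p z = (\<Sum>\<alpha>\<in>A. of_real (Poly_Mapping.lookup p \<alpha>) * (\<Prod>i\<in>UNIV. z i ^ Poly_Mapping.lookup \<alpha> i))"
  unfolding ev_def using assms by (intro sum.mono_neutral_left) (auto simp: in_keys_iff)

lemma ev_single [simp]: "ev (Poly_Mapping.single \<alpha> c) z = of_real c * (\<Prod>i\<in>UNIV. z i ^ Poly_Mapping.lookup \<alpha> i)"
  by (subst ev_superset[of "{\<alpha>}"]) auto

lemma ev_0 [simp]: "ev 0 z = 0"
  by (simp add: ev_def)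

lemma ev_add [simp]: "ev (p + q) z = ev p z + ev q z"
proof -
  let ?A = "Poly_Mapping.keys p \<union> Poly_Mapping.keys q"
  have "Poly_Mapping.keys (p + q) \<subseteq> ?A" by (rule keys_add)
  then show ?thesis
    by (simp add: ev_superset[of ?A] lookup_add sum.distrib distrib_right)
qed

lemma ev_sum [simp]: "ev (\<Sum>i\<in>A. p i) z = (\<Sum>i\<in>A. ev (p i) z)"
  by (induction A rule: infinite_finite_induct) auto

lemma ev_mult [simp]: "ev (p * q) z = ev p z * ev q z"
proof (induction p rule: mpoly_induct)
  case (single a c)
  show ?case
  proof (induction q rule: mpoly_induct)
    case (single b d)
    then show ?case by (simp add: mult_single lookup_add power_add prod.distrib)
  qed (simp add: distrib_left)
qed (simp add: distrib_right)

lemma ev_Const [simp]: "ev (Const c) z = of_real c"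
  by (simp add: Const_def)

lemma ev_1 [simp]: "ev 1 z = 1"
  using ev_Const[of 1 z] by (simp add: Const_def)

lemma ev_power [simp]: "ev (p ^ k) z = ev p z ^ k"
  by (induction k) auto

lemma ev_Var [simp]: "ev (Var i) z = z i"
proof -
  have "(\<Prod>j\<in>UNIV. z j ^ Poly_Mapping.lookup (Poly_Mapping.single i (1::nat)) j)
      = (\<Prod>j\<in>UNIV. if j = i then z j else 1)"
    by (intro prod.cong) (auto simp: lookup_single when_def)
  then show ?thesis by (simp add: Var_def)
qed

lemma ev_uminus [simp]: "ev (- p) z = - ev p z"
  using ev_add[of p "- p" z] by (simp add: add_eq_0_iff del: ev_add)

lemma ev_diff [simp]: "ev (p - q) z = ev p z - ev q z"
  using ev_add[of p "- q" z] by (simp del: ev_add)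

lemma ev_theta: "ev theta z = 1 + (\<Sum>i\<in>UNIV. (z i)\<^sup>2)"
  by (simp add: theta_def norm_sq_def)

lemma norm_vec_sq: "(norm (x :: real ^ 'n))\<^sup>2 = (\<Sum>i\<in>UNIV. (x $ i)\<^sup>2)"
  by (simp add: norm_vec_def L2_set_def sum_nonneg)

lemma eval_theta: "eval_mpoly theta x = 1 + (norm x)\<^sup>2"
  by (simp add: eval_mpoly_eq_ev ev_theta norm_vec_sq)

lemma ev_of_real:
  "ev p (\<lambda>i. of_real (z i) :: 'b::{comm_ring_1,real_algebra_1}) = of_real (ev p z)"
  by (simp add: ev_def)

lemma lookup_Const_mult [simp]: "Poly_Mapping.lookup (Const c * p) \<alpha> = c * Poly_Mapping.lookup p \<alpha>"
proof (induction p rule: mpoly_induct)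
  case (single a d)
  then show ?case by (simp add: Const_def mult_single lookup_single when_def)
qed (simp add: distrib_left lookup_add)

text \<open>Given by its coefficients, so that linearity and commutation of partial derivatives can be read
  off; the factor \<open>\<alpha>\<^sub>i + 1\<close> belongs to the shifted exponent.\<close>

definition pd :: "'v \<Rightarrow> 'v real_mpoly \<Rightarrow> 'v real_mpoly"
  where "pd i p = Abs_poly_mapping (\<lambda>\<alpha>. real (Suc (Poly_Mapping.lookup \<alpha> i)) *
      Poly_Mapping.lookup p (\<alpha> + Poly_Mapping.single i 1))"

lemma lookup_pd: "Poly_Mapping.lookup (pd i p) \<alpha> =
    real (Suc (Poly_Mapping.lookup \<alpha> i)) * Poly_Mapping.lookup p (\<alpha> + Poly_Mapping.single i 1)"
proof -
  let ?s = "\<lambda>\<alpha>::'a \<Rightarrow>\<^sub>0 nat. \<alpha> + Poly_Mapping.single i 1"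
  have "finite (?s -` Poly_Mapping.keys p)"
    by (rule finite_vimageI) (auto simp: inj_on_def)
  moreover have "{\<alpha>. real (Suc (Poly_Mapping.lookup \<alpha> i)) * Poly_Mapping.lookup p (?s \<alpha>) \<noteq> 0} \<subseteq> ?s -` Poly_Mapping.keys p"
    by (auto simp: in_keys_iff)
  ultimately have "finite {\<alpha>. real (Suc (Poly_Mapping.lookup \<alpha> i)) * Poly_Mapping.lookup p (?s \<alpha>) \<noteq> 0}"
    by (rule rev_finite_subset)
  then show ?thesis
    unfolding pd_def by (subst lookup_Abs_poly_mapping) auto
qed

lemma pd_0 [simp]: "pd i 0 = 0"
  by (rule poly_mapping_eqI) (simp add: lookup_pd)

lemma pd_add [simp]: "pd i (p + q) = pd i p + pd i q"
  by (rule poly_mapping_eqI) (simp add: lookup_pd lookup_add distrib_left)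

lemma pd_sum [simp]: "pd i (\<Sum>k\<in>A. p k) = (\<Sum>k\<in>A. pd i (p k))"
  by (induction A rule: infinite_finite_induct) auto

lemma pd_Const_mult [simp]: "pd i (Const c * p) = Const c * pd i p"
  by (rule poly_mapping_eqI) (simp add: lookup_pd)

lemma single_neq_0_nat: "\<alpha> + Poly_Mapping.single i (1::nat) \<noteq> 0"
proof
  assume "\<alpha> + Poly_Mapping.single i (1::nat) = 0"
  then have "Poly_Mapping.lookup (\<alpha> + Poly_Mapping.single i (1::nat)) i = 0" by simp
  then show False by (simp add: lookup_add)
qed

lemma pd_Const [simp]: "pd i (Const c) = 0"
proof (rule poly_mapping_eqI)
  fix \<alpha>
  show "Poly_Mapping.lookup (pd i (Const c)) \<alpha> = Poly_Mapping.lookup 0 \<alpha>"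
    using single_neq_0_nat[of \<alpha> i, symmetric] by (simp only: lookup_pd Const_def lookup_single when_def) simp
qed

lemma pd_1 [simp]: "pd i 1 = 0"
  using pd_Const[of i 1] by (simp add: Const_def)

lemma pd_single: "pd i (Poly_Mapping.single \<alpha> c) =
    Poly_Mapping.single (\<alpha> - Poly_Mapping.single i 1) (real (Poly_Mapping.lookup \<alpha> i) * c)"
proof (rule poly_mapping_eqI)
  fix \<beta>
  show "Poly_Mapping.lookup (pd i (Poly_Mapping.single \<alpha> c)) \<beta> =
    Poly_Mapping.lookup (Poly_Mapping.single (\<alpha> - Poly_Mapping.single i 1) (real (Poly_Mapping.lookup \<alpha> i) * c)) \<beta>"
  proof (cases "\<alpha> = \<beta> + Poly_Mapping.single i 1")
    case True
    then show ?thesis by (simp add: lookup_pd lookup_add)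
  next
    case False
    have "Poly_Mapping.lookup \<alpha> i = 0" if "\<alpha> - Poly_Mapping.single i 1 = \<beta>"
    proof (rule ccontr)
      assume "Poly_Mapping.lookup \<alpha> i \<noteq> 0"
      then have "\<alpha> = (\<alpha> - Poly_Mapping.single i 1) + Poly_Mapping.single i 1"
        by (intro poly_mapping_eqI) (auto simp: lookup_add lookup_minus lookup_single when_def)
      with that False show False by simp
    qed
    then show ?thesis using False by (auto simp: lookup_pd lookup_single when_def)
  qed
qed

lemma pd_Var_mult: "pd j (Var i * p) = (if i = j then p else 0) + Var i * pd j p"
proof (induction p rule: mpoly_induct)
  case (single \<alpha> c)
  show ?case
  proof (cases "Poly_Mapping.lookup \<alpha> j = 0")
    case True
    then show ?thesis
      by (auto simp: Var_def mult_single pd_single lookup_add lookup_single when_def)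
  next
    case False
    define \<beta> where "\<beta> = \<alpha> - Poly_Mapping.single j 1"
    have \<alpha>: "\<alpha> = Poly_Mapping.single j 1 + \<beta>"
      using False unfolding \<beta>_def
      by (intro poly_mapping_eqI) (auto simp: lookup_add lookup_minus lookup_single when_def)
    have 1: "Poly_Mapping.single i 1 + (Poly_Mapping.single j 1 + \<beta>) - Poly_Mapping.single j 1
        = Poly_Mapping.single i 1 + \<beta>"
      by (metis add.left_commute add_diff_cancel_left')
    have 2: "Poly_Mapping.single j 1 + \<beta> - Poly_Mapping.single j 1 = \<beta>"
      by (rule add_diff_cancel_left')
    have "Var i * pd j (Poly_Mapping.single \<alpha> c) =
        Poly_Mapping.single (Poly_Mapping.single i 1 + \<beta>) (real (Poly_Mapping.lookup \<alpha> j) * c)"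
      unfolding \<alpha> pd_single 2 by (simp add: Var_def mult_single)
    moreover have "pd j (Var i * Poly_Mapping.single \<alpha> c) =
        Poly_Mapping.single (Poly_Mapping.single i 1 + \<beta>)
          (real ((if i = j then 1 else 0) + Poly_Mapping.lookup \<alpha> j) * c)"
      unfolding \<alpha> Var_def mult_single pd_single 1
      by (simp add: lookup_add lookup_single when_def)
    ultimately show ?thesis
      by (auto simp: \<alpha> distrib_right simp flip: single_add)
  qed
qed (auto simp: algebra_simps)

lemma pd_Var: "pd j (Var i) = (if i = j then 1 else 0)"
  using pd_Var_mult[of j i 1] by simp

lemma single_eq_Var_mult:
  assumes "Poly_Mapping.lookup \<alpha> i \<noteq> 0"
  shows "Poly_Mapping.single \<alpha> c = Var i * Poly_Mapping.single (\<alpha> - Poly_Mapping.single i 1) c"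
proof -
  have "\<alpha> = Poly_Mapping.single i 1 + (\<alpha> - Poly_Mapping.single i 1)"
    using assms by (intro poly_mapping_eqI) (auto simp: lookup_add lookup_minus lookup_single when_def)
  then show ?thesis by (simp add: Var_def mult_single)
qed

definition mdeg :: "('v::finite \<Rightarrow>\<^sub>0 nat) \<Rightarrow> nat"
  where "mdeg \<alpha> = (\<Sum>i\<in>UNIV. Poly_Mapping.lookup \<alpha> i)"

lemma mdeg_add [simp]: "mdeg (\<alpha> + \<beta>) = mdeg \<alpha> + mdeg \<beta>"
  by (simp add: mdeg_def lookup_add sum.distrib)

lemma mdeg_0 [simp]: "mdeg 0 = 0"
  by (simp add: mdeg_def)

lemma mdeg_single [simp]: "mdeg (Poly_Mapping.single i k) = k"
  by (simp add: mdeg_def lookup_single when_def)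

lemma mdeg_eq_0_iff [simp]: "mdeg \<alpha> = 0 \<longleftrightarrow> \<alpha> = 0"
  by (auto simp: mdeg_def intro: poly_mapping_eqI)

lemma mdeg_pos_obtain:
  assumes "\<alpha> \<noteq> 0"
  obtains i where "Poly_Mapping.lookup \<alpha> i \<noteq> 0"
  using assms by (metis poly_mapping_eqI lookup_zero)

lemma mdeg_diff_single:
  assumes "Poly_Mapping.lookup \<alpha> i \<noteq> 0"
  shows "Suc (mdeg (\<alpha> - Poly_Mapping.single i 1)) = mdeg \<alpha>"
proof -
  have "\<alpha> = Poly_Mapping.single i 1 + (\<alpha> - Poly_Mapping.single i 1)"
    using assms by (intro poly_mapping_eqI) (auto simp: lookup_add lookup_minus lookup_single when_def)
  then show ?thesis by (metis mdeg_add mdeg_single plus_1_eq_Suc)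
qed

lemma monomial_induct [case_names 0 Var]:
  fixes \<alpha> :: "'v::finite \<Rightarrow>\<^sub>0 nat"
  assumes zero: "P 0" and step: "\<And>i \<alpha>. P \<alpha> \<Longrightarrow> P (Poly_Mapping.single i 1 + \<alpha>)"
  shows "P \<alpha>"
proof (induction "mdeg \<alpha>" arbitrary: \<alpha>)
  case 0
  then show ?case using zero by simp
next
  case (Suc n)
  then have "\<alpha> \<noteq> 0" by auto
  then obtain i where i: "Poly_Mapping.lookup \<alpha> i \<noteq> 0" by (rule mdeg_pos_obtain)
  then have "\<alpha> = Poly_Mapping.single i 1 + (\<alpha> - Poly_Mapping.single i 1)"
    by (intro poly_mapping_eqI) (auto simp: lookup_add lookup_minus lookup_single when_def)
  moreover have "P (\<alpha> - Poly_Mapping.single i 1)"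
    using Suc mdeg_diff_single[OF i] by auto
  ultimately show ?case using step by metis
qed

lemma ring_induct [case_names Const add Var]:
  fixes p :: "'v::finite real_mpoly"
  assumes C: "\<And>c. P (Const c)" and add: "\<And>p q. P p \<Longrightarrow> P q \<Longrightarrow> P (p + q)"
    and V: "\<And>i p. P p \<Longrightarrow> P (Var i * p)"
  shows "P p"
proof (induction p rule: mpoly_induct)
  case (single a c)
  show ?case
  proof (induction a rule: monomial_induct)
    case 0
    then show ?case using C[of c] by (simp add: Const_def)
  next
    case (Var i \<alpha>)
    then show ?case using V[OF Var, of i] by (simp add: Var_def mult_single)
  qed
qed (use add in auto)

lemma Const_add: "Const (a + b) = Const a + Const b"
  by (simp add: Const_def single_add)

lemma Const_mult: "Const (a * b) = Const a * Const b"
  by (simp add: Const_def mult_single)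

lemma pd_mult: "pd j (p * q) = pd j p * q + p * pd j (q :: 'v::finite real_mpoly)"
proof (induction p rule: ring_induct)
  case (Var i p)
  have "pd j (Var i * p * q) = (if i = j then p * q else 0) + Var i * (pd j p * q + p * pd j q)"
    using pd_Var_mult[of j i "p * q"] Var by (simp add: mult.assoc)
  then show ?case
    by (simp only: pd_Var_mult distrib_left distrib_right mult.assoc add.assoc if_distrib[of "\<lambda>r. r * q"] mult_zero_left)
qed (simp_all add: distrib_left distrib_right add_ac)

lemma pd_commute: "pd i (pd j p) = pd j (pd i p)"
proof (rule poly_mapping_eqI)
  fix \<alpha>
  show "Poly_Mapping.lookup (pd i (pd j p)) \<alpha> = Poly_Mapping.lookup (pd j (pd i p)) \<alpha>"
    by (cases "i = j") (auto simp: lookup_pd lookup_add lookup_single add_ac)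
qed

text \<open>This links the algebraic derivatives to the analytic ones, over the reals and over the complex
  numbers alike.\<close>

lemma ev_line_has_field_derivative:
  fixes a b :: "'v::finite \<Rightarrow> 'b::real_normed_field"
  shows "((\<lambda>v. ev p (\<lambda>i. a i + v * b i)) has_field_derivative
      (\<Sum>i\<in>UNIV. b i * ev (pd i p) (\<lambda>i. a i + v * b i))) (at v)"
proof (induction p rule: ring_induct)
  case (Const c)
  then show ?case by simp
next
  case (add p q)
  then show ?case by (auto intro!: derivative_eq_intros simp: distrib_left sum.distrib)
next
  case (Var j p)
  have "(\<Sum>i\<in>UNIV. b i * ev (pd i (Var j * p)) z) =
     (\<Sum>i\<in>UNIV. (if j = i then b i * ev p z else 0)) + z j * (\<Sum>i\<in>UNIV. b i * ev (pd i p) z)" for z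
    unfolding sum_distrib_left sum.distrib[symmetric]
    by (intro sum.cong refl) (simp add: pd_Var_mult distrib_left mult.left_commute)
  then show ?case
    using Var by (auto intro!: derivative_eq_intros simp: algebra_simps)
qed

text \<open>The coefficients are, up to positive factors, the values at the origin of the iterated
  derivatives, and all derivatives of the zero function vanish.\<close>

lemma ev_eq_0_imp_eq_0:
  fixes p :: "'v::finite real_mpoly"
  assumes "\<And>z :: 'v \<Rightarrow> real. ev p z = 0"
  shows "p = 0"
proof (rule poly_mapping_eqI)
  fix \<alpha> :: "'v \<Rightarrow>\<^sub>0 nat"
  have "Poly_Mapping.lookup p \<alpha> = 0" using assms
  proof (induction \<alpha> arbitrary: p rule: monomial_induct)
    case 0
    have "ev p (\<lambda>_. 0::real) = Poly_Mapping.lookup p 0" for p :: "'v real_mpoly"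
    proof (induction p rule: mpoly_induct)
      case (single a c)
      then show ?case
        by (auto simp: lookup_single when_def power_0_left elim!: mdeg_pos_obtain)
    qed (simp add: lookup_add)
    then show ?case using 0 by metis
  next
    case (Var i \<alpha>)
    have "ev (pd i p) z = 0" for z :: "'v \<Rightarrow> real"
    proof -
      let ?b = "\<lambda>k. if k = i then 1 else (0::real)"
      have "((\<lambda>v. ev p (\<lambda>k. z k + v * ?b k)) has_field_derivative
         (\<Sum>k\<in>UNIV. ?b k * ev (pd k p) (\<lambda>k. z k + 0 * ?b k))) (at 0)"
        by (rule ev_line_has_field_derivative)
      moreover have "(\<Sum>k\<in>UNIV. ?b k * ev (pd k p) (\<lambda>k. z k + 0 * ?b k)) = ev (pd i p) z"
        by (simp add: if_distrib[of "\<lambda>x. x * _"] cong: if_cong)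
      ultimately have "((\<lambda>v. 0::real) has_field_derivative ev (pd i p) z) (at 0)"
        using Var.prems by simp
      then show ?thesis by (metis DERIV_const DERIV_unique)
    qed
    from Var.IH[OF this] show ?case by (simp add: lookup_pd add.commute)
  qed
  then show "Poly_Mapping.lookup p \<alpha> = Poly_Mapping.lookup 0 \<alpha>" by simp
qed

lemma eval_mpoly_inject:
  fixes p q :: "'n::finite real_mpoly"
  assumes "\<And>x. eval_mpoly p x = eval_mpoly q x"
  shows "p = q"
proof -
  have "ev (p - q) z = 0" for z :: "'n \<Rightarrow> real"
    using assms[of "\<chi> i. z i"] by (simp add: eval_mpoly_eq_ev)
  from ev_eq_0_imp_eq_0[OF this] show ?thesis by simp
qed

section \<open>Degrees and sums of squares\<close>

lemma total_degree_le_iff: "total_degree p \<le> d \<longleftrightarrow> (\<forall>\<alpha>\<in>Poly_Mapping.keys p. mdeg \<alpha> \<le> d)"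
  unfolding total_degree_def mdeg_def by (subst Max_le_iff) auto

lemma total_degree_add: "total_degree p \<le> d \<Longrightarrow> total_degree q \<le> d \<Longrightarrow> total_degree (p + q) \<le> d"
  using keys_add[of p q] by (auto simp: total_degree_le_iff)

lemma total_degree_0 [simp]: "total_degree 0 = 0"
  by (simp add: total_degree_def)

lemma total_degree_sum: "(\<And>i. i \<in> A \<Longrightarrow> total_degree (p i) \<le> d) \<Longrightarrow> total_degree (\<Sum>i\<in>A. p i) \<le> d"
  by (induction A rule: infinite_finite_induct) (simp_all add: total_degree_add total_degree_0)

lemma total_degree_mult:
  assumes "total_degree p \<le> d" "total_degree q \<le> e"
  shows "total_degree (p * q) \<le> d + e"
  unfolding total_degree_le_iff
proof
  fix \<alpha> assume "\<alpha> \<in> Poly_Mapping.keys (p * q)"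
  then obtain a b where "\<alpha> = a + b" "a \<in> Poly_Mapping.keys p" "b \<in> Poly_Mapping.keys q"
    using keys_mult[of p q] by blast
  with assms show "mdeg \<alpha> \<le> d + e"
    unfolding total_degree_le_iff by (auto intro: add_mono)
qed

lemma total_degree_single: "total_degree (Poly_Mapping.single \<alpha> c) \<le> mdeg \<alpha>"
  by (auto simp: total_degree_le_iff)

lemma total_degree_Const [simp]: "total_degree (Const c) = 0"
  using total_degree_single[of 0 c] by (simp add: Const_def)

lemma total_degree_Var: "total_degree (Var i) \<le> 1"
  using total_degree_single[of "Poly_Mapping.single i 1" 1] by (simp add: Var_def)

lemma total_degree_power: "total_degree p \<le> d \<Longrightarrow> total_degree (p ^ k) \<le> k * d"
proof (induction k)
  case 0
  show ?case using total_degree_Const[of 1] by (simp add: Const_def)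
next
  case (Suc k)
  then show ?case using total_degree_mult[of p d "p ^ k" "k * d"] by simp
qed

lemma total_degree_theta: "total_degree (theta :: 'n::finite real_mpoly) \<le> 2"
proof -
  have "total_degree ((Var i)\<^sup>2 :: 'n real_mpoly) \<le> 2" for i
    using total_degree_power[OF total_degree_Var[of i], of 2] by simp
  moreover have "total_degree (1 :: 'n real_mpoly) \<le> 2"
    using total_degree_Const[of 1, where 'a = 'n] by (simp add: Const_def)
  ultimately show ?thesis
    unfolding theta_def norm_sq_def by (intro total_degree_add total_degree_sum)
qed

lemma is_sos_square: "is_sos (p\<^sup>2)"
  unfolding is_sos_def by (rule exI[of _ 1], rule exI[of _ "\<lambda>_. p"]) simp

lemma is_sos_0: "is_sos 0"
  unfolding is_sos_def by (rule exI[of _ 0]) simp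

lemma is_sos_add:
  assumes "is_sos p" "is_sos q"
  shows "is_sos (p + q)"
proof -
  obtain r a where p: "p = (\<Sum>i<(r::nat). (a i)\<^sup>2)"
    using assms(1) unfolding is_sos_def by (elim exE)
  obtain s b where q: "q = (\<Sum>i<(s::nat). (b i)\<^sup>2)"
    using assms(2) unfolding is_sos_def by (elim exE)
  let ?c = "\<lambda>i::nat. if i < r then a i else b (i - r)"
  have "(\<Sum>i<r + s. (?c i)\<^sup>2) = (\<Sum>i<r. (?c i)\<^sup>2) + (\<Sum>i\<in>{r..<r + s}. (?c i)\<^sup>2)"
    by (subst sum.union_disjoint[symmetric]) (auto intro!: sum.cong)
  also have "(\<Sum>i\<in>{r..<r + s}. (?c i)\<^sup>2) = (\<Sum>i<s. (b i)\<^sup>2)"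
    by (rule sum.reindex_bij_witness[of _ "\<lambda>i. i + r" "\<lambda>i. i - r"]) auto
  finally show ?thesis
    unfolding is_sos_def p q by (intro exI[of _ "r + s"] exI[of _ ?c]) simp
qed

lemma is_sos_sum: "(\<And>i. i \<in> A \<Longrightarrow> is_sos (p i)) \<Longrightarrow> is_sos (\<Sum>i\<in>A. p i)"
  by (induction A rule: infinite_finite_induct) (auto intro: is_sos_add is_sos_0)

lemma is_sos_mult:
  assumes "is_sos p" "is_sos q"
  shows "is_sos (p * q)"
proof -
  obtain r a where p: "p = (\<Sum>i<(r::nat). (a i)\<^sup>2)"
    using assms(1) unfolding is_sos_def by (elim exE)
  obtain s b where q: "q = (\<Sum>i<(s::nat). (b i)\<^sup>2)"
    using assms(2) unfolding is_sos_def by (elim exE)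
  have "p * q = (\<Sum>i<r. \<Sum>j<s. (a i * b j)\<^sup>2)"
    unfolding p q sum_product by (simp add: power_mult_distrib)
  then show ?thesis by (simp add: is_sos_sum is_sos_square)
qed

lemma is_sos_Const:
  assumes "c \<ge> 0" shows "is_sos (Const c :: 'v real_mpoly)"
proof -
  have "(Const c :: 'v real_mpoly) = (Const (sqrt c))\<^sup>2"
    unfolding power2_eq_square Const_mult[symmetric] using assms by simp
  then show ?thesis by (simp add: is_sos_square)
qed

lemma is_sos_power: "is_sos p \<Longrightarrow> is_sos (p ^ k)"
  by (induction k) (use is_sos_square[of 1] in \<open>auto intro: is_sos_mult\<close>)

lemma is_sos_theta: "is_sos theta"
  unfolding theta_def norm_sq_def
  using is_sos_square[of 1] by (auto intro!: is_sos_add is_sos_sum is_sos_square)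

text \<open>Identities between polynomials are proved as identities between functions: a polynomial is
  determined by its values. The index of \<open>sosf\<close> is half of the degree bound.\<close>

definition polyf :: "nat \<Rightarrow> (real ^ 'n::finite \<Rightarrow> real) \<Rightarrow> bool"
  where "polyf d F \<longleftrightarrow> (\<exists>p. total_degree p \<le> d \<and> (\<forall>x. eval_mpoly p x = F x))"

definition sosf :: "nat \<Rightarrow> (real ^ 'n::finite \<Rightarrow> real) \<Rightarrow> bool"
  where "sosf d F \<longleftrightarrow> (\<exists>p. is_sos p \<and> total_degree p \<le> 2 * d \<and> (\<forall>x. eval_mpoly p x = F x))"

lemma polyf_const: "polyf d (\<lambda>x. c)"
  unfolding polyf_def by (rule exI[of _ "Const c"]) (simp add: eval_mpoly_eq_ev)

lemma polyf_coord: "d \<ge> 1 \<Longrightarrow> polyf d (\<lambda>x. x $ i)"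
  unfolding polyf_def by (rule exI[of _ "Var i"]) (use total_degree_Var[of i] in \<open>auto simp: eval_mpoly_eq_ev\<close>)

lemma polyf_add: "polyf d F \<Longrightarrow> polyf d G \<Longrightarrow> polyf d (\<lambda>x. F x + G x)"
  unfolding polyf_def by (elim exE, rename_tac p q, rule_tac x = "p + q" in exI)
    (auto simp: total_degree_add eval_mpoly_eq_ev)

lemma polyf_mult: "polyf d F \<Longrightarrow> polyf e G \<Longrightarrow> polyf (d + e) (\<lambda>x. F x * G x)"
  unfolding polyf_def by (elim exE, rename_tac p q, rule_tac x = "p * q" in exI)
    (auto simp: total_degree_mult eval_mpoly_eq_ev)

lemma polyf_sum: "(\<And>i. i \<in> A \<Longrightarrow> polyf d (F i)) \<Longrightarrow> polyf d (\<lambda>x. \<Sum>i\<in>A. F i x)"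
  by (induction A rule: infinite_finite_induct) (auto intro: polyf_const polyf_add)

lemma polyf_cmult: "polyf d F \<Longrightarrow> polyf d (\<lambda>x. c * F x)"
  using polyf_mult[OF polyf_const[of 0 c]] by simp

lemma sosf_square: "polyf d F \<Longrightarrow> sosf d (\<lambda>x. (F x)\<^sup>2)"
  unfolding polyf_def sosf_def
  by (elim exE, rename_tac p, rule_tac x = "p\<^sup>2" in exI)
    (use total_degree_power[of _ d 2] in \<open>auto simp: eval_mpoly_eq_ev is_sos_square\<close>)

lemma sosf_add: "sosf d F \<Longrightarrow> sosf d G \<Longrightarrow> sosf d (\<lambda>x. F x + G x)"
  unfolding sosf_def by (elim exE, rename_tac p q, rule_tac x = "p + q" in exI)
    (auto simp: total_degree_add eval_mpoly_eq_ev is_sos_add)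

lemma sosf_0: "sosf d (\<lambda>x. 0)"
  unfolding sosf_def by (rule exI[of _ 0]) (auto simp: is_sos_0 eval_mpoly_eq_ev total_degree_le_iff)

lemma sosf_sum: "(\<And>i. i \<in> A \<Longrightarrow> sosf d (F i)) \<Longrightarrow> sosf d (\<lambda>x. \<Sum>i\<in>A. F i x)"
  by (induction A rule: infinite_finite_induct) (auto intro: sosf_0 sosf_add)

lemma sosf_mult: "sosf d F \<Longrightarrow> sosf e G \<Longrightarrow> sosf (d + e) (\<lambda>x. F x * G x)"
  unfolding sosf_def by (elim exE, rename_tac p q, rule_tac x = "p * q" in exI)
    (use total_degree_mult[of _ "2 * d" _ "2 * e"] in \<open>auto simp: eval_mpoly_eq_ev is_sos_mult\<close>)

lemma sosf_const: "c \<ge> 0 \<Longrightarrow> sosf d (\<lambda>x. c)"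
  unfolding sosf_def by (rule exI[of _ "Const c"]) (auto simp: eval_mpoly_eq_ev is_sos_Const)

lemma sosf_cmult: "c \<ge> 0 \<Longrightarrow> sosf d F \<Longrightarrow> sosf d (\<lambda>x. c * F x)"
  using sosf_mult[of 0 "\<lambda>_. c" d F] sosf_const[of c 0] by simp

lemma sosf_theta_power: "sosf k (\<lambda>x :: real ^ 'n::finite. (1 + (norm x)\<^sup>2) ^ k)"
  unfolding sosf_def
  by (rule exI[of _ "theta ^ k"])
    (use total_degree_power[OF total_degree_theta, of k, where 'a='n] in
      \<open>auto simp: is_sos_power is_sos_theta eval_theta eval_mpoly_eq_ev[of "theta ^ k"]
        simp flip: eval_mpoly_eq_ev[of theta]\<close>)

section \<open>Derivatives of forms on the sphere\<close>

definition hom :: "nat \<Rightarrow> 'v::finite real_mpoly \<Rightarrow> bool"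
  where "hom d p \<longleftrightarrow> (\<forall>\<alpha>\<in>Poly_Mapping.keys p. mdeg \<alpha> = d)"

lemma hom_iff: "hom d p \<longleftrightarrow> (\<forall>\<alpha>. mdeg \<alpha> \<noteq> d \<longrightarrow> Poly_Mapping.lookup p \<alpha> = 0)"
  by (auto simp: hom_def in_keys_iff)

lemma hom_0 [simp]: "hom d 0"
  by (simp add: hom_def)

lemma hom_add: "hom d p \<Longrightarrow> hom d q \<Longrightarrow> hom d (p + q)"
  by (auto simp: hom_iff lookup_add)

lemma hom_diff: "hom d p \<Longrightarrow> hom d q \<Longrightarrow> hom d (p - q)"
  by (auto simp: hom_iff lookup_minus)

lemma hom_sum: "(\<And>i. i \<in> A \<Longrightarrow> hom d (p i)) \<Longrightarrow> hom d (\<Sum>i\<in>A. p i)"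
  by (induction A rule: infinite_finite_induct) (auto intro: hom_add)

lemma hom_Const_mult: "hom d p \<Longrightarrow> hom d (Const c * p)"
  by (auto simp: hom_iff)

lemma hom_mult:
  assumes "hom d p" "hom e q"
  shows "hom (d + e) (p * q)"
  unfolding hom_def
proof
  fix \<alpha> assume "\<alpha> \<in> Poly_Mapping.keys (p * q)"
  then obtain a b where "\<alpha> = a + b" "a \<in> Poly_Mapping.keys p" "b \<in> Poly_Mapping.keys q"
    using keys_mult[of p q] by blast
  with assms show "mdeg \<alpha> = d + e" by (auto simp: hom_def)
qed

lemma hom_1: "hom 0 1"
  by (auto simp: hom_def)

lemma hom_power: "hom d p \<Longrightarrow> hom (k * d) (p ^ k)"
  by (induction k) (auto intro: hom_1 hom_mult)

lemma hom_norm_sq: "hom 2 norm_sq"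
proof -
  have "hom 1 (Var i)" for i :: 'a by (auto simp: hom_def Var_def)
  then show ?thesis
    unfolding norm_sq_def using hom_power[of 1 _ 2] by (auto intro!: hom_sum)
qed

lemma hom_pd: "hom d p \<Longrightarrow> hom (d - 1) (pd i p)"
  by (auto simp: hom_iff lookup_pd)

lemma hom_0_pd: "hom 0 p \<Longrightarrow> pd i p = 0"
  by (intro poly_mapping_eqI) (simp add: hom_iff lookup_pd single_neq_0_nat[simplified])

lemma ev_hom_scale: "hom d p \<Longrightarrow> ev p (\<lambda>i. c * z i) = c ^ d * ev p z"
  unfolding ev_def sum_distrib_left
  by (intro sum.cong refl)
    (auto simp: hom_def mdeg_def power_mult_distrib prod.distrib power_sum[symmetric] algebra_simps)

lemma eval_norm_sq: "eval_mpoly norm_sq x = (norm x)\<^sup>2"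
  by (simp add: eval_mpoly_eq_ev norm_sq_def norm_vec_sq)

lemma eval_hom_scaleR: "hom d p \<Longrightarrow> eval_mpoly p (c *\<^sub>R x) = c ^ d * eval_mpoly p x"
  using ev_hom_scale[of d p c "\<lambda>i. x $ i"] by (simp add: eval_mpoly_eq_ev)

text \<open>\<open>B\<close> bounds the form on the unit sphere; homogeneity carries the bound to the whole space.\<close>

definition bounded_form :: "nat \<Rightarrow> real \<Rightarrow> 'v::finite real_mpoly \<Rightarrow> bool"
  where "bounded_form d B H \<longleftrightarrow> hom d H \<and> (\<forall>y. \<bar>eval_mpoly H y\<bar> \<le> B * norm y ^ d)"

lemma bounded_form_nonneg: "bounded_form d B (H :: 'v::finite real_mpoly) \<Longrightarrow> B \<ge> 0"
proof -
  assume "bounded_form d B H"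
  then have "\<bar>eval_mpoly H (axis undefined 1)\<bar> \<le> B * norm (axis (undefined :: 'v) (1::real)) ^ d"
    unfolding bounded_form_def by blast
  then show ?thesis by (simp add: norm_axis_1) 
qed

lemma one_plus_inverse_power_le: "d \<ge> 1 \<Longrightarrow> (1 + 1 / real d) ^ d \<le> 3"
proof -
  assume d: "d \<ge> 1"
  have "(1 + 1 / real d) ^ d \<le> exp (1 / real d) ^ d"
    by (intro power_mono exp_ge_add_one_self) auto
  also have "\<dots> = exp 1" using d by (simp add: exp_of_nat_mult[symmetric])
  also have "\<dots> \<le> 3" by (rule exp_le)
  finally show ?thesis .
qed

text \<open>On the great circle through \<open>y\<close> and \<open>u\<close> the form is, up to a factor of modulus one, a complex
  polynomial of degree \<open>d\<close> in \<open>v = exp (2 \<i> \<phi>)\<close>. The maximum principle, applied to it and to its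
  reversal, bounds it by \<open>B max(1, \<bar>v\<bar>)\<^sup>d\<close>, and Cauchy's estimate on a circle of radius \<open>1/d\<close> bounds
  its derivative at \<open>v = 1\<close>, whose real and imaginary parts are, up to factors, the radial
  and the tangential derivative. This replaces the inequality of Bernstein at the price of a constant; what matters is
  that the bound is polynomial in \<open>d\<close>. The case \<open>u = 0\<close> serves when the gradient is radial.\<close>

lemma great_circle_derivative_bound:
  fixes H :: "'v::finite real_mpoly"
  assumes H: "bounded_form d B H" and d: "d \<ge> 1"
    and yu: "norm y = 1" "norm u \<le> 1" "y \<bullet> u = 0"
  shows "\<bar>\<Sum>i\<in>UNIV. y $ i * eval_mpoly (pd i H) y\<bar> \<le> 6 * real d * B"
    and "\<bar>\<Sum>i\<in>UNIV. u $ i * eval_mpoly (pd i H) y\<bar> \<le> 6 * real d * B"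
proof -
  have hom: "hom d H" and bd: "\<And>y. \<bar>eval_mpoly H y\<bar> \<le> B * norm y ^ d"
    using H by (auto simp: bounded_form_def)
  define a b where "a i = (complex_of_real (y $ i) + \<i> * complex_of_real (u $ i)) / 2"
    and "b i = (complex_of_real (y $ i) - \<i> * complex_of_real (u $ i)) / 2" for i
  define W where "W v = ev H (\<lambda>i. a i + v * b i)" for v
  define W' where "W' v = ev H (\<lambda>i. b i + v * a i)" for v
  have W_circle: "norm (W v) \<le> B" if v: "norm v = 1" for v
  proof -
    obtain \<phi> where \<phi>: "v = cis (2 * \<phi>)"
    proof
      have "v \<noteq> 0" using v by auto
      then have "cis (Arg v) = v" using cis_Arg[of v] v by (simp add: sgn_div_norm)
      then show "v = cis (2 * (Arg v / 2))" by simp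
    qed
    have "a i + v * b i = cis \<phi> * of_real ((cos \<phi> *\<^sub>R y + sin \<phi> *\<^sub>R u) $ i)" for i
    proof -
      have "v = cis \<phi> * cis \<phi>" by (simp add: \<phi> cis_mult)
      moreover have "cis \<phi> * cis (- \<phi>) = 1" by (simp add: cis_mult)
      ultimately have "a i + v * b i = cis \<phi> * (cis (- \<phi>) * a i + cis \<phi> * b i)"
        by (simp add: algebra_simps)
      also have "cis (- \<phi>) * a i + cis \<phi> * b i = of_real ((cos \<phi> *\<^sub>R y + sin \<phi> *\<^sub>R u) $ i)"
        by (simp add: a_def b_def complex_eq_iff field_simps)
      finally show ?thesis .
    qed
    then have "W v = cis \<phi> ^ d * of_real (eval_mpoly H (cos \<phi> *\<^sub>R y + sin \<phi> *\<^sub>R u))"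
      unfolding W_def by (simp add: ev_hom_scale[OF hom] ev_of_real eval_mpoly_eq_ev del: of_real_add of_real_mult)
    moreover have "norm (cos \<phi> *\<^sub>R y + sin \<phi> *\<^sub>R u) \<le> 1"
    proof -
      have "y \<bullet> y = 1" using yu by (simp add: dot_square_norm)
      then have "(norm (cos \<phi> *\<^sub>R y + sin \<phi> *\<^sub>R u))\<^sup>2 = (cos \<phi>)\<^sup>2 + (sin \<phi>)\<^sup>2 * (norm u)\<^sup>2"
        unfolding power2_norm_eq_inner using yu(3)
        by (simp add: inner_add_left inner_add_right inner_commute[of u y] power2_eq_square)
      also have "\<dots> \<le> (cos \<phi>)\<^sup>2 + (sin \<phi>)\<^sup>2 * 1"
        using yu(2) by (intro add_left_mono mult_left_mono power_le_one) auto
      finally show ?thesis by (simp add: power2_le_iff_abs_le abs_square_le_1)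
    qed
    then have "B * norm (cos \<phi> *\<^sub>R y + sin \<phi> *\<^sub>R u) ^ d \<le> B * 1"
      by (intro mult_left_mono power_le_one bounded_form_nonneg[OF H]) auto
    ultimately show ?thesis using bd[of "cos \<phi> *\<^sub>R y + sin \<phi> *\<^sub>R u"]
      by (simp add: norm_mult norm_power)
  qed
  \<comment> \<open>\<open>W'\<close> is the polynomial \<open>W\<close> with its coefficients in reversed order.\<close>
  have rev: "W v = v ^ d * W' (1 / v)" if "v \<noteq> 0" for v
  proof -
    have "(\<lambda>i. a i + v * b i) = (\<lambda>i. v * (b i + 1 / v * a i))"
      using that by (auto simp: field_simps)
    then show ?thesis unfolding W_def W'_def by (simp only: ev_hom_scale[OF hom])
  qed
  have W'_deriv: "\<exists>D. (W' has_field_derivative D) (at v)" for v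
    unfolding W'_def using ev_line_has_field_derivative[of H b a v] by blast
  have W'_hol: "W' holomorphic_on S" for S
    using W'_deriv by (meson field_differentiable_at_within field_differentiable_def holomorphic_on_def)
  have W'_disc: "norm (W' v) \<le> B" if v: "norm v \<le> 1" for v
  proof (rule maximum_modulus_frontier[of W' "cball 0 1"])
    fix z :: complex assume "z \<in> frontier (cball 0 1)"
    then have z: "norm z = 1" by (simp add: frontier_cball)
    then have "norm (W' z) = norm (W (1 / z))"
    proof -
      have "z \<noteq> 0" using z by auto
      then show ?thesis using rev[of "1 / z"] z by (simp add: norm_mult norm_power norm_divide)
    qed
    also have "\<dots> \<le> B" using z by (intro W_circle) (simp add: norm_divide)
    finally show "norm (W' z) \<le> B" .
  qed (use v W'_hol in \<open>auto intro: holomorphic_on_imp_continuous_on\<close>)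
  have Bnn: "B \<ge> 0" by (rule bounded_form_nonneg[OF H])
  have W_deriv: "(W has_field_derivative (\<Sum>i\<in>UNIV. b i * ev (pd i H) (\<lambda>i. a i + v * b i))) (at v)" for v
    unfolding W_def by (rule ev_line_has_field_derivative)
  have W_hol: "W holomorphic_on S" for S
    using W_deriv by (meson field_differentiable_at_within field_differentiable_def holomorphic_on_def)
  have W_disc: "norm (W v) \<le> B * max 1 (norm v) ^ d" for v
  proof (cases "norm v \<le> 1")
    case True
    have "norm (W v) \<le> B"
      by (rule maximum_modulus_frontier[of W "cball 0 1"])
        (use True W_hol in \<open>auto intro: holomorphic_on_imp_continuous_on W_circle simp: frontier_cball\<close>)
    then show ?thesis using True by (simp add: max_def)
  next
    case False
    then have "norm (W' (1 / v)) \<le> B" by (intro W'_disc) (simp add: norm_divide divide_simps)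
    then have "norm v ^ d * norm (W' (1 / v)) \<le> norm v ^ d * B" by (intro mult_left_mono) auto
    moreover have "norm (W v) = norm v ^ d * norm (W' (1 / v))"
    proof -
      have "v \<noteq> 0" using False by auto
      from rev[OF this] show ?thesis by (simp add: norm_mult norm_power)
    qed
    ultimately show ?thesis using False by (simp add: max_def mult.commute)
  qed
  have "norm ((deriv ^^ 1) W 1) \<le> fact 1 * (B * 3) / (1 / real d) ^ 1"
  proof (rule Cauchy_inequality)
    fix x :: complex assume "norm (1 - x) = 1 / real d"
    then have "norm x \<le> 1 + 1 / real d"
      using norm_triangle_sub[of x 1] by (simp add: norm_minus_commute)
    then have "max 1 (norm x) ^ d \<le> (1 + 1 / real d) ^ d" by (intro power_mono) auto
    also have "\<dots> \<le> 3" using one_plus_inverse_power_le[OF d] .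
    finally have "B * max 1 (norm x) ^ d \<le> B * 3" using Bnn by (rule mult_left_mono)
    then show "norm (W x) \<le> B * 3" using W_disc[of x] by linarith
  qed (use d W_hol in \<open>auto intro: holomorphic_on_imp_continuous_on\<close>)
  then have D: "norm (deriv W 1) \<le> 3 * real d * B" using d by (simp add: field_simps)
  have "deriv W 1 = (\<Sum>i\<in>UNIV. b i * ev (pd i H) (\<lambda>i. a i + 1 * b i))"
    using W_deriv[of 1] by (rule DERIV_imp_deriv)
  also have "(\<lambda>i. a i + 1 * b i) = (\<lambda>i. of_real (y $ i))"
    by (auto simp: a_def b_def field_simps)
  also have "(\<Sum>i\<in>UNIV. b i * ev (pd i H) (\<lambda>i. of_real (y $ i))) =
      (\<Sum>i\<in>UNIV. b i * of_real (eval_mpoly (pd i H) y))"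
    by (simp add: ev_of_real eval_mpoly_eq_ev)
  finally have deriv: "deriv W 1 = (\<Sum>i\<in>UNIV. b i * of_real (eval_mpoly (pd i H) y))" .
  have "Re (deriv W 1) = (\<Sum>i\<in>UNIV. y $ i * eval_mpoly (pd i H) y) / 2"
    and "Im (deriv W 1) = - (\<Sum>i\<in>UNIV. u $ i * eval_mpoly (pd i H) y) / 2"
    unfolding deriv by (simp_all add: b_def sum_divide_distrib sum_negf[symmetric])
  then show "\<bar>\<Sum>i\<in>UNIV. y $ i * eval_mpoly (pd i H) y\<bar> \<le> 6 * real d * B"
    and "\<bar>\<Sum>i\<in>UNIV. u $ i * eval_mpoly (pd i H) y\<bar> \<le> 6 * real d * B"
    using D abs_Re_le_cmod[of "deriv W 1"] abs_Im_le_cmod[of "deriv W 1"] by simp_all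
qed

lemma unit_vector_exists_scale:
  fixes y :: "real ^ 'v::finite"
  shows "\<exists>e. norm e = 1 \<and> y = norm y *\<^sub>R e"
proof (cases "y = 0")
  case True
  then show ?thesis by (intro exI[of _ "axis undefined 1"]) (simp add: norm_axis_1)
next
  case False
  then show ?thesis by (intro exI[of _ "y /\<^sub>R norm y"]) auto
qed

text \<open>The gradient has a radial and a tangential part; the great circle in the direction of the
  tangential part controls both.\<close>

lemma bounded_form_pd:
  fixes H :: "'v::finite real_mpoly"
  assumes H: "bounded_form d B H"
  shows "bounded_form (d - 1) (12 * real d * B) (pd i H)"
proof (cases "d = 0")
  case True
  then show ?thesis using H hom_0_pd[of H i] by (auto simp: bounded_form_def eval_mpoly_eq_ev)
next
  case False
  then have d: "d \<ge> 1" by simp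
  have hom: "hom (d - 1) (pd i H)" using H hom_pd by (auto simp: bounded_form_def)
  have sphere: "\<bar>eval_mpoly (pd i H) y\<bar> \<le> 12 * real d * B" if y: "norm y = 1" for y
  proof -
    define w where "w = (\<chi> i. eval_mpoly (pd i H) y)"
    define r where "r = w - (y \<bullet> w) *\<^sub>R y"
    have yy: "y \<bullet> y = 1" using y by (simp add: dot_square_norm)
    have inner_w: "v \<bullet> w = (\<Sum>i\<in>UNIV. v $ i * eval_mpoly (pd i H) y)" for v
      by (simp add: inner_vec_def w_def)
    define u where "u = r /\<^sub>R norm r"
    have yr: "y \<bullet> r = 0" by (simp add: r_def inner_diff_right yy)
    then have u: "norm u \<le> 1" "y \<bullet> u = 0" by (cases "r = 0"; simp add: u_def)+
    have "r \<bullet> w = r \<bullet> (r + (y \<bullet> w) *\<^sub>R y)" by (simp add: r_def)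
    then have "r \<bullet> w = r \<bullet> r" using yr by (simp add: inner_add_right inner_commute[of r y])
    then have "u \<bullet> w = norm r"
      by (cases "r = 0") (simp_all add: u_def dot_square_norm power2_eq_square)
    then have six: "norm r \<le> 6 * real d * B" "\<bar>y \<bullet> w\<bar> \<le> 6 * real d * B"
      using great_circle_derivative_bound[OF H d y u] by (simp_all add: inner_w)
    have "\<bar>eval_mpoly (pd i H) y\<bar> = \<bar>w $ i\<bar>" by (simp add: w_def)
    also have "\<dots> \<le> norm w" by (rule component_le_norm_cart)
    finally have wi: "\<bar>eval_mpoly (pd i H) y\<bar> \<le> norm w" .
    have wdec: "w = r + (y \<bullet> w) *\<^sub>R y" by (simp add: r_def)
    have "norm w \<le> norm r + \<bar>y \<bullet> w\<bar>"
      using norm_triangle_ineq[of r "(y \<bullet> w) *\<^sub>R y"] wdec y by simp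
    with six wi show ?thesis by linarith
  qed
  have "\<bar>eval_mpoly (pd i H) y\<bar> \<le> 12 * real d * B * norm y ^ (d - 1)" for y
  proof -
    obtain e where e: "norm e = 1" "y = norm y *\<^sub>R e" using unit_vector_exists_scale by blast
    have "eval_mpoly (pd i H) y = norm y ^ (d - 1) * eval_mpoly (pd i H) e"
      by (subst e(2)) (simp add: eval_hom_scaleR[OF hom])
    then have "\<bar>eval_mpoly (pd i H) y\<bar> = norm y ^ (d - 1) * \<bar>eval_mpoly (pd i H) e\<bar>"
      by (simp add: abs_mult)
    also have "\<dots> \<le> norm y ^ (d - 1) * (12 * real d * B)"
      by (intro mult_left_mono sphere e(1)) auto
    finally show ?thesis by (simp add: mult.commute)
  qed
  with hom show ?thesis by (simp add: bounded_form_def)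
qed

text \<open>The coefficients are iterated derivatives, so a form that is tiny on the sphere has tiny
  coefficients. The constant depends on the degree exponentially, which is harmless because it is only
  used in a limit.\<close>

lemma bounded_form_lookup:
  assumes "bounded_form d B H" "mdeg \<alpha> = d" "d \<le> D"
  shows "\<bar>Poly_Mapping.lookup H \<alpha>\<bar> \<le> (12 * real D) ^ d * B"
  using assms
proof (induction \<alpha> arbitrary: d B H rule: monomial_induct)
  case 0
  then have "d = 0" and H: "bounded_form 0 B H" by auto
  have "H = Const (Poly_Mapping.lookup H 0)"
    using H by (intro poly_mapping_eqI) (auto simp: bounded_form_def hom_iff Const_def lookup_single when_def)
  then have "eval_mpoly H 0 = Poly_Mapping.lookup H 0"
    by (metis ev_Const eval_mpoly_eq_ev of_real_eq_id id_apply)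
  moreover have "\<bar>eval_mpoly H 0\<bar> \<le> B * norm (0 :: real ^ 'a) ^ 0"
    using H unfolding bounded_form_def by blast
  ultimately show ?case using \<open>d = 0\<close> by simp
next
  case (Var i \<alpha>)
  then have d: "d = Suc (mdeg \<alpha>)" by simp
  have B: "B \<ge> 0" by (rule bounded_form_nonneg[OF Var.prems(1)])
  have "\<bar>Poly_Mapping.lookup H (Poly_Mapping.single i 1 + \<alpha>)\<bar> \<le> \<bar>Poly_Mapping.lookup (pd i H) \<alpha>\<bar>"
    unfolding lookup_pd abs_mult add.commute[of \<alpha>]
    using mult_right_mono[of 1 "\<bar>real (Suc (Poly_Mapping.lookup \<alpha> i))\<bar>"
        "\<bar>Poly_Mapping.lookup H (Poly_Mapping.single i 1 + \<alpha>)\<bar>"] by simp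
  also have "\<dots> \<le> (12 * real D) ^ (d - 1) * (12 * real d * B)"
    by (intro Var.IH bounded_form_pd Var.prems) (use d Var.prems in auto)
  also have "\<dots> \<le> (12 * real D) ^ (d - 1) * (12 * real D * B)"
    using Var.prems(3) B by (intro mult_left_mono mult_right_mono) auto
  also have "\<dots> = (12 * real D) ^ d * B" using d by simp
  finally show ?case .
qed

definition lap :: "'v::finite real_mpoly \<Rightarrow> 'v real_mpoly"
  where "lap p = (\<Sum>i\<in>UNIV. pd i (pd i p))"

lemma lap_add [simp]: "lap (p + q) = lap p + lap q"
  by (simp add: lap_def sum.distrib)

lemma lap_0 [simp]: "lap 0 = 0"
  by (simp add: lap_def)

lemma lap_Const_mult [simp]: "lap (Const c * p) = Const c * lap p"
  by (simp add: lap_def sum_distrib_left)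

lemma lap_pow_add [simp]: "(lap ^^ j) (p + q) = (lap ^^ j) p + (lap ^^ j) q"
  by (induction j) auto

lemma lap_pow_0 [simp]: "(lap ^^ j) 0 = 0"
  by (induction j) auto

lemma hom_lap: "hom d p \<Longrightarrow> hom (d - 2) (lap p)"
  unfolding lap_def by (intro hom_sum) (use hom_pd[of "d - 1"] hom_pd[of d p] in \<open>auto simp: numeral_2_eq_2\<close>)

lemma hom_lap_pow: "hom d p \<Longrightarrow> hom (d - 2 * j) ((lap ^^ j) p)"
  by (induction j) (use hom_lap in \<open>fastforce+\<close>)

lemma lap_eq_0: "hom d p \<Longrightarrow> d < 2 \<Longrightarrow> lap p = 0"
proof -
  assume "hom d p" "d < 2"
  then have "hom 0 (pd i p)" for i using hom_pd[of d p i] by (cases d) auto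
  then show "lap p = 0" by (simp add: lap_def hom_0_pd)
qed

lemma lap_pow_eq_0: "hom d p \<Longrightarrow> d < 2 * j \<Longrightarrow> (lap ^^ j) p = 0"
proof (induction j)
  case (Suc j)
  then show ?case
    using lap_eq_0[OF hom_lap_pow[OF Suc.prems(1), of j]] by (cases "d < 2 * j") auto
qed simp

lemma bounded_form_lap:
  fixes p :: "'v::finite real_mpoly"
  assumes p: "bounded_form d B p" "d \<le> D"
  shows "bounded_form (d - 2) (real CARD('v) * (12 * real D)\<^sup>2 * B) (lap p)"
proof -
  have B: "B \<ge> 0" by (rule bounded_form_nonneg[OF p(1)])
  have "bounded_form (d - 2) (12 * real (d - 1) * (12 * real d * B)) (pd i (pd i p))" for i
    using bounded_form_pd[OF bounded_form_pd[OF p(1), of i], of i] by (simp add: numeral_2_eq_2)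
  then have b: "\<bar>eval_mpoly (pd i (pd i p)) y\<bar> \<le> 12 * real (d - 1) * (12 * real d * B) * norm y ^ (d - 2)" for i y
    unfolding bounded_form_def by blast
  have "\<bar>eval_mpoly (lap p) y\<bar> \<le> real CARD('v) * (12 * real D)\<^sup>2 * B * norm y ^ (d - 2)" for y
  proof -
    have "\<bar>eval_mpoly (lap p) y\<bar> = \<bar>\<Sum>i\<in>UNIV. eval_mpoly (pd i (pd i p)) y\<bar>"
      by (simp add: lap_def eval_mpoly_eq_ev)
    also have "\<dots> \<le> (\<Sum>i\<in>UNIV. \<bar>eval_mpoly (pd i (pd i p)) y\<bar>)" by (rule sum_abs)
    also have "\<dots> \<le> (\<Sum>i\<in>(UNIV :: 'v set). 12 * real D * (12 * real D * B) * norm y ^ (d - 2))"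
    proof (rule sum_mono)
      fix i
      have "12 * real (d - 1) * (12 * real d * B) * norm y ^ (d - 2) \<le> 12 * real D * (12 * real D * B) * norm y ^ (d - 2)"
        using p(2) B by (intro mult_right_mono mult_mono) auto
      with b[of i y] show "\<bar>eval_mpoly (pd i (pd i p)) y\<bar> \<le> 12 * real D * (12 * real D * B) * norm y ^ (d - 2)"
        by linarith
    qed
    also have "\<dots> = real CARD('v) * (12 * real D)\<^sup>2 * B * norm y ^ (d - 2)"
      by (simp add: power2_eq_square)
    finally show ?thesis .
  qed
  then show ?thesis using hom_lap p(1) by (auto simp: bounded_form_def)
qed

lemma bounded_form_lap_pow:
  fixes p :: "'v::finite real_mpoly"
  assumes p: "bounded_form d B p"
  shows "bounded_form (d - 2 * j) ((real CARD('v) * (12 * real d)\<^sup>2) ^ j * B) ((lap ^^ j) p)"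
proof (induction j)
  case (Suc j)
  from bounded_form_lap[OF Suc, of d] show ?case by (simp add: mult.assoc)
qed (use p in simp)

section \<open>Gaussian expectations of polynomials\<close>

text \<open>Gaussian expectations serve as a positive functional on polynomials that is invariant under
  rotations and has explicit moments.\<close>

definition gauss :: "real measure"
  where "gauss = density lborel (\<lambda>x. ennreal (normal_density 0 1 x))"

definition mom :: "nat \<Rightarrow> real"
  where "mom k = (if even k then fact k / (2 ^ (k div 2) * fact (k div 2)) else 0)"

text \<open>Integration by parts against the normal density, in terms of moments.\<close>

lemma mom_Suc: "mom (Suc k) = real k * mom (k - 1)"
proof (cases "even k")
  case True
  then show ?thesis by (cases k) (auto simp: mom_def)
next
  case False
  then obtain l where k: "k = Suc (2 * l)" by (metis oddE Suc_eq_plus1)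
  have "mom (Suc k) = fact (2 * Suc l) / (2 ^ Suc l * fact (Suc l))"
    by (simp add: mom_def k)
  also have "fact (2 * Suc l) = (2 * real (Suc l)) * real k * fact (2 * l)"
    by (simp add: k algebra_simps)
  also have "\<dots> / (2 ^ Suc l * fact (Suc l)) = real k * (fact (2 * l) / (2 ^ l * fact l))"
    by (simp add: field_simps del: of_nat_Suc)
  finally show ?thesis by (simp add: mom_def k)
qed

lemma gauss_moment: "has_bochner_integral gauss (\<lambda>x. x ^ k) (mom k)"
proof -
  have "has_bochner_integral lborel (\<lambda>x. normal_density 0 1 x * x ^ k) (mom k)"
  proof (cases "even k")
    case True
    then obtain l where k: "k = 2 * l" by (rule evenE)
    show ?thesis
      using normal_moment_even[of 1 0 l] by (simp add: k mom_def)
  next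
    case False
    then obtain l where k: "k = 2 * l + 1" by (rule oddE)
    show ?thesis
      using normal_moment_odd[of 1 0 l] False by (simp add: k mom_def)
  qed
  then show ?thesis
    unfolding gauss_def by (subst has_bochner_integral_density) auto
qed

lemma sigma_finite_gauss: "sigma_finite_measure gauss"
  unfolding gauss_def using prob_space_normal_density[of 1 0]
  by (simp add: prob_space_imp_sigma_finite)

definition gexp :: "'v::finite real_mpoly \<Rightarrow> real"
  where "gexp p = (\<integral>z. ev p z \<partial>(Pi\<^sub>M UNIV (\<lambda>_::'v. gauss)))"

lemma monomial_integral:
  fixes \<alpha> :: "'v::finite \<Rightarrow>\<^sub>0 nat"
  shows "integrable (Pi\<^sub>M UNIV (\<lambda>_::'v. gauss)) (\<lambda>z. \<Prod>i\<in>UNIV. z i ^ Poly_Mapping.lookup \<alpha> i)"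
    and "(\<integral>z. (\<Prod>i\<in>UNIV. z i ^ Poly_Mapping.lookup \<alpha> i) \<partial>(Pi\<^sub>M UNIV (\<lambda>_::'v. gauss)))
      = (\<Prod>i\<in>UNIV. mom (Poly_Mapping.lookup \<alpha> i))"
proof -
  interpret product_sigma_finite "\<lambda>_::'v. gauss"
    by (rule product_sigma_finite.intro) (rule sigma_finite_gauss)
  have mom: "integrable gauss (\<lambda>x. x ^ k)" "(\<integral>x. x ^ k \<partial>gauss) = mom k" for k
    using gauss_moment[of k] by (auto simp: has_bochner_integral_iff)
  show "integrable (Pi\<^sub>M UNIV (\<lambda>_::'v. gauss)) (\<lambda>z. \<Prod>i\<in>UNIV. z i ^ Poly_Mapping.lookup \<alpha> i)"
    by (rule product_integrable_prod) (use mom in auto)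
  show "(\<integral>z. (\<Prod>i\<in>UNIV. z i ^ Poly_Mapping.lookup \<alpha> i) \<partial>(Pi\<^sub>M UNIV (\<lambda>_::'v. gauss)))
      = (\<Prod>i\<in>UNIV. mom (Poly_Mapping.lookup \<alpha> i))"
    by (subst product_integral_prod) (use mom in auto)
qed

lemma integrable_ev: "integrable (Pi\<^sub>M UNIV (\<lambda>_::'v::finite. gauss)) (\<lambda>z. ev p z)"
  unfolding ev_def by (intro Bochner_Integration.integrable_sum integrable_mult_right monomial_integral)

lemma gexp_add [simp]: "gexp (p + q) = gexp p + gexp q"
  by (simp add: gexp_def Bochner_Integration.integral_add[OF integrable_ev integrable_ev])

lemma gexp_0 [simp]: "gexp 0 = 0"
  by (simp add: gexp_def)

lemma gexp_sum: "gexp (\<Sum>i\<in>A. p i) = (\<Sum>i\<in>A. gexp (p i))"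
  by (induction A rule: infinite_finite_induct) auto

lemma gexp_Const_mult [simp]: "gexp (Const c * p) = c * gexp p"
  by (simp add: gexp_def)

lemma gexp_nonneg: "(\<And>z. ev p z \<ge> (0::real)) \<Longrightarrow> gexp p \<ge> 0"
  unfolding gexp_def by (rule Bochner_Integration.integral_nonneg)

lemma gexp_single: "gexp (Poly_Mapping.single \<alpha> c) = c * (\<Prod>i\<in>UNIV. mom (Poly_Mapping.lookup \<alpha> i))"
  by (simp add: gexp_def monomial_integral)

lemma gexp_1 [simp]: "gexp 1 = 1"
  using gexp_single[of 0 1] by (simp add: mom_def)

text \<open>Stein's identity.\<close>

lemma gexp_Var_mult: "gexp (Var i * p) = gexp (pd i p)"
proof (induction p rule: mpoly_induct)
  case (single \<alpha> c)
  have "Var i * Poly_Mapping.single \<alpha> c = Poly_Mapping.single (Poly_Mapping.single i 1 + \<alpha>) c"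
    by (simp add: Var_def mult_single)
  moreover have "(\<Prod>j\<in>UNIV. mom (Poly_Mapping.lookup (Poly_Mapping.single i 1 + \<alpha>) j)) =
      mom (Suc (Poly_Mapping.lookup \<alpha> i)) * (\<Prod>j\<in>UNIV - {i}. mom (Poly_Mapping.lookup \<alpha> j))"
    by (subst prod.remove[of UNIV i])
      (auto simp: lookup_add lookup_single when_def intro!: arg_cong2[where f = "(*)"] prod.cong)
  moreover have "(\<Prod>j\<in>UNIV. mom (Poly_Mapping.lookup (\<alpha> - Poly_Mapping.single i 1) j)) =
      mom (Poly_Mapping.lookup \<alpha> i - 1) * (\<Prod>j\<in>UNIV - {i}. mom (Poly_Mapping.lookup \<alpha> j))"
    by (subst prod.remove[of UNIV i])
      (auto simp: lookup_minus lookup_single when_def intro!: arg_cong2[where f = "(*)"] prod.cong)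
  ultimately show ?case by (simp add: gexp_single pd_single mom_Suc)
qed (simp add: distrib_left)

definition linform :: "(real, 'v::finite) vec \<Rightarrow> 'v real_mpoly"
  where "linform y = (\<Sum>i\<in>UNIV. Const (y $ i) * Var i)"

lemma pd_power_linform: "pd i (linform y ^ r) = Const (real r * y $ i) * linform y ^ (r - 1)"
proof -
  have "pd i (linform y) = (\<Sum>j\<in>UNIV. if j = i then Const (y $ j) else 0)"
    unfolding linform_def pd_sum by (intro sum.cong refl) (simp add: pd_Var)
  then have l: "pd i (linform y) = Const (y $ i)" by simp
  have "pd i (linform y ^ Suc r) = Const (real (Suc r) * y $ i) * linform y ^ r" for r
  proof (induction r)
    case (Suc r)
    have "pd i (linform y ^ Suc (Suc r)) = Const (y $ i) * linform y ^ Suc r + linform y * (Const (real (Suc r) * y $ i) * linform y ^ r)"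
      by (subst power_Suc, subst pd_mult, subst Suc.IH, subst l) (rule refl)
    also have "\<dots> = (Const (y $ i) + Const (real (Suc r) * y $ i)) * linform y ^ Suc r"
      by (simp add: algebra_simps)
    also have "Const (y $ i) + Const (real (Suc r) * y $ i) = Const (real (Suc (Suc r)) * y $ i)"
      by (simp add: Const_add[symmetric] algebra_simps)
    finally show ?case by simp
  qed (simp add: l)
  then show ?thesis by (cases r) (auto simp: Const_def)
qed

text \<open>As a function of \<open>y\<close> this is a nonnegative combination of powers \<open>(z \<bullet> y)\<^sup>r\<close>, with weight \<open>h z\<close>
  and Gaussian \<open>z\<close>; for \<open>h \<ge> 0\<close> and even \<open>r\<close> it will be a sum of squares of forms.\<close>

definition pairing :: "nat \<Rightarrow> (real, 'v::finite) vec \<Rightarrow> 'v real_mpoly \<Rightarrow> real"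
  where "pairing r y h = gexp (h * linform y ^ r) / fact r"

lemma pairing_add [simp]: "pairing r y (p + q) = pairing r y p + pairing r y q"
  by (simp add: pairing_def distrib_right add_divide_distrib)

lemma pairing_0 [simp]: "pairing r y 0 = 0"
  by (simp add: pairing_def)

lemma pairing_Const_mult [simp]: "pairing r y (Const c * p) = c * pairing r y p"
  by (simp add: pairing_def mult.assoc)

lemma pairing_Var_mult:
  "pairing r y (Var i * h) = pairing r y (pd i h) + (if r = 0 then 0 else y $ i * pairing (r - 1) y h)"
proof -
  have "gexp (Var i * h * linform y ^ r) = gexp (pd i h * linform y ^ r + h * (Const (real r * y $ i) * linform y ^ (r - 1)))"
    by (simp only: mult.assoc gexp_Var_mult pd_mult pd_power_linform)
  also have "h * (Const (real r * y $ i) * linform y ^ (r - 1)) = Const (real r * y $ i) * (h * linform y ^ (r - 1))"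
    by (rule mult.left_commute)
  finally have *: "gexp (Var i * h * linform y ^ r) =
      gexp (pd i h * linform y ^ r) + real r * y $ i * gexp (h * linform y ^ (r - 1))"
    by (simp only: gexp_add gexp_Const_mult)
  show ?thesis
  proof (cases r)
    case 0
    then show ?thesis using * by (simp add: pairing_def)
  next
    case (Suc s)
    have "real (Suc s) * y $ i * b / fact (Suc s) = y $ i * (b / fact s)" for b
      by (simp add: field_simps del: of_nat_Suc)
    then show ?thesis
      unfolding pairing_def * add_divide_distrib unfolding Suc by (simp del: fact_Suc of_nat_Suc power_Suc)
  qed
qed

lemma pairing_1_even: "pairing (2 * s) y 1 = (norm y ^ 2) ^ s / (2 ^ s * fact s)"
proof (induction s)
  case (Suc s)
  have "gexp (linform y ^ Suc (Suc (2 * s))) = (\<Sum>i\<in>UNIV. y $ i * gexp (Var i * linform y ^ Suc (2 * s)))"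
    by (subst power_Suc, subst linform_def) (simp add: sum_distrib_right gexp_sum mult.assoc)
  also have "\<dots> = (\<Sum>i\<in>UNIV. (y $ i)\<^sup>2 * (real (Suc (2 * s)) * gexp (linform y ^ (2 * s))))"
  proof (intro sum.cong refl)
    fix i
    have "gexp (Var i * linform y ^ Suc (2 * s)) = real (Suc (2 * s)) * y $ i * gexp (linform y ^ (2 * s))"
      by (simp only: gexp_Var_mult pd_power_linform gexp_Const_mult diff_Suc_1)
    then show "y $ i * gexp (Var i * linform y ^ Suc (2 * s)) =
        (y $ i)\<^sup>2 * (real (Suc (2 * s)) * gexp (linform y ^ (2 * s)))"
      by (simp only: power2_eq_square mult_ac)
  qed
  also have "\<dots> = norm y ^ 2 * (real (Suc (2 * s)) * gexp (linform y ^ (2 * s)))"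
    by (simp add: norm_vec_sq sum_distrib_right)
  finally have step: "gexp (linform y ^ Suc (Suc (2 * s))) = norm y ^ 2 * (real (Suc (2 * s)) * gexp (linform y ^ (2 * s)))" .
  have "pairing (2 * Suc s) y 1 = norm y ^ 2 / (2 * real (Suc s)) * pairing (2 * s) y 1"
    unfolding pairing_def mult_Suc_right
    by (simp only: mult_1 add_Suc add_2_eq_Suc step) (simp add: field_simps del: of_nat_Suc, simp)
  then show ?case unfolding Suc.IH by (simp add: field_simps)
qed (simp add: pairing_def)

section \<open>Wick's formula\<close>

lemma lap_Var_mult: "lap (Var i * h) = Var i * lap h + Const 2 * pd i h"
proof -
  have "pd j (pd j (Var i * h)) = Var i * pd j (pd j h) + (if j = i then Const 2 * pd j h else 0)" for j
  proof -
    have "Const 2 * q = q + q" for q :: "'a real_mpoly"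
      using Const_add[of 1 1, where 'a = 'a] by (simp add: distrib_right Const_def)
    then show ?thesis by (auto simp: pd_Var_mult add_ac)
  qed
  then show ?thesis by (simp add: lap_def sum.distrib sum_distrib_left)
qed

lemma pd_lap_pow: "pd i ((lap ^^ j) h) = (lap ^^ j) (pd i h)"
proof (induction j)
  case (Suc j)
  have "pd i (lap q) = lap (pd i q)" for q :: "'a real_mpoly"
  proof -
    have "pd i (pd k (pd k q)) = pd k (pd k (pd i q))" for k
      by (metis pd_commute)
    then show ?thesis by (simp add: lap_def)
  qed
  then show ?case using Suc by simp
qed simp

text \<open>The commutator of \<open>\<Delta>\<^sup>j\<close> with the multiplication by a variable is \<open>2 j \<partial>\<^sub>i \<Delta>\<^bsup>j-1\<^esup>\<close>.\<close>

lemma lap_pow_Var_mult: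
  "(lap ^^ j) (Var i * h) = Var i * (lap ^^ j) h + Const (2 * real j) * (lap ^^ (j - 1)) (pd i h)"
proof (induction j)
  case 0
  then show ?case by (simp add: Const_def)
next
  case (Suc j)
  have "(lap ^^ Suc j) (Var i * h) = lap (Var i * (lap ^^ j) h) + Const (2 * real j) * lap ((lap ^^ (j - 1)) (pd i h))"
    by (simp add: Suc)
  also have "Const (2 * real j) * lap ((lap ^^ (j - 1)) (pd i h)) = Const (2 * real j) * (lap ^^ j) (pd i h)"
    by (cases j) (auto simp: Const_def)
  also have "lap (Var i * (lap ^^ j) h) = Var i * (lap ^^ Suc j) h + Const 2 * (lap ^^ j) (pd i h)"
    by (simp add: lap_Var_mult pd_lap_pow)
  also have "\<dots> + Const (2 * real j) * (lap ^^ j) (pd i h) =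
      Var i * (lap ^^ Suc j) h + (Const 2 + Const (2 * real j)) * (lap ^^ j) (pd i h)"
    by (simp only: distrib_right add.assoc)
  also have "Const 2 + Const (2 * real j) = Const (2 * real (Suc j))"
    unfolding Const_add[symmetric] by (rule arg_cong[where f = Const]) simp
  finally show ?case by simp
qed

text \<open>The \<open>j\<close>-th term in the part of degree \<open>r\<close> of \<open>exp (\<bar>y\<bar>\<^sup>2 / 2) exp (\<Delta> / 2) h\<close>, where \<open>h\<close> has degree
  \<open>d\<close>. The factor \<open>pairing (r + 2 j - d) y 1\<close> is the corresponding Taylor term of
  \<open>exp (\<bar>y\<bar>\<^sup>2 / 2)\<close>.\<close>

definition wick_term :: "nat \<Rightarrow> nat \<Rightarrow> (real, 'v::finite) vec \<Rightarrow> 'v real_mpoly \<Rightarrow> nat \<Rightarrow> real"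
  where "wick_term r d y h j = (if d \<le> r + 2 * j then pairing (r + 2 * j - d) y 1 else 0) *
      eval_mpoly ((lap ^^ j) h) y / (2 ^ j * fact j)"

text \<open>Splitting off one variable, Stein's identity on the left and the commutator with the Laplacian
  on the right give the same recursion. The bound \<open>J\<close> on the number of terms is free because terms
  with \<open>2 j > d\<close> vanish; the induction uses it with \<open>J\<close> and \<open>J - 1\<close>.\<close>

lemma wick_monomial:
  "mdeg \<alpha> \<le> J \<Longrightarrow> pairing r y (Poly_Mapping.single \<alpha> c) = (\<Sum>j\<le>J. wick_term r (mdeg \<alpha>) y (Poly_Mapping.single \<alpha> c) j)"
proof (induction "mdeg \<alpha>" arbitrary: \<alpha> c r J rule: less_induct)
  case less
  show ?case
  proof (cases "\<alpha> = 0")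
    case True
    have h: "Poly_Mapping.single \<alpha> c = Const c * 1" using True by (simp add: Const_def)
    have "hom 0 (Const c * 1 :: 'a real_mpoly)" by (rule hom_Const_mult[OF hom_1])
    then have "wick_term r 0 y (Const c * 1) (Suc j) = 0" for j
      unfolding wick_term_def using lap_pow_eq_0[of 0 "Const c * 1 :: 'a real_mpoly" "Suc j"] by (simp add: eval_mpoly_eq_ev del: funpow.simps)
    then have "(\<Sum>j\<le>J. wick_term r 0 y (Const c * 1) j) = wick_term r 0 y (Const c * 1) 0"
      by (subst sum.atMost_shift) simp
    also have "\<dots> = c * pairing r y 1" by (simp add: wick_term_def eval_mpoly_eq_ev)
    finally have "(\<Sum>j\<le>J. wick_term r 0 y (Const c * 1) j) = c * pairing r y 1" .
    moreover have "mdeg \<alpha> = 0" using True by simp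
    ultimately show ?thesis unfolding h by (simp only: pairing_Const_mult)
  next
    case False
    then obtain i where i: "Poly_Mapping.lookup \<alpha> i \<noteq> 0" by (rule mdeg_pos_obtain)
    define \<beta> where "\<beta> = \<alpha> - Poly_Mapping.single i 1"
    define h where "h = Poly_Mapping.single \<beta> c"
    have \<beta>: "mdeg \<alpha> = Suc (mdeg \<beta>)" using mdeg_diff_single[OF i] by (simp add: \<beta>_def)
    have \<alpha>: "Poly_Mapping.single \<alpha> c = Var i * h"
      unfolding h_def \<beta>_def by (rule single_eq_Var_mult[OF i])
    have hom_h: "hom (mdeg \<beta>) h" by (auto simp: h_def hom_def)
    obtain J' where J': "J = Suc J'" using less.prems \<beta> by (cases J) auto
    let ?d = "mdeg \<alpha>"
    define E where "E j = (if ?d \<le> r + 2 * j then pairing (r + 2 * j - ?d) y 1 else 0)" for j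
    have split: "wick_term r ?d y (Var i * h) j =
        y $ i * (E j * eval_mpoly ((lap ^^ j) h) y / (2 ^ j * fact j)) +
        E j * (2 * real j * eval_mpoly ((lap ^^ (j - 1)) (pd i h)) y) / (2 ^ j * fact j)" for j
      unfolding wick_term_def lap_pow_Var_mult E_def eval_mpoly_eq_ev
      by (simp add: add_divide_distrib algebra_simps)
    have first: "(\<Sum>j\<le>J. E j * eval_mpoly ((lap ^^ j) h) y / (2 ^ j * fact j)) =
        (if r = 0 then 0 else pairing (r - 1) y h)"
    proof (cases "r = 0")
      case True
      have zero: "E j * eval_mpoly ((lap ^^ j) h) y = 0" for j
        using lap_pow_eq_0[OF hom_h, of j] True \<beta> by (auto simp: E_def eval_mpoly_eq_ev)
      show ?thesis using True by (simp only: zero) simp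
    next
      case False
      have "pairing (r - 1) y h = (\<Sum>j\<le>J. wick_term (r - 1) (mdeg \<beta>) y h j)"
        unfolding h_def using less.prems \<beta> by (intro less.hyps) auto
      also have "\<dots> = (\<Sum>j\<le>J. E j * eval_mpoly ((lap ^^ j) h) y / (2 ^ j * fact j))"
      proof (intro sum.cong refl)
        fix j
        have "(mdeg \<beta> \<le> r - 1 + 2 * j) = (?d \<le> r + 2 * j)" "r - 1 + 2 * j - mdeg \<beta> = r + 2 * j - ?d"
          using False \<beta> by auto
        then show "wick_term (r - 1) (mdeg \<beta>) y h j = E j * eval_mpoly ((lap ^^ j) h) y / (2 ^ j * fact j)"
          by (simp add: wick_term_def E_def)
      qed
      finally show ?thesis using False by simp
    qed
    have second: "(\<Sum>j\<le>J. E j * (2 * real j * eval_mpoly ((lap ^^ (j - 1)) (pd i h)) y) / (2 ^ j * fact j)) =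
        pairing r y (pd i h)"
    proof (cases "Poly_Mapping.lookup \<beta> i = 0")
      case True
      then have "pd i h = 0" by (simp add: h_def pd_single)
      then show ?thesis by (simp add: eval_mpoly_eq_ev)
    next
      case False
      have \<gamma>: "mdeg \<beta> = Suc (mdeg (\<beta> - Poly_Mapping.single i 1))" using mdeg_diff_single[OF False] by simp
      have "(\<Sum>j\<le>J. E j * (2 * real j * eval_mpoly ((lap ^^ (j - 1)) (pd i h)) y) / (2 ^ j * fact j)) =
          (\<Sum>j\<le>J'. E (Suc j) * (2 * real (Suc j) * eval_mpoly ((lap ^^ j) (pd i h)) y) / (2 ^ Suc j * fact (Suc j)))"
        unfolding J' by (subst sum.atMost_Suc_shift) simp
      also have "\<dots> = (\<Sum>j\<le>J'. wick_term r (mdeg (\<beta> - Poly_Mapping.single i 1)) y (pd i h) j)"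
      proof (intro sum.cong refl)
        fix j
        have "(mdeg (\<beta> - Poly_Mapping.single i 1) \<le> r + 2 * j) = (?d \<le> r + 2 * Suc j)"
          "r + 2 * j - mdeg (\<beta> - Poly_Mapping.single i 1) = r + 2 * Suc j - ?d"
          using \<beta> \<gamma> by auto
        then have E: "(if mdeg (\<beta> - Poly_Mapping.single i 1) \<le> r + 2 * j
            then pairing (r + 2 * j - mdeg (\<beta> - Poly_Mapping.single i 1)) y 1 else 0) = E (Suc j)"
          by (simp add: E_def)
        have "2 * real (Suc j) * b / (2 ^ Suc j * fact (Suc j)) = b / (2 ^ j * fact j)" for b
          by (simp add: field_simps del: of_nat_Suc)
        from this[of "E (Suc j) * eval_mpoly ((lap ^^ j) (pd i h)) y"]
        show "E (Suc j) * (2 * real (Suc j) * eval_mpoly ((lap ^^ j) (pd i h)) y) / (2 ^ Suc j * fact (Suc j)) =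
            wick_term r (mdeg (\<beta> - Poly_Mapping.single i 1)) y (pd i h) j"
          unfolding wick_term_def E by (simp only: mult_ac)
      qed
      also have "\<dots> = pairing r y (pd i h)"
        unfolding h_def pd_single using less.prems \<beta> \<gamma> J' by (intro less.hyps[symmetric]) auto
      finally show ?thesis .
    qed
    have "(\<Sum>j\<le>J. wick_term r ?d y (Var i * h) j) =
        y $ i * (\<Sum>j\<le>J. E j * eval_mpoly ((lap ^^ j) h) y / (2 ^ j * fact j)) + pairing r y (pd i h)"
      unfolding split sum.distrib second by (simp add: sum_distrib_left)
    also have "\<dots> = pairing r y (Var i * h)"
      unfolding first pairing_Var_mult by simp
    finally show ?thesis by (simp only: \<alpha>)
  qed
qed

lemma wick_term_add: "wick_term r d y (p + q) j = wick_term r d y p j + wick_term r d y q j"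
  by (simp add: wick_term_def eval_mpoly_eq_ev distrib_left add_divide_distrib)

lemma wick:
  assumes "hom d H" "d \<le> J"
  shows "pairing r y H = (\<Sum>j\<le>J. wick_term r d y H j)"
proof -
  have "pairing r y (\<Sum>\<alpha>\<in>A. Poly_Mapping.single \<alpha> (Poly_Mapping.lookup H \<alpha>)) =
      (\<Sum>j\<le>J. wick_term r d y (\<Sum>\<alpha>\<in>A. Poly_Mapping.single \<alpha> (Poly_Mapping.lookup H \<alpha>)) j)"
    if "A \<subseteq> Poly_Mapping.keys H" "finite A" for A
    using that(2,1)
  proof (induction A rule: finite_induct)
    case empty
    then show ?case by (simp add: wick_term_def eval_mpoly_eq_ev)
  next
    case (insert \<alpha> A)
    then have "mdeg \<alpha> = d" using assms(1) by (auto simp: hom_def)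
    then show ?case
      using insert wick_monomial[of \<alpha> J r y "Poly_Mapping.lookup H \<alpha>"] assms(2)
      by (simp add: wick_term_add sum.distrib)
  qed
  moreover have "H = (\<Sum>\<alpha>\<in>Poly_Mapping.keys H. Poly_Mapping.single \<alpha> (Poly_Mapping.lookup H \<alpha>))"
    by (rule poly_mapping_eqI) (auto simp: lookup_sum lookup_single when_def in_keys_iff)
  ultimately show ?thesis by (metis finite_keys order_refl)
qed

text \<open>Divided by its leading term, Wick's formula for \<open>r = 2 (k + K)\<close> and a form \<open>H\<close> of degree \<open>2 K\<close> has
  the coefficients \<open>reznick_coeff k j\<close> in front of \<open>\<bar>y\<bar>\<^bsup>2j\<^esup> \<Delta>\<^sup>j H\<close>. The term for \<open>j = 0\<close> is \<open>H\<close> itself,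
  and the remaining ones, with the opposite sign, form the defect of \<open>H\<close>.\<close>

definition reznick_coeff :: "nat \<Rightarrow> nat \<Rightarrow> real"
  where "reznick_coeff k j = fact k / (4 ^ j * fact j * fact (k + j))"

definition defect :: "nat \<Rightarrow> nat \<Rightarrow> 'v::finite real_mpoly \<Rightarrow> 'v real_mpoly"
  where "defect k K H = - (\<Sum>j=1..K. Const (reznick_coeff k j) * (norm_sq ^ j * (lap ^^ j) H))"

lemma defect_add: "defect k K (p + q) = defect k K p + defect k K q"
  by (simp add: defect_def distrib_left sum.distrib)

text \<open>Up to a constant, the pairing is \<open>\<bar>y\<bar>\<^bsup>2k\<^esup>\<close> times \<open>H\<close> minus its defect. This is where the powers of
  \<open>\<bar>y\<bar>\<^sup>2\<close> in the denominator come from.\<close>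

lemma pairing_eq_defect:
  fixes H :: "'v::finite real_mpoly"
  assumes "hom (2 * K) H"
  shows "pairing (2 * (k + K)) y H = (norm y ^ 2) ^ k / (2 ^ k * fact k) * eval_mpoly (H - defect k K H) y"
proof -
  have zero: "wick_term (2 * (k + K)) (2 * K) y H j = 0" if "j > K" for j
    using lap_pow_eq_0[OF assms, of j] that by (simp add: wick_term_def eval_mpoly_eq_ev)
  have "pairing (2 * (k + K)) y H = (\<Sum>j\<le>2 * K. wick_term (2 * (k + K)) (2 * K) y H j)"
    by (rule wick[OF assms order_refl])
  also have "\<dots> = (\<Sum>j\<le>K. wick_term (2 * (k + K)) (2 * K) y H j)"
  proof (rule sum.mono_neutral_right)
    show "\<forall>j\<in>{..2 * K} - {..K}. wick_term (2 * (k + K)) (2 * K) y H j = 0"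
      by (intro ballI zero) auto
  qed auto
  also have "\<dots> = (\<Sum>j\<le>K. (norm y ^ 2) ^ k / (2 ^ k * fact k) *
      (reznick_coeff k j * ((norm y ^ 2) ^ j * eval_mpoly ((lap ^^ j) H) y)))"
  proof (intro sum.cong refl)
    fix j
    have "2 * (k + K) + 2 * j - 2 * K = 2 * (k + j)" by simp
    then have "wick_term (2 * (k + K)) (2 * K) y H j =
        (norm y ^ 2) ^ (k + j) / (2 ^ (k + j) * fact (k + j)) * eval_mpoly ((lap ^^ j) H) y / (2 ^ j * fact j)"
      unfolding wick_term_def by (simp only: pairing_1_even) simp
    also have "\<dots> = (norm y ^ 2) ^ k / (2 ^ k * fact k) *
      (reznick_coeff k j * ((norm y ^ 2) ^ j * eval_mpoly ((lap ^^ j) H) y))"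
    proof -
      have "(4::real) ^ j = 2 ^ j * 2 ^ j" by (simp flip: power_mult_distrib)
      then show ?thesis by (simp add: reznick_coeff_def power_add field_simps)
    qed
    finally show "wick_term (2 * (k + K)) (2 * K) y H j = (norm y ^ 2) ^ k / (2 ^ k * fact k) *
      (reznick_coeff k j * ((norm y ^ 2) ^ j * eval_mpoly ((lap ^^ j) H) y))" .
  qed
  also have "\<dots> = (norm y ^ 2) ^ k / (2 ^ k * fact k) *
      (\<Sum>j\<le>K. reznick_coeff k j * ((norm y ^ 2) ^ j * eval_mpoly ((lap ^^ j) H) y))"
    by (simp add: sum_distrib_left)
  also have "(\<Sum>j\<le>K. reznick_coeff k j * ((norm y ^ 2) ^ j * eval_mpoly ((lap ^^ j) H) y)) =
      eval_mpoly H y + (\<Sum>j=1..K. reznick_coeff k j * ((norm y ^ 2) ^ j * eval_mpoly ((lap ^^ j) H) y))"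
  proof -
    have "{..K} = insert 0 {1..K}" by auto
    then show ?thesis by (simp add: reznick_coeff_def)
  qed
  also have "\<dots> = eval_mpoly (H - defect k K H) y"
    by (simp add: defect_def eval_mpoly_eq_ev eval_norm_sq[unfolded eval_mpoly_eq_ev])
  finally show ?thesis .
qed

lemma hom_defect: "hom (2 * K) H \<Longrightarrow> hom (2 * K) (defect k K H)"
proof -
  assume H: "hom (2 * K) H"
  have "hom (2 * K) (Const (reznick_coeff k j) * (norm_sq ^ j * (lap ^^ j) H))" if "j \<le> K" for j
  proof -
    have "hom (j * 2 + (2 * K - 2 * j)) (norm_sq ^ j * (lap ^^ j) H)"
      by (intro hom_mult hom_power hom_norm_sq hom_lap_pow H)
    moreover have "j * 2 + (2 * K - 2 * j) = 2 * K" using that by simp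
    ultimately show ?thesis by (metis hom_Const_mult)
  qed
  then have "hom (2 * K) (0 - (\<Sum>j=1..K. Const (reznick_coeff k j) * (norm_sq ^ j * (lap ^^ j) H)))"
    by (intro hom_diff hom_sum) auto
  then show ?thesis by (simp add: defect_def)
qed

lemma reznick_coeff_le: "k \<ge> 1 \<Longrightarrow> reznick_coeff k j \<le> (1 / (4 * real k)) ^ j"
proof -
  assume k: "k \<ge> 1"
  have "fact k * real k ^ j \<le> fact (k + j)"
  proof (induction j)
    case (Suc j)
    have "fact k * real k ^ Suc j = real k * (fact k * real k ^ j)" by simp
    also have "\<dots> \<le> real (Suc (k + j)) * fact (k + j)" using Suc by (intro mult_mono) auto
    finally show ?case by simp
  qed simp
  then have "fact k / fact (k + j) \<le> 1 / real k ^ j" using k by (simp add: field_simps)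
  moreover have "1 / (4 ^ j * fact j) \<le> 1 / (4 ^ j :: real)"
    using fact_ge_1[of j, where 'a = real] by (simp add: divide_simps)
  ultimately have "(fact k / fact (k + j)) * (1 / (4 ^ j * fact j)) \<le> (1 / real k ^ j) * (1 / (4 ^ j :: real))"
    by (intro mult_mono) auto
  then show ?thesis by (simp add: reznick_coeff_def power_mult_distrib power_divide field_simps)
qed

lemma geometric_sum_le:
  assumes x: "0 \<le> x" "x \<le> (1 / 2 :: real)"
  shows "(\<Sum>j=1..n. x ^ j) \<le> 2 * x"
proof -
  have "(\<Sum>j=1..n. x ^ j) \<le> 2 * x - 2 * x ^ Suc n"
  proof (induction n)
    case (Suc n)
    have "2 * x * x ^ Suc n \<le> 1 * x ^ Suc n" using x by (intro mult_right_mono) auto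
    then have "2 * x ^ Suc (Suc n) \<le> x ^ Suc n" by simp
    moreover have "(\<Sum>j=1..Suc n. x ^ j) = (\<Sum>j=1..n. x ^ j) + x ^ Suc n" by simp
    ultimately show ?case using Suc by linarith
  qed simp
  moreover have "x ^ Suc n \<ge> 0" using x by simp
  ultimately show ?thesis by linarith
qed

text \<open>The \<open>j\<close>-th coefficient is at most \<open>(4 k)\<^bsup>-j\<^esup>\<close> and \<open>\<Delta>\<^sup>j\<close> costs a factor \<open>O (K\<^sup>2)\<^sup>j\<close>, so the defect is a
  contraction as soon as \<open>k\<close> exceeds a multiple of \<open>K\<^sup>2\<close>.\<close>

lemma bounded_form_defect:
  fixes H :: "'v::finite real_mpoly"
  assumes H: "bounded_form (2 * K) B H" and k: "k \<ge> 1"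
    and \<rho>: "\<rho> = real CARD('v) * (24 * real K)\<^sup>2 / (2 * real k)" "\<rho> \<le> 1"
  shows "bounded_form (2 * K) (\<rho> * B) (defect k K H)"
proof -
  define \<beta> where "\<beta> = real CARD('v) * (24 * real K)\<^sup>2"
  define x where "x = \<beta> / (4 * real k)"
  have x: "0 \<le> x" "x \<le> 1 / 2" "\<rho> = 2 * x" using \<rho> k by (simp_all add: x_def \<beta>_def)
  have B: "B \<ge> 0" by (rule bounded_form_nonneg[OF H])
  have "\<bar>eval_mpoly (defect k K H) y\<bar> \<le> \<rho> * B * norm y ^ (2 * K)" for y
  proof -
    have term_bd: "\<bar>reznick_coeff k j * ((norm y ^ 2) ^ j * eval_mpoly ((lap ^^ j) H) y)\<bar> \<le> x ^ j * (B * norm y ^ (2 * K))"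
      if "j \<in> {1..K}" for j
    proof -
      have "\<bar>eval_mpoly ((lap ^^ j) H) y\<bar> \<le> \<beta> ^ j * B * norm y ^ (2 * K - 2 * j)"
        using bounded_form_lap_pow[OF H, of j] by (auto simp: bounded_form_def \<beta>_def)
      then have "(norm y ^ 2) ^ j * \<bar>eval_mpoly ((lap ^^ j) H) y\<bar> \<le> (norm y ^ 2) ^ j * (\<beta> ^ j * B * norm y ^ (2 * K - 2 * j))"
        by (intro mult_left_mono) auto
      also have "\<dots> = \<beta> ^ j * B * (norm y ^ (2 * j) * norm y ^ (2 * K - 2 * j))" by (simp add: power_mult)
      also have "norm y ^ (2 * j) * norm y ^ (2 * K - 2 * j) = norm y ^ (2 * K)"
        using that by (simp flip: power_add)
      finally have "(norm y ^ 2) ^ j * \<bar>eval_mpoly ((lap ^^ j) H) y\<bar> \<le> \<beta> ^ j * B * norm y ^ (2 * K)" .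
      from mult_mono[OF reznick_coeff_le[OF k] this]
      have "reznick_coeff k j * ((norm y ^ 2) ^ j * \<bar>eval_mpoly ((lap ^^ j) H) y\<bar>) \<le>
          (1 / (4 * real k)) ^ j * (\<beta> ^ j * B * norm y ^ (2 * K))" by simp
      also have "\<dots> = x ^ j * (B * norm y ^ (2 * K))"
        by (simp add: x_def power_divide power_mult_distrib)
      finally show ?thesis
        by (simp add: abs_mult reznick_coeff_def)
    qed
    have "eval_mpoly (defect k K H) y = - (\<Sum>j=1..K. reznick_coeff k j * ((norm y ^ 2) ^ j * eval_mpoly ((lap ^^ j) H) y))"
      by (simp add: defect_def eval_mpoly_eq_ev eval_norm_sq[unfolded eval_mpoly_eq_ev])
    then have "\<bar>eval_mpoly (defect k K H) y\<bar> \<le> (\<Sum>j=1..K. \<bar>reznick_coeff k j * ((norm y ^ 2) ^ j * eval_mpoly ((lap ^^ j) H) y)\<bar>)"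
      by (simp only: abs_minus_cancel sum_abs)
    also have "\<dots> \<le> (\<Sum>j=1..K. x ^ j * (B * norm y ^ (2 * K)))" by (intro sum_mono term_bd)
    also have "\<dots> = (\<Sum>j=1..K. x ^ j) * (B * norm y ^ (2 * K))" by (simp add: sum_distrib_right)
    also have "(\<Sum>j=1..K. x ^ j) \<le> 2 * x" by (rule geometric_sum_le[OF x(1,2)])
    then have "(\<Sum>j=1..K. x ^ j) * (B * norm y ^ (2 * K)) \<le> 2 * x * (B * norm y ^ (2 * K))"
      using B by (intro mult_right_mono) auto
    finally show ?thesis using x(3) by (simp add: mult.assoc)
  qed
  with hom_defect H show ?thesis by (auto simp: bounded_form_def)
qed

section \<open>Sums of squares from Gram matrices\<close>

lemma quadratic_form_insert:
  fixes G :: "'i \<Rightarrow> 'i \<Rightarrow> real"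
  assumes "finite I" "a \<notin> I" "\<And>b. b \<in> I \<Longrightarrow> G b a = G a b"
  shows "(\<Sum>b\<in>insert a I. \<Sum>c\<in>insert a I. v b * v c * G b c) =
    G a a * (v a)\<^sup>2 + 2 * v a * (\<Sum>b\<in>I. G a b * v b) + (\<Sum>b\<in>I. \<Sum>c\<in>I. v b * v c * G b c)"
proof -
  have "(\<Sum>b\<in>I. v b * v a * G b a) = v a * (\<Sum>b\<in>I. G a b * v b)"
    unfolding sum_distrib_left using assms(3) by (intro sum.cong refl) (simp add: mult_ac)
  moreover have "(\<Sum>c\<in>I. v a * v c * G a c) = v a * (\<Sum>b\<in>I. G a b * v b)"
    unfolding sum_distrib_left by (intro sum.cong refl) (simp add: mult_ac)
  ultimately show ?thesis
    using assms(1,2) by (simp add: sum.distrib power2_eq_square algebra_simps)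
qed

text \<open>Completing the square for one index leaves the Schur complement, which is again positive
  semidefinite. If the pivot is zero, so is its row.\<close>

lemma sosf_gram:
  fixes G :: "'i \<Rightarrow> 'i \<Rightarrow> real"
  assumes "finite I" "\<And>a b. a \<in> I \<Longrightarrow> b \<in> I \<Longrightarrow> G b a = G a b"
    and "\<And>u. (\<Sum>a\<in>I. \<Sum>b\<in>I. u a * u b * G a b) \<ge> 0"
    and "\<And>a. a \<in> I \<Longrightarrow> polyf d (m a)"
  shows "sosf d (\<lambda>x. \<Sum>a\<in>I. \<Sum>b\<in>I. m a x * m b x * G a b)"
  using assms
proof (induction I arbitrary: G rule: finite_induct)
  case empty
  then show ?case by (simp add: sosf_0)
next
  case (insert a I)
  have sym: "G b a = G a b" if "b \<in> I" for b using insert.prems(1)[of a b] that by simp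
  have expand: "(\<Sum>b\<in>insert a I. \<Sum>c\<in>insert a I. v b * v c * G b c) =
      G a a * (v a)\<^sup>2 + 2 * v a * (\<Sum>b\<in>I. G a b * v b) + (\<Sum>b\<in>I. \<Sum>c\<in>I. v b * v c * G b c)" for v
    using sym by (intro quadratic_form_insert insert.hyps) auto
  have psd: "G a a * (u a)\<^sup>2 + 2 * u a * (\<Sum>b\<in>I. G a b * u b) + (\<Sum>b\<in>I. \<Sum>c\<in>I. u b * u c * G b c) \<ge> 0" for u
    using insert.prems(2)[of u] unfolding expand[of u] .
  have upd: "(\<Sum>b\<in>I. F b ((u(a := s)) b)) = (\<Sum>b\<in>I. F b (u b :: real) :: real)" for F u s
    using insert.hyps(2) by (intro sum.cong) auto
  have psd': "G a a * s\<^sup>2 + 2 * s * (\<Sum>b\<in>I. G a b * u b) + (\<Sum>b\<in>I. \<Sum>c\<in>I. u b * u c * G b c) \<ge> 0" for s u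
  proof -
    have "(\<Sum>b\<in>I. \<Sum>c\<in>I. (u(a := s)) b * (u(a := s)) c * G b c) = (\<Sum>b\<in>I. \<Sum>c\<in>I. u b * u c * G b c)"
      using insert.hyps(2) by (intro sum.cong refl) auto
    moreover have "(\<Sum>b\<in>I. G a b * (u(a := s)) b) = (\<Sum>b\<in>I. G a b * u b)"
      using insert.hyps(2) by (intro sum.cong refl) auto
    ultimately show ?thesis using psd[of "u(a := s)"] by simp
  qed
  have Gaa: "G a a \<ge> 0" using psd'[of 1 "\<lambda>_. 0"] by simp
  show ?case
  proof (cases "G a a = 0")
    case True
    have "G a b = 0" if b: "b \<in> I" for b
    proof (rule ccontr)
      assume nz: "G a b \<noteq> 0"
      let ?u = "\<lambda>c. if c = b then 1 else (0::real)"
      have 1: "(\<Sum>c\<in>I. G a c * ?u c) = G a b"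
        using b insert.hyps(1) by (simp add: if_distrib[of "\<lambda>x. _ * x"] cong: if_cong)
      define Q where "Q = (\<Sum>c\<in>I. \<Sum>e\<in>I. ?u c * ?u e * G c e)"
      have "2 * s * G a b + Q \<ge> 0" for s
        using psd'[of s ?u] unfolding 1 Q_def[symmetric] True by simp
      \<comment> \<open>An affine function of \<open>s\<close> that is bounded below is constant.\<close>
      from this[of "- (Q + 1) / (2 * G a b)"] show False using nz by (simp add: field_simps)
    qed
    then have "(\<Sum>b\<in>insert a I. \<Sum>c\<in>insert a I. m b x * m c x * G b c) = (\<Sum>b\<in>I. \<Sum>c\<in>I. m b x * m c x * G b c)" for x
      using expand[of "\<lambda>b. m b x"] True by simp
    moreover have "sosf d (\<lambda>x. \<Sum>b\<in>I. \<Sum>c\<in>I. m b x * m c x * G b c)"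
      using insert.prems psd'[of 0] by (intro insert.IH) auto
    ultimately show ?thesis by simp
  next
    case False
    with Gaa have pos: "G a a > 0" by simp
    define G' where "G' b c = G b c - G a b * G a c / G a a" for b c
    have schur: "(\<Sum>b\<in>I. \<Sum>c\<in>I. v b * v c * G' b c) =
        (\<Sum>b\<in>I. \<Sum>c\<in>I. v b * v c * G b c) - (\<Sum>b\<in>I. G a b * v b)\<^sup>2 / G a a" for v
    proof -
      have "(\<Sum>b\<in>I. G a b * v b)\<^sup>2 / G a a = (\<Sum>b\<in>I. \<Sum>c\<in>I. v b * v c * (G a b * G a c / G a a))"
        unfolding power2_eq_square sum_product sum_divide_distrib
        by (intro sum.cong refl) (simp add: mult_ac)
      then show ?thesis by (simp add: G'_def right_diff_distrib sum_subtractf)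
    qed
    have "sosf d (\<lambda>x. \<Sum>b\<in>I. \<Sum>c\<in>I. m b x * m c x * G' b c)"
    proof (rule insert.IH)
      fix u :: "'i \<Rightarrow> real"
      have "G a a * (- (\<Sum>b\<in>I. G a b * u b) / G a a)\<^sup>2 + 2 * (- (\<Sum>b\<in>I. G a b * u b) / G a a) * (\<Sum>b\<in>I. G a b * u b)
          = - (\<Sum>b\<in>I. G a b * u b)\<^sup>2 / G a a"
        using pos by (simp add: power2_eq_square field_simps)
      then show "(\<Sum>b\<in>I. \<Sum>c\<in>I. u b * u c * G' b c) \<ge> 0"
        using psd'[of "- (\<Sum>b\<in>I. G a b * u b) / G a a" u] unfolding schur by simp
    qed (use insert.prems in \<open>auto simp: G'_def\<close>)
    moreover have "sosf d (\<lambda>x. G a a * (m a x + (\<Sum>b\<in>I. (G a b / G a a) * m b x))\<^sup>2)"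
      using Gaa insert.prems(3) by (intro sosf_cmult sosf_square polyf_add polyf_sum polyf_cmult) auto
    ultimately have "sosf d (\<lambda>x. G a a * (m a x + (\<Sum>b\<in>I. (G a b / G a a) * m b x))\<^sup>2 +
        (\<Sum>b\<in>I. \<Sum>c\<in>I. m b x * m c x * G' b c))"
      by (rule sosf_add[rotated])
    moreover have "G a a * (m a x + (\<Sum>b\<in>I. (G a b / G a a) * m b x))\<^sup>2 +
        (\<Sum>b\<in>I. \<Sum>c\<in>I. m b x * m c x * G' b c) =
        (\<Sum>b\<in>insert a I. \<Sum>c\<in>insert a I. m b x * m c x * G b c)" for x
    proof -
      define S where "S = (\<Sum>b\<in>I. G a b * m b x)"
      have "(\<Sum>b\<in>I. (G a b / G a a) * m b x) = S / G a a"
        by (simp add: S_def sum_divide_distrib)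
      moreover have "G a a * (m a x + S / G a a)\<^sup>2 = G a a * (m a x)\<^sup>2 + 2 * m a x * S + S\<^sup>2 / G a a"
        using pos by (simp add: power2_eq_square field_simps)
      ultimately show ?thesis
        unfolding expand[of "\<lambda>b. m b x"] schur[of "\<lambda>b. m b x"] S_def[symmetric] by simp
    qed
    ultimately show ?thesis by simp
  qed
qed

text \<open>Expanding over words instead of exponent vectors avoids multinomial coefficients; the Gram
  matrix below does not mind repeated monomials.\<close>

lemma linform_power:
  "linform y ^ s = (\<Sum>w | length w = s. Const (\<Prod>i\<leftarrow>w. y $ i) * (\<Prod>i\<leftarrow>w. Var i))"
proof (induction s)
  case 0
  then show ?case by (simp add: Const_def)
next
  case (Suc s)
  have "{w :: 'a list. length w = Suc s} = (\<lambda>(i, w). i # w) ` (UNIV \<times> {w. length w = s})"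
    by (auto simp: image_iff length_Suc_conv)
  moreover have "inj_on (\<lambda>(i, w). i # w) (UNIV \<times> {w :: 'a list. length w = s})"
    by (auto simp: inj_on_def)
  ultimately have "(\<Sum>w | length w = Suc s. Const (\<Prod>i\<leftarrow>w. y $ i) * (\<Prod>i\<leftarrow>w. Var i)) =
      (\<Sum>(i, w)\<in>UNIV \<times> {w. length w = s}. Const (\<Prod>j\<leftarrow>i # w. y $ j) * (\<Prod>j\<leftarrow>i # w. Var j))"
    by (simp add: sum.reindex case_prod_unfold)
  also have "\<dots> = (\<Sum>i\<in>UNIV. \<Sum>w | length w = s. (Const (y $ i) * Var i) * (Const (\<Prod>j\<leftarrow>w. y $ j) * (\<Prod>j\<leftarrow>w. Var j)))"
    by (simp add: sum.cartesian_product Const_mult mult_ac)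
  also have "\<dots> = linform y * linform y ^ s"
    unfolding Suc.IH by (subst linform_def) (simp add: sum_product)
  finally show ?case by simp
qed

text \<open>The Gram matrix with respect to the words of length \<open>s\<close> is positive semidefinite because its
  quadratic form is the expectation of \<open>h\<close> times a square. Hence \<open>h\<close> itself need only be nonnegative,
  not a sum of squares.\<close>

lemma sosf_gexp:
  fixes h :: "'v::finite real_mpoly" and Y :: "real ^ 'n::finite \<Rightarrow> real ^ 'v"
  assumes h: "\<And>z. ev h z \<ge> (0::real)" and Y: "\<And>i. polyf 1 (\<lambda>x. Y x $ i)"
  shows "sosf s (\<lambda>x. gexp (h * linform (Y x) ^ (2 * s)))"
proof -
  define I where "I = {w :: 'v list. length w = s}"
  define m where "m w x = (\<Prod>i\<leftarrow>w. Y x $ i)" for w x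
  define X :: "'v list \<Rightarrow> 'v real_mpoly" where "X w = (\<Prod>i\<leftarrow>w. Var i)" for w
  define G where "G a b = gexp (h * (X a * X b))" for a b
  have "finite I" unfolding I_def using finite_lists_length_eq[of "UNIV :: 'v set" s] by simp
  have expand: "gexp (h * (\<Sum>a\<in>I. Const (u a) * X a)\<^sup>2) = (\<Sum>a\<in>I. \<Sum>b\<in>I. u a * u b * G a b)" for u
  proof -
    have "h * (\<Sum>a\<in>I. Const (u a) * X a)\<^sup>2 = (\<Sum>a\<in>I. \<Sum>b\<in>I. Const (u a * u b) * (h * (X a * X b)))"
      unfolding power2_eq_square sum_product unfolding sum_distrib_left
      by (intro sum.cong refl) (simp add: Const_mult mult_ac)
    then show ?thesis by (simp add: gexp_sum G_def)
  qed
  have "polyf s (m w)" if "w \<in> I" for w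
  proof -
    have "polyf (length w) (m w)"
      unfolding m_def by (induction w) (use polyf_mult[OF Y] in \<open>auto intro: polyf_const\<close>)
    then show ?thesis using that by (simp add: I_def)
  qed
  moreover have "(\<Sum>a\<in>I. \<Sum>b\<in>I. u a * u b * G a b) \<ge> 0" for u
    unfolding expand[symmetric] using h by (intro gexp_nonneg) simp
  ultimately have "sosf s (\<lambda>x. \<Sum>a\<in>I. \<Sum>b\<in>I. m a x * m b x * G a b)"
    using \<open>finite I\<close> by (intro sosf_gram) (auto simp: G_def mult.commute)
  moreover have "gexp (h * linform (Y x) ^ (2 * s)) = (\<Sum>a\<in>I. \<Sum>b\<in>I. m a x * m b x * G a b)" for x
    using expand[of "\<lambda>w. m w x"]
    by (simp add: mult.commute[of 2] power_mult linform_power I_def m_def X_def)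
  ultimately show ?thesis by simp
qed

section \<open>Uniform denominators\<close>

text \<open>Homogeneous coordinates of \<open>x\<close>; the extra coordinate has index \<open>None\<close>.\<close>

definition hvec :: "real ^ 'n::finite \<Rightarrow> real ^ 'n option"
  where "hvec x = (\<chi> i. case i of None \<Rightarrow> 1 | Some j \<Rightarrow> x $ j)"

lemma hvec_simps [simp]: "hvec x $ None = 1" "hvec x $ Some j = x $ j"
  by (simp_all add: hvec_def)

lemma sum_option: "(\<Sum>i\<in>UNIV. f i) = f None + (\<Sum>j\<in>(UNIV :: 'n::finite set). f (Some j))"
  by (simp add: UNIV_option_conv sum.reindex)

lemma prod_option: "(\<Prod>i\<in>UNIV. f i) = f None * (\<Prod>j\<in>(UNIV :: 'n::finite set). f (Some j))"
  by (simp add: UNIV_option_conv prod.reindex)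

lemma norm_hvec: "(norm (hvec x))\<^sup>2 = 1 + (norm x)\<^sup>2"
  by (simp add: norm_vec_sq sum_option)

lemma polyf_hvec: "polyf 1 (\<lambda>x. hvec x $ i)"
  by (cases i) (auto intro: polyf_const polyf_coord)

definition mon :: "('v::finite \<Rightarrow>\<^sub>0 nat) \<Rightarrow> real ^ 'v \<Rightarrow> real"
  where "mon \<alpha> y = (\<Prod>i\<in>UNIV. (y $ i) ^ Poly_Mapping.lookup \<alpha> i)"

lemma mon_add: "mon (\<alpha> + \<beta>) y = mon \<alpha> y * mon \<beta> y"
  by (simp add: mon_def lookup_add power_add prod.distrib)

lemma mon_single [simp]: "mon (Poly_Mapping.single i 1) y = y $ i"
  using ev_Var[of i "\<lambda>i. y $ i"] by (simp add: mon_def Var_def)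

lemmas mon_single' [simp] = mon_single[unfolded One_nat_def]

lemma polyf_mon_hvec: "polyf (mdeg \<alpha>) (\<lambda>x. mon \<alpha> (hvec x))"
proof (induction \<alpha> rule: monomial_induct)
  case 0
  then show ?case by (simp add: mon_def polyf_const)
next
  case (Var i \<alpha>)
  then show ?case using polyf_mult[OF polyf_hvec[of i] Var] by (simp add: mon_add)
qed

text \<open>Multiply by \<open>\<bar>hvec x\<bar>\<^sup>2\<close> and replace one factor by a single squared coordinate; the other
  squared coordinates contribute squares.\<close>

lemma sosf_norm_minus_monomial:
  "sosf (mdeg \<beta>) (\<lambda>x. (1 + (norm x)\<^sup>2) ^ mdeg \<beta> - (mon \<beta> (hvec x))\<^sup>2)"
proof (induction \<beta> rule: monomial_induct)
  case 0
  then show ?case by (simp add: mon_def sosf_0)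
next
  case (Var i \<beta>)
  have "sosf 1 (\<lambda>x. (1 + (norm x)\<^sup>2) ^ 1)" by (rule sosf_theta_power)
  from sosf_mult[OF this Var] have
    1: "sosf (1 + mdeg \<beta>) (\<lambda>x. (1 + (norm x)\<^sup>2) * ((1 + (norm x)\<^sup>2) ^ mdeg \<beta> - (mon \<beta> (hvec x))\<^sup>2))" by simp
  have 2: "sosf (1 + mdeg \<beta>) (\<lambda>x. (\<Sum>j\<in>UNIV - {i}. (hvec x $ j)\<^sup>2) * (mon \<beta> (hvec x))\<^sup>2)"
    by (intro sosf_mult sosf_sum sosf_square polyf_hvec polyf_mon_hvec)
  have "(norm (hvec x))\<^sup>2 = (hvec x $ i)\<^sup>2 + (\<Sum>j\<in>UNIV - {i}. (hvec x $ j)\<^sup>2)" for x :: "real ^ 'a"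
    unfolding norm_vec_sq by (rule sum.remove) auto
  then have "1 + (norm x)\<^sup>2 = (hvec x $ i)\<^sup>2 + (\<Sum>j\<in>UNIV - {i}. (hvec x $ j)\<^sup>2)" for x :: "real ^ 'a"
    by (simp add: norm_hvec)
  then have "(1 + (norm x)\<^sup>2) * ((1 + (norm x)\<^sup>2) ^ mdeg \<beta> - (mon \<beta> (hvec x))\<^sup>2) +
      (\<Sum>j\<in>UNIV - {i}. (hvec x $ j)\<^sup>2) * (mon \<beta> (hvec x))\<^sup>2 =
      (1 + (norm x)\<^sup>2) ^ Suc (mdeg \<beta>) - (hvec x $ i * mon \<beta> (hvec x))\<^sup>2" for x :: "real ^ 'a"
    by (simp add: right_diff_distrib power_mult_distrib) (simp add: algebra_simps)
  with sosf_add[OF 1 2] show ?case by (simp add: mon_add)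
qed

lemma split_exponent:
  "mdeg \<alpha> = a + b \<Longrightarrow> \<exists>\<beta> \<gamma>. \<alpha> = \<beta> + \<gamma> \<and> mdeg \<beta> = a \<and> mdeg \<gamma> = b"
proof (induction \<alpha> arbitrary: a rule: monomial_induct)
  case 0
  then show ?case by (intro exI[of _ 0]) simp
next
  case (Var i \<alpha>)
  show ?case
  proof (cases a)
    case 0
    then show ?thesis using Var.prems by (intro exI[of _ 0] exI[of _ "Poly_Mapping.single i 1 + \<alpha>"]) simp
  next
    case (Suc a')
    then obtain \<beta> \<gamma> where "\<alpha> = \<beta> + \<gamma>" "mdeg \<beta> = a'" "mdeg \<gamma> = b" using Var.IH[of a'] Var.prems by auto
    then show ?thesis using Suc
      by (intro exI[of _ "Poly_Mapping.single i 1 + \<beta>"] exI[of _ \<gamma>]) (simp add: add.assoc)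
  qed
qed

text \<open>Write the monomial as a product of two monomials of degree \<open>K\<close> and complete the square.\<close>

lemma sosf_monomial_absorbed:
  assumes "mdeg \<alpha> = 2 * K"
  shows "sosf K (\<lambda>x. c * mon \<alpha> (hvec x) + \<bar>c\<bar> * (1 + (norm x)\<^sup>2) ^ K)"
proof -
  obtain \<beta> \<gamma> where \<alpha>: "\<alpha> = \<beta> + \<gamma>" "mdeg \<beta> = K" "mdeg \<gamma> = K"
    using split_exponent[of \<alpha> K K] assms by auto
  have "sosf K (\<lambda>x. \<bar>c\<bar> / 2 * (mon \<beta> (hvec x) + sgn c * mon \<gamma> (hvec x))\<^sup>2)"
    using polyf_mon_hvec[of \<beta>] polyf_mon_hvec[of \<gamma>] \<alpha>
    by (intro sosf_cmult sosf_square polyf_add polyf_cmult) auto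
  moreover have "sosf K (\<lambda>x. \<bar>c\<bar> / 2 * ((1 + (norm x)\<^sup>2) ^ K - (mon \<beta> (hvec x))\<^sup>2))"
    using sosf_norm_minus_monomial[of \<beta>] \<alpha> by (intro sosf_cmult) auto
  moreover have "sosf K (\<lambda>x. \<bar>c\<bar> / 2 * ((1 + (norm x)\<^sup>2) ^ K - (mon \<gamma> (hvec x))\<^sup>2))"
    using sosf_norm_minus_monomial[of \<gamma>] \<alpha> by (intro sosf_cmult) auto
  ultimately have "sosf K (\<lambda>x. \<bar>c\<bar> / 2 * (mon \<beta> (hvec x) + sgn c * mon \<gamma> (hvec x))\<^sup>2 +
     (\<bar>c\<bar> / 2 * ((1 + (norm x)\<^sup>2) ^ K - (mon \<beta> (hvec x))\<^sup>2) +
      \<bar>c\<bar> / 2 * ((1 + (norm x)\<^sup>2) ^ K - (mon \<gamma> (hvec x))\<^sup>2)))"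
    by (intro sosf_add)
  moreover have "\<bar>c\<bar> / 2 * (p + sgn c * q)\<^sup>2 + (\<bar>c\<bar> / 2 * (t - p\<^sup>2) + \<bar>c\<bar> / 2 * (t - q\<^sup>2)) = c * (p * q) + \<bar>c\<bar> * t"
    for p q t :: real
  proof -
    define h where "h = \<bar>c\<bar> / 2"
    have "2 * h * sgn c = c" "h * (sgn c)\<^sup>2 = h" "\<bar>c\<bar> = 2 * h"
      by (simp_all add: h_def abs_mult_sgn sgn_if)
    moreover have "h * (p + s * q)\<^sup>2 + (h * (t - p\<^sup>2) + h * (t - q\<^sup>2)) =
        (2 * h * s) * (p * q) + (h * s\<^sup>2) * q\<^sup>2 - h * q\<^sup>2 + (2 * h) * t" for s
      by (simp add: power2_eq_square algebra_simps)
    ultimately show ?thesis unfolding h_def[symmetric] by simp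
  qed
  ultimately show ?thesis by (simp add: \<alpha>(1) mon_add)
qed

lemma eval_mpoly_mon: "eval_mpoly p y = (\<Sum>\<alpha>\<in>Poly_Mapping.keys p. Poly_Mapping.lookup p \<alpha> * mon \<alpha> y)"
  by (simp add: eval_mpoly_def mon_def)

text \<open>This absorbs the error term of a truncated Neumann series, and it settles the case of large
  \<open>\<epsilon>\<close>.\<close>

lemma sosf_form_absorbed:
  assumes R: "hom (2 * K) R" and \<tau>: "(\<Sum>\<alpha>\<in>Poly_Mapping.keys R. \<bar>Poly_Mapping.lookup R \<alpha>\<bar>) \<le> \<tau>"
  shows "sosf K (\<lambda>x. eval_mpoly R (hvec x) + \<tau> * (1 + (norm x)\<^sup>2) ^ K)"
proof -
  let ?S = "\<Sum>\<alpha>\<in>Poly_Mapping.keys R. \<bar>Poly_Mapping.lookup R \<alpha>\<bar>"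
  have "sosf K (\<lambda>x. \<Sum>\<alpha>\<in>Poly_Mapping.keys R. Poly_Mapping.lookup R \<alpha> * mon \<alpha> (hvec x) +
      \<bar>Poly_Mapping.lookup R \<alpha>\<bar> * (1 + (norm x)\<^sup>2) ^ K)"
    using R by (intro sosf_sum sosf_monomial_absorbed) (auto simp: hom_def)
  moreover have "sosf K (\<lambda>x. (\<tau> - ?S) * (1 + (norm x)\<^sup>2) ^ K)"
    using \<tau> by (intro sosf_cmult sosf_theta_power) auto
  ultimately have "sosf K (\<lambda>x. (\<Sum>\<alpha>\<in>Poly_Mapping.keys R. Poly_Mapping.lookup R \<alpha> * mon \<alpha> (hvec x) +
      \<bar>Poly_Mapping.lookup R \<alpha>\<bar> * (1 + (norm x)\<^sup>2) ^ K) + (\<tau> - ?S) * (1 + (norm x)\<^sup>2) ^ K)"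
    by (rule sosf_add)
  then show ?thesis by (simp add: eval_mpoly_mon sum.distrib sum_distrib_right[symmetric] algebra_simps)
qed

lemma finite_mdeg_eq: "finite {\<alpha> :: 'v::finite \<Rightarrow>\<^sub>0 nat. mdeg \<alpha> = d}"
proof (rule finite_imageD)
  have "Poly_Mapping.lookup ` {\<alpha> :: 'v \<Rightarrow>\<^sub>0 nat. mdeg \<alpha> = d} \<subseteq> (\<Pi>\<^sub>E i\<in>UNIV. {..d})"
    by (auto simp: mdeg_def intro!: member_le_sum)
  then show "finite (Poly_Mapping.lookup ` {\<alpha> :: 'v \<Rightarrow>\<^sub>0 nat. mdeg \<alpha> = d})"
    by (rule finite_subset) (intro finite_PiE, auto)
  show "inj_on Poly_Mapping.lookup {\<alpha> :: 'v \<Rightarrow>\<^sub>0 nat. mdeg \<alpha> = d}"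
    by (rule inj_onI, rule poly_mapping_eqI, erule fun_cong)
qed

text \<open>A telescoping sum, inverting \<open>1 - V\<close> up to the \<open>n\<close>-th power of the defect operator \<open>V\<close>.\<close>

lemma defect_pow_sum: "(\<Sum>i<n. (defect k K ^^ i) H) - defect k K (\<Sum>i<n. (defect k K ^^ i) H) = H - (defect k K ^^ n) H"
proof (induction n)
  case 0
  then show ?case by (simp add: defect_def lap_pow_0)
next
  case (Suc n)
  let ?S = "\<Sum>i<n. (defect k K ^^ i) H" and ?T = "(defect k K ^^ n) H"
  have "?S + ?T - defect k K (?S + ?T) = (?S - defect k K ?S) + (?T - defect k K ?T)"
    by (simp add: defect_add)
  also have "\<dots> = (H - ?T) + (?T - defect k K ?T)" by (simp only: Suc)
  finally show ?case by simp
qed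

text \<open>Write \<open>V\<close> for the defect operator and \<open>H' = H - (\<delta>/2) \<bar>y\<bar>\<^bsup>2K\<^esup>\<close>. The truncated Neumann series
  \<open>h = \<Sum>\<^bsub>i<n\<^esub> V\<^sup>i H'\<close> is still nonnegative because \<open>V\<close> shrinks forms by a factor of at most \<open>\<delta> / (4 M)\<close>.
  Its pairing is a sum of squares, and it equals \<open>\<bar>y\<bar>\<^bsup>2k\<^esup> (H' - V\<^sup>n H')\<close> up to a positive constant. The
  error \<open>V\<^sup>n H'\<close> has coefficients tending to \<open>0\<close> and is absorbed by the part \<open>(\<delta>/2) \<bar>y\<bar>\<^bsup>2K\<^esup>\<close> that was
  put aside.\<close>

theorem sosf_positive_form:
  fixes H :: "'n::finite option real_mpoly"
  assumes H: "hom (2 * K) H"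
    and bounds: "\<And>y. \<delta> * norm y ^ (2 * K) \<le> eval_mpoly H y" "\<And>y. eval_mpoly H y \<le> M * norm y ^ (2 * K)"
    and \<delta>: "0 < \<delta>" "\<delta> \<le> M" and K: "K \<ge> 1"
    and k: "real k \<ge> 2 * real CARD('n option) * (24 * real K)\<^sup>2 * M / \<delta>"
  shows "sosf (k + K) (\<lambda>x. (1 + (norm x)\<^sup>2) ^ k * eval_mpoly H (hvec x))"
proof -
  define \<beta> where "\<beta> = real CARD('n option) * (24 * real K)\<^sup>2"
  have \<beta>: "\<beta> > 0" using K by (simp add: \<beta>_def card_UNIV_option)
  have k\<beta>: "2 * \<beta> * M \<le> real k * \<delta>" using k \<delta> by (simp add: \<beta>_def field_simps)
  have "0 < 2 * \<beta> * M" using \<beta> \<delta> by simp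
  then have "0 < real k * \<delta>" using k\<beta> by linarith
  then have k1: "k \<ge> 1" using \<delta> by (simp add: zero_less_mult_iff)
  define \<rho> where "\<rho> = \<beta> / (2 * real k)"
  have \<rho>M: "4 * \<rho> * M \<le> \<delta>" using k\<beta> k1 by (simp add: \<rho>_def field_simps)
  have \<rho>0: "\<rho> > 0" using \<beta> k1 by (simp add: \<rho>_def)
  have "4 * \<rho> * \<delta> \<le> 4 * \<rho> * M" using \<rho>0 \<delta> by (intro mult_left_mono) auto
  then have "4 * \<rho> * \<delta> \<le> 1 * \<delta>" using \<rho>M by linarith
  then have \<rho>1: "\<rho> \<le> 1 / 4" using \<delta> by (simp add: mult_le_cancel_right)
  define H' where "H' = H - Const (\<delta> / 2) * norm_sq ^ K"
  have eval_H': "eval_mpoly H' y = eval_mpoly H y - \<delta> / 2 * norm y ^ (2 * K)" for y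
    by (simp add: H'_def eval_mpoly_eq_ev eval_norm_sq[unfolded eval_mpoly_eq_ev] power_mult)
  have "hom (2 * K) H'"
    unfolding H'_def using hom_power[OF hom_norm_sq, of K, where 'a = "'n option"]
    by (intro hom_diff H hom_Const_mult) (simp add: mult.commute)
  moreover have "\<bar>eval_mpoly H' y\<bar> \<le> M * norm y ^ (2 * K)" for y
  proof -
    have "0 \<le> \<delta> * norm y ^ (2 * K)" using \<delta> by simp
    then show ?thesis using bounds[of y] unfolding eval_H' by linarith
  qed
  ultimately have H': "bounded_form (2 * K) M H'" by (simp add: bounded_form_def)
  have V: "bounded_form (2 * K) (\<rho> ^ i * M) ((defect k K ^^ i) H')" for i
  proof (induction i)
    case (Suc i)
    from bounded_form_defect[OF this k1, of \<rho>] show ?case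
      using \<rho>1 by (simp add: \<rho>_def \<beta>_def mult.assoc)
  qed (use H' in simp)
  define C where "C = real (card {\<alpha> :: 'n option \<Rightarrow>\<^sub>0 nat. mdeg \<alpha> = 2 * K}) * (12 * real (2 * K)) ^ (2 * K) * M"
  have "(\<lambda>n. C * \<rho> ^ n) \<longlonglongrightarrow> C * 0"
    using \<rho>0 \<rho>1 by (intro tendsto_mult_left LIMSEQ_power_zero) auto
  then have "\<forall>\<^sub>F n in sequentially. C * \<rho> ^ n < \<delta> / 2"
    using \<delta> by (intro order_tendstoD) auto
  then obtain n0 where n0: "\<And>n. n \<ge> n0 \<Longrightarrow> C * \<rho> ^ n < \<delta> / 2"
    by (auto simp: eventually_sequentially)
  define n where "n = Suc n0"
  have n: "C * \<rho> ^ n < \<delta> / 2" using n0[of n] by (simp add: n_def)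
  define h where "h = (\<Sum>i<n. (defect k K ^^ i) H')"
  define R where "R = (defect k K ^^ n) H'"
  have hR: "h - defect k K h = H' - R" unfolding h_def R_def by (rule defect_pow_sum)
  have hom_h: "hom (2 * K) h"
    unfolding h_def using V by (intro hom_sum) (auto simp: bounded_form_def)
  have h_nonneg: "eval_mpoly h y \<ge> 0" for y
  proof -
    have "eval_mpoly h y = (\<Sum>i<n. eval_mpoly ((defect k K ^^ i) H') y)"
      by (simp add: h_def eval_mpoly_eq_ev)
    also have "\<dots> = eval_mpoly H' y + (\<Sum>i=1..n0. eval_mpoly ((defect k K ^^ i) H') y)"
      unfolding n_def by (subst sum.lessThan_Suc_shift) (simp add: sum.atLeast1_atMost_eq)
    finally have 1: "eval_mpoly h y = eval_mpoly H' y + (\<Sum>i=1..n0. eval_mpoly ((defect k K ^^ i) H') y)" .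
    have "\<bar>\<Sum>i=1..n0. eval_mpoly ((defect k K ^^ i) H') y\<bar> \<le> (\<Sum>i=1..n0. \<rho> ^ i * (M * norm y ^ (2 * K)))"
    proof (rule order_trans[OF sum_abs sum_mono])
      fix i
      show "\<bar>eval_mpoly ((defect k K ^^ i) H') y\<bar> \<le> \<rho> ^ i * (M * norm y ^ (2 * K))"
        using V[of i] by (auto simp: bounded_form_def mult.assoc)
    qed
    also have "\<dots> = (\<Sum>i=1..n0. \<rho> ^ i) * (M * norm y ^ (2 * K))" by (simp add: sum_distrib_right)
    also have "\<dots> \<le> 2 * \<rho> * (M * norm y ^ (2 * K))"
      using \<rho>0 \<rho>1 \<delta> by (intro mult_right_mono geometric_sum_le) auto
    also have "\<dots> = (4 * \<rho> * M) / 2 * norm y ^ (2 * K)" by simp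
    also have "\<dots> \<le> \<delta> / 2 * norm y ^ (2 * K)" using \<rho>M by (intro mult_right_mono divide_right_mono) auto
    finally have "\<bar>\<Sum>i=1..n0. eval_mpoly ((defect k K ^^ i) H') y\<bar> \<le> \<delta> / 2 * norm y ^ (2 * K)" .
    moreover have "\<delta> / 2 * norm y ^ (2 * K) \<le> eval_mpoly H' y"
      using bounds(1)[of y] unfolding eval_H' by (simp add: field_simps)
    ultimately show ?thesis unfolding 1 by linarith
  qed
  have "ev h z \<ge> 0" for z :: "'n option \<Rightarrow> real"
    using h_nonneg[of "\<chi> i. z i"] by (simp add: eval_mpoly_eq_ev)
  then have "sosf (k + K) (\<lambda>x. gexp (h * linform (hvec x) ^ (2 * (k + K))))"
    by (rule sosf_gexp) (rule polyf_hvec)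
  then have "sosf (k + K) (\<lambda>x. (2 ^ k * fact k / fact (2 * (k + K))) * gexp (h * linform (hvec x) ^ (2 * (k + K))))"
    by (intro sosf_cmult) auto
  moreover have "(2 ^ k * fact k / fact (2 * (k + K))) * gexp (h * linform (hvec x) ^ (2 * (k + K))) =
      (1 + (norm x)\<^sup>2) ^ k * eval_mpoly (H' - R) (hvec x)" for x :: "real ^ 'n"
  proof -
    have "(2 ^ k * fact k / fact (2 * (k + K))) * gexp (h * linform (hvec x) ^ (2 * (k + K)))
        = 2 ^ k * fact k * pairing (2 * (k + K)) (hvec x) h"
      by (simp only: pairing_def times_divide_eq_left times_divide_eq_right)
    also have "\<dots> = (1 + (norm x)\<^sup>2) ^ k * eval_mpoly (H' - R) (hvec x)"
      unfolding pairing_eq_defect[OF hom_h] hR norm_hvec by simp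
    finally show ?thesis .
  qed
  ultimately have main: "sosf (k + K) (\<lambda>x. (1 + (norm x)\<^sup>2) ^ k * eval_mpoly (H' - R) (hvec x))"
    by simp
  have "(\<Sum>\<alpha>\<in>Poly_Mapping.keys R. \<bar>Poly_Mapping.lookup R \<alpha>\<bar>) \<le> \<delta> / 2"
  proof -
    have R: "bounded_form (2 * K) (\<rho> ^ n * M) R" unfolding R_def by (rule V)
    then have keys: "Poly_Mapping.keys R \<subseteq> {\<alpha>. mdeg \<alpha> = 2 * K}" by (auto simp: bounded_form_def hom_def)
    have "(\<Sum>\<alpha>\<in>Poly_Mapping.keys R. \<bar>Poly_Mapping.lookup R \<alpha>\<bar>) \<le>
        (\<Sum>\<alpha>\<in>Poly_Mapping.keys R. (12 * real (2 * K)) ^ (2 * K) * (\<rho> ^ n * M))"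
      using keys by (intro sum_mono bounded_form_lookup[OF R]) auto
    also have "\<dots> = real (card (Poly_Mapping.keys R)) * ((12 * real (2 * K)) ^ (2 * K) * (\<rho> ^ n * M))" by simp
    also have "\<dots> \<le> real (card {\<alpha> :: 'n option \<Rightarrow>\<^sub>0 nat. mdeg \<alpha> = 2 * K}) * ((12 * real (2 * K)) ^ (2 * K) * (\<rho> ^ n * M))"
      using keys \<rho>0 \<delta> by (intro mult_right_mono of_nat_mono card_mono finite_mdeg_eq) auto
    also have "\<dots> = C * \<rho> ^ n" by (simp add: C_def)
    finally show ?thesis using n by linarith
  qed
  moreover have "hom (2 * K) R" using V unfolding R_def by (auto simp: bounded_form_def)
  ultimately have "sosf K (\<lambda>x. eval_mpoly R (hvec x) + \<delta> / 2 * (1 + (norm x)\<^sup>2) ^ K)"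
    by (intro sosf_form_absorbed)
  from sosf_add[OF main sosf_mult[OF sosf_theta_power[of k] this]]
  have "sosf (k + K) (\<lambda>x. (1 + (norm x)\<^sup>2) ^ k * eval_mpoly (H' - R) (hvec x) +
      (1 + (norm x)\<^sup>2) ^ k * (eval_mpoly R (hvec x) + \<delta> / 2 * (1 + (norm x)\<^sup>2) ^ K))" .
  moreover have "(1 + (norm x)\<^sup>2) ^ k * eval_mpoly (H' - R) (hvec x) +
      (1 + (norm x)\<^sup>2) ^ k * (eval_mpoly R (hvec x) + \<delta> / 2 * (1 + (norm x)\<^sup>2) ^ K) =
      (1 + (norm x)\<^sup>2) ^ k * eval_mpoly H (hvec x)" for x :: "real ^ 'n"
  proof -
    have "eval_mpoly (H' - R) (hvec x) + (eval_mpoly R (hvec x) + \<delta> / 2 * (1 + (norm x)\<^sup>2) ^ K)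
      = eval_mpoly H' (hvec x) + \<delta> / 2 * (1 + (norm x)\<^sup>2) ^ K"
      by (simp add: eval_mpoly_eq_ev)
    also have "\<dots> = eval_mpoly H (hvec x)" by (simp add: eval_H' power_mult norm_hvec)
    finally show ?thesis by (simp only: distrib_left[symmetric])
  qed
  ultimately show ?thesis by simp
qed

section \<open>Homogenization\<close>

definition emb :: "nat \<Rightarrow> ('n::finite \<Rightarrow>\<^sub>0 nat) \<Rightarrow> ('n option \<Rightarrow>\<^sub>0 nat)"
  where "emb D \<alpha> = Abs_poly_mapping (\<lambda>i. case i of None \<Rightarrow> D - mdeg \<alpha> | Some j \<Rightarrow> Poly_Mapping.lookup \<alpha> j)"

lemma lookup_emb: "Poly_Mapping.lookup (emb D \<alpha>) i =
    (case i of None \<Rightarrow> D - mdeg \<alpha> | Some j \<Rightarrow> Poly_Mapping.lookup \<alpha> j)"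
  unfolding emb_def by (subst lookup_Abs_poly_mapping) auto

lemma mdeg_emb: "mdeg \<alpha> \<le> D \<Longrightarrow> mdeg (emb D \<alpha>) = D"
  by (simp add: mdeg_def sum_option lookup_emb)

definition homogenize :: "nat \<Rightarrow> 'n::finite real_mpoly \<Rightarrow> 'n option real_mpoly"
  where "homogenize D p = (\<Sum>\<alpha>\<in>Poly_Mapping.keys p. Poly_Mapping.single (emb D \<alpha>) (Poly_Mapping.lookup p \<alpha>))"

lemma hom_homogenize: "total_degree p \<le> D \<Longrightarrow> hom D (homogenize D p)"
  unfolding homogenize_def total_degree_le_iff
  by (intro hom_sum) (auto simp: hom_def mdeg_emb)

lemma eval_homogenize: "eval_mpoly (homogenize D p) y =
    (\<Sum>\<alpha>\<in>Poly_Mapping.keys p. Poly_Mapping.lookup p \<alpha> *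
      ((y $ None) ^ (D - mdeg \<alpha>) * (\<Prod>j\<in>UNIV. (y $ Some j) ^ Poly_Mapping.lookup \<alpha> j)))"
  by (simp add: homogenize_def eval_mpoly_eq_ev prod_option lookup_emb)

lemma eval_homogenize_hvec: "eval_mpoly (homogenize D p) (hvec x) = eval_mpoly p x"
  unfolding eval_homogenize eval_mpoly_def[of p] by simp

lemma eval_homogenize_scale:
  assumes "total_degree p \<le> D"
  shows "eval_mpoly (homogenize D p) (c *\<^sub>R hvec x) = c ^ D * eval_mpoly p x"
  by (simp add: eval_hom_scaleR[OF hom_homogenize[OF assms]] eval_homogenize_hvec)

lemma hvec_decompose:
  assumes "y $ None \<noteq> (0 :: real)"
  shows "y = (y $ None) *\<^sub>R hvec (\<chi> j. y $ Some j / y $ None)"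
proof -
  have "y $ i = ((y $ None) *\<^sub>R hvec (\<chi> j. y $ Some j / y $ None)) $ i" for i
    using assms by (cases i) auto
  then show ?thesis by (subst vec_eq_iff) blast
qed

lemma continuous_on_eval_mpoly [continuous_intros]:
  "continuous_on S f \<Longrightarrow> continuous_on S (\<lambda>x. eval_mpoly p (f x))"
  unfolding eval_mpoly_def by (intro continuous_intros)

text \<open>Reznick's theorem on uniform denominators in affine form, with a denominator exponent
  proportional to \<open>K\<^sup>2 M / \<delta>\<close>. The bounds for the homogenization at infinity follow by continuity.\<close>

theorem sosf_positive_polynomial:
  fixes p :: "'n::finite real_mpoly"
  assumes deg: "total_degree p \<le> 2 * K"
    and bounds: "\<And>x. \<delta> * (1 + (norm x)\<^sup>2) ^ K \<le> eval_mpoly p x" "\<And>x. eval_mpoly p x \<le> M * (1 + (norm x)\<^sup>2) ^ K"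
    and \<delta>: "0 < \<delta>" "\<delta> \<le> M" and K: "K \<ge> 1"
    and k: "real k \<ge> 2 * real CARD('n option) * (24 * real K)\<^sup>2 * M / \<delta>"
  shows "sosf (k + K) (\<lambda>x. (1 + (norm x)\<^sup>2) ^ k * eval_mpoly p x)"
proof -
  let ?H = "homogenize (2 * K) p"
  have affine: "\<delta> * norm y ^ (2 * K) \<le> eval_mpoly ?H y \<and> eval_mpoly ?H y \<le> M * norm y ^ (2 * K)"
    if nz: "y $ None \<noteq> 0" for y
  proof -
    obtain c x where y: "y = c *\<^sub>R hvec x" using hvec_decompose[OF nz] by blast
    have "norm y ^ (2 * K) = c ^ (2 * K) * (1 + (norm x)\<^sup>2) ^ K"
      by (simp add: y power_mult_distrib power_mult norm_hvec)
    moreover have "eval_mpoly ?H y = c ^ (2 * K) * eval_mpoly p x"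
      unfolding y by (rule eval_homogenize_scale[OF deg])
    moreover have "c ^ (2 * K) \<ge> 0" by simp
    ultimately show ?thesis
      using mult_left_mono[OF bounds(1)[of x], of "c ^ (2 * K)"] mult_left_mono[OF bounds(2)[of x], of "c ^ (2 * K)"]
      by (simp add: mult.left_commute)
  qed
  have all: "\<delta> * norm y ^ (2 * K) \<le> eval_mpoly ?H y \<and> eval_mpoly ?H y \<le> M * norm y ^ (2 * K)" for y
  proof (cases "y $ None = 0")
    case True
    let ?y = "\<lambda>s. y + s *\<^sub>R axis None (1 :: real)"
    have cont: "((\<lambda>s. \<phi> (?y s)) \<longlongrightarrow> \<phi> y) (at_right 0)" if "continuous_on UNIV \<phi>" for \<phi> :: "real ^ 'n option \<Rightarrow> real"
    proof -
      have "continuous_on UNIV (\<lambda>s. \<phi> (?y s))"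
        by (rule continuous_on_compose2[OF that]) (auto intro!: continuous_intros)
      then have "isCont (\<lambda>s. \<phi> (?y s)) 0" by (simp add: continuous_on_eq_continuous_at)
      then show ?thesis by (auto simp: isCont_def intro: tendsto_within_subset)
    qed
    have near: "\<forall>\<^sub>F s in at_right 0. (?y s) $ None \<noteq> 0"
      using eventually_at_right_less[of 0] by eventually_elim (simp add: True axis_def)
    have "\<delta> * norm y ^ (2 * K) \<le> eval_mpoly ?H y"
    proof (rule tendsto_le[OF trivial_limit_at_right_real cont cont])
      show "\<forall>\<^sub>F s in at_right 0. \<delta> * norm (?y s) ^ (2 * K) \<le> eval_mpoly ?H (?y s)"
        using near by eventually_elim (use affine in blast)
    qed (intro continuous_intros)+
    moreover have "eval_mpoly ?H y \<le> M * norm y ^ (2 * K)"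
    proof (rule tendsto_le[OF trivial_limit_at_right_real cont cont])
      show "\<forall>\<^sub>F s in at_right 0. eval_mpoly ?H (?y s) \<le> M * norm (?y s) ^ (2 * K)"
        using near by eventually_elim (use affine in blast)
    qed (intro continuous_intros)+
    ultimately show ?thesis by simp
  qed (rule affine)
  have "sosf (k + K) (\<lambda>x. (1 + (norm x)\<^sup>2) ^ k * eval_mpoly ?H (hvec x))"
    using all by (intro sosf_positive_form[OF hom_homogenize[OF deg] _ _ \<delta> K k]) auto
  then show ?thesis by (simp add: eval_homogenize_hvec)
qed

section \<open>The infimum of a polynomial family is an algebraic function of the parameter\<close>

text \<open>Families of polynomials in \<open>z\<^sub>0, \<dots>, z\<^bsub>K-1\<^esub>\<close> of degree at most \<open>d\<close> whose coefficients are polynomials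
  in a parameter \<open>t\<close>. The variables are indexed by natural numbers because their number depends on
  the number of constraints.\<close>

inductive PF :: "nat \<Rightarrow> nat \<Rightarrow> (real \<Rightarrow> (nat \<Rightarrow> real) \<Rightarrow> real) \<Rightarrow> bool" for K
  where
    PF_const: "PF K d (\<lambda>t z. poly c t)"
  | PF_var: "PF K d p \<Longrightarrow> i < K \<Longrightarrow> PF K (Suc d) (\<lambda>t z. z i * p t z)"
  | PF_add: "PF K d p \<Longrightarrow> PF K d q \<Longrightarrow> PF K d (\<lambda>t z. p t z + q t z)"

lemma PF_mono: "PF K d p \<Longrightarrow> d \<le> e \<Longrightarrow> PF K e p"
proof (induction arbitrary: e rule: PF.induct)
  case (PF_var d p i)
  then obtain e' where "e = Suc e'" "d \<le> e'" by (metis Suc_le_D Suc_le_mono)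
  then show ?case using PF_var by (auto intro: PF.PF_var)
qed (auto intro: PF.intros)

lemma PF_mult: "PF K d p \<Longrightarrow> PF K e q \<Longrightarrow> PF K (d + e) (\<lambda>t z. p t z * q t z)"
proof (induction rule: PF.induct)
  case (PF_const d c)
  have "PF K e (\<lambda>t z. poly c t * q t z)"
    using PF_const
  proof (induction rule: PF.induct)
    case (PF_const d b)
    then show ?case using PF.PF_const[of K d "c * b"] by simp
  next
    case (PF_var d p i)
    then show ?case using PF.PF_var[of K d _ i] by (simp add: mult.left_commute)
  next
    case (PF_add d p q)
    then show ?case using PF.PF_add by (simp add: distrib_left)
  qed
  then show ?case by (rule PF_mono) simp
next
  case (PF_var d p i)
  then show ?case using PF.PF_var[of K "d + e" _ i] by (simp add: mult.assoc)
next
  case (PF_add d p p')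
  then show ?case using PF.PF_add by (simp add: distrib_right)
qed

lemma PF_real: "PF K d (\<lambda>t z. c)"
  using PF_const[of K d "[:c:]"] by simp

lemma PF_param: "PF K d (\<lambda>t z. t)"
  using PF_const[of K d "[:0, 1:]"] by simp

lemma PF_coord: "i < K \<Longrightarrow> PF K 1 (\<lambda>t z. z i)"
  using PF_var[OF PF_real[of K 0 1], of i] by simp

lemma PF_power: "PF K d p \<Longrightarrow> PF K (k * d) (\<lambda>t z. p t z ^ k)"
  by (induction k) (auto intro: PF_real PF_mult)

lemma PF_sum: "(\<And>i. i \<in> A \<Longrightarrow> PF K d (p i)) \<Longrightarrow> PF K d (\<lambda>t z. \<Sum>i\<in>A. p i t z)"
  by (induction A rule: infinite_finite_induct) (auto intro: PF_real PF_add)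

lemma PF_prod:
  "finite A \<Longrightarrow> (\<And>i. i \<in> A \<Longrightarrow> PF K (d i) (p i)) \<Longrightarrow> PF K (sum d A) (\<lambda>t z. \<Prod>i\<in>A. p i t z)"
  by (induction A rule: finite_induct) (auto intro: PF_real PF_mult)

lemma PF_continuous: "PF K d p \<Longrightarrow> continuous_on S (\<lambda>z. p t z)"
proof (induction rule: PF.induct)
  case (PF_var d p i)
  have "continuous_on S (\<lambda>z :: nat \<Rightarrow> real. z i)"
    by (rule continuous_on_subset[OF continuous_on_product_coordinates]) simp
  then show ?case using PF_var by (auto intro!: continuous_intros)
qed (auto intro!: continuous_intros)

lemma PF_cong: "PF K d p \<Longrightarrow> (\<And>i. i < K \<Longrightarrow> z i = z' i) \<Longrightarrow> p t z = p t z'"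
  by (induction rule: PF.induct) auto

text \<open>The drop of the degree matters: it makes the reduction modulo the critical equations terminate.
  In degree \<open>0\<close> there is no room for it, hence the alternative.\<close>

lemma PF_derivative:
  assumes "PF K d p"
  shows "\<exists>p'. (\<forall>t z. ((\<lambda>s. p t (z(i := s))) has_field_derivative p' t z) (at (z i))) \<and>
      (p' = (\<lambda>t z. 0) \<or> (\<exists>e. d = Suc e \<and> PF K e p'))"
  using assms
proof (induction rule: PF.induct)
  case (PF_const d c)
  show ?case by (rule exI[of _ "\<lambda>t z. 0"]) simp
next
  case (PF_var d p j)
  from PF_var.IH obtain p' where
    p': "\<forall>t z. ((\<lambda>s. p t (z(i := s))) has_field_derivative p' t z) (at (z i))"
    and deg: "p' = (\<lambda>t z. 0) \<or> (\<exists>e. d = Suc e \<and> PF K e p')" by (elim exE conjE)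
  define q where "q = (\<lambda>t z. (if j = i then 1 else 0) * p t z + z j * p' t z)"
  have "((\<lambda>s. (z(i := s)) j * p t (z(i := s))) has_field_derivative q t z) (at (z i))" for t z
  proof -
    have "((\<lambda>s. (z(i := s)) j) has_field_derivative (if j = i then 1 else 0)) (at (z i))"
      by auto
    from DERIV_mult[OF this p'[rule_format, of t z]] show ?thesis by (simp add: q_def algebra_simps)
  qed
  moreover have "PF K d q"
  proof -
    have "PF K d (\<lambda>t z. z j * p' t z)" using deg
    proof
      assume "p' = (\<lambda>t z. 0)"
      then show ?thesis using PF_real[of K d 0] by simp
    next
      assume "\<exists>e. d = Suc e \<and> PF K e p'"
      then show ?thesis using PF_var.hyps(2) PF.PF_var by blast
    qed
    moreover have "PF K d (\<lambda>t z. (if j = i then 1 else 0) * p t z)"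
      using PF_mult[OF PF_real[of K 0] PF_var.hyps(1)] by simp
    ultimately show ?thesis unfolding q_def by (rule PF.PF_add[rotated])
  qed
  ultimately show ?case by (intro exI[of _ q]) (auto simp del: fun_upd_apply)
next
  case (PF_add d p q)
  from PF_add.IH(1) obtain p' where
    p': "\<forall>t z. ((\<lambda>s. p t (z(i := s))) has_field_derivative p' t z) (at (z i))"
      "p' = (\<lambda>t z. 0) \<or> (\<exists>e. d = Suc e \<and> PF K e p')" by (elim exE conjE)
  from PF_add.IH(2) obtain q' where
    q': "\<forall>t z. ((\<lambda>s. q t (z(i := s))) has_field_derivative q' t z) (at (z i))"
      "q' = (\<lambda>t z. 0) \<or> (\<exists>e. d = Suc e \<and> PF K e q')" by (elim exE conjE)
  have "(\<lambda>t z. p' t z + q' t z) = (\<lambda>t z. 0) \<or> (\<exists>e. d = Suc e \<and> PF K e (\<lambda>t z. p' t z + q' t z))"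
    using p'(2) q'(2) by (auto intro: PF.PF_add)
  moreover have "((\<lambda>s. p t (z(i := s)) + q t (z(i := s))) has_field_derivative p' t z + q' t z) (at (z i))" for t z
    using DERIV_add[OF p'(1)[rule_format, of t z] q'(1)[rule_format, of t z]] .
  ultimately show ?case
    by (intro exI[of _ "\<lambda>t z. p' t z + q' t z"]) (simp del: fun_upd_apply)
qed

text \<open>The outer variable is the perturbation \<open>\<delta>\<close>, the inner one the parameter \<open>t\<close>.\<close>

definition ev2 :: "real poly poly \<Rightarrow> real \<Rightarrow> real \<Rightarrow> real"
  where "ev2 r t \<delta> = poly (poly r [:\<delta>:]) t"

lemma ev2_simps [simp]:
  "ev2 0 t \<delta> = 0" "ev2 (r + s) t \<delta> = ev2 r t \<delta> + ev2 s t \<delta>" "ev2 (r * s) t \<delta> = ev2 r t \<delta> * ev2 s t \<delta>"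
  "ev2 [:c:] t \<delta> = poly c t" "ev2 (r ^ k) t \<delta> = ev2 r t \<delta> ^ k" "ev2 [:0, 1:] t \<delta> = \<delta>"
  "ev2 1 t \<delta> = 1"
  by (simp_all add: ev2_def)

lemma ev2_sum [simp]: "ev2 (\<Sum>i\<in>A. r i) t \<delta> = (\<Sum>i\<in>A. ev2 (r i) t \<delta>)"
  by (induction A rule: infinite_finite_induct) auto

lemma isCont_ev2: "isCont (\<lambda>\<delta>. ev2 r t \<delta>) \<delta>"
proof (induction r)
  case 0
  then show ?case by simp
next
  case (pCons a r)
  have "ev2 (pCons a r) t = (\<lambda>\<delta>. poly a t + \<delta> * ev2 r t \<delta>)"
    by (auto simp: ev2_def)
  then show ?case using pCons by (auto intro!: continuous_intros)
qed

text \<open>Elimination without fractions: cross-multiplication with a pivot removes one equation and one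
  unknown.\<close>

lemma underdetermined_system_solvable:
  fixes c :: "'i \<Rightarrow> 'b \<Rightarrow> 'a::idom"
  assumes "finite B" "finite I" "card B < card I"
  shows "\<exists>r. (\<exists>i\<in>I. r i \<noteq> 0) \<and> (\<forall>b\<in>B. (\<Sum>i\<in>I. r i * c i b) = 0)"
  using assms
proof (induction B arbitrary: I c rule: finite_induct)
  case empty
  then obtain i where "i \<in> I" by (metis card_gt_0_iff ex_in_conv card.empty)
  then show ?case by (intro exI[of _ "\<lambda>_. 1"]) auto
next
  case (insert b B)
  show ?case
  proof (cases "\<exists>j\<in>I. c j b \<noteq> 0")
    case False
    have "card B < card I" using insert.hyps insert.prems(2) by simp
    from insert.IH[OF insert.prems(1) this, of c] obtain r where
      "\<exists>i\<in>I. r i \<noteq> 0" "\<forall>a\<in>B. (\<Sum>i\<in>I. r i * c i a) = 0" by (elim exE conjE)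
    then show ?thesis using False by (intro exI[of _ r]) simp
  next
    case True
    then obtain j where j: "j \<in> I" "c j b \<noteq> 0" by blast
    let ?I = "I - {j}"
    have "card B < card ?I" using insert.hyps insert.prems j by simp
    from insert.IH[OF _ this, of "\<lambda>i a. c j b * c i a - c i b * c j a"]
    obtain r where r: "\<exists>i\<in>?I. r i \<noteq> 0"
      and r0: "\<And>a. a \<in> B \<Longrightarrow> (\<Sum>i\<in>?I. r i * (c j b * c i a - c i b * c j a)) = 0"
      using insert.prems by auto
    define s where "s i = (if i = j then - (\<Sum>i\<in>?I. r i * c i b) else r i * c j b)" for i
    have sum_s: "(\<Sum>i\<in>I. s i * c i a) = (\<Sum>i\<in>?I. r i * (c j b * c i a - c i b * c j a))" for a
    proof -
      have "(\<Sum>i\<in>I. s i * c i a) = s j * c j a + (\<Sum>i\<in>?I. s i * c i a)"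
        using insert.prems j by (simp add: sum.remove)
      also have "(\<Sum>i\<in>?I. s i * c i a) = (\<Sum>i\<in>?I. r i * c j b * c i a)"
        by (intro sum.cong) (auto simp: s_def)
      also have "s j * c j a + (\<Sum>i\<in>?I. r i * c j b * c i a) =
          (\<Sum>i\<in>?I. r i * c j b * c i a) - (\<Sum>i\<in>?I. r i * c i b) * c j a"
        by (simp add: s_def)
      also have "\<dots> = (\<Sum>i\<in>?I. r i * (c j b * c i a - c i b * c j a))"
        by (simp only: right_diff_distrib sum_subtractf sum_distrib_right mult.assoc)
      finally show ?thesis .
    qed
    have "(\<Sum>i\<in>I. s i * c i a) = 0" if "a \<in> insert b B" for a
      using that r0 by (auto simp: sum_s algebra_simps)
    moreover have "\<exists>i\<in>I. s i \<noteq> 0" using r j(2) by (auto simp: s_def)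
    ultimately show ?thesis by blast
  qed
qed

definition zmon :: "nat \<Rightarrow> (nat \<Rightarrow> nat) \<Rightarrow> (nat \<Rightarrow> real) \<Rightarrow> real"
  where "zmon K \<beta> z = (\<Prod>i<K. z i ^ \<beta> i)"

text \<open>The exponents of the monomials that cannot be reduced by equations of the form
  \<open>\<delta> z\<^sub>i\<^bsup>q-1\<^esup> = \<close> (terms of lower degree).\<close>

definition expbox :: "nat \<Rightarrow> nat \<Rightarrow> (nat \<Rightarrow> nat) set"
  where "expbox K q = {\<beta>. (\<forall>i<K. \<beta> i < q - 1) \<and> (\<forall>i\<ge>K. \<beta> i = 0)}"

lemma finite_expbox: "finite (expbox K q)"
proof -
  have "expbox K q \<subseteq> {f. \<forall>x. (x \<in> {..<K} \<longrightarrow> f x \<in> {..<q - 1}) \<and> (x \<notin> {..<K} \<longrightarrow> f x = 0)}"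
    by (auto simp: expbox_def)
  then show ?thesis by (rule finite_subset) (intro finite_set_of_finite_funs, auto)
qed

lemma PF_zmon: "PF K (sum \<beta> {..<K}) (\<lambda>t z. zmon K \<beta> z)"
  unfolding zmon_def using PF_power[OF PF_coord] by (intro PF_prod) auto

text \<open>\<open>P' i\<close> stands for the partial derivatives of a family \<open>P\<close> of degree less than \<open>q\<close>.\<close>

context
  fixes K q :: nat and P' :: "nat \<Rightarrow> real \<Rightarrow> (nat \<Rightarrow> real) \<Rightarrow> real"
  assumes q: "q \<ge> 2" and P': "\<And>i. i < K \<Longrightarrow> PF K (q - 2) (P' i)"
begin

text \<open>The critical points of \<open>P + \<delta> \<Sum> z\<^sub>i\<^sup>q\<close>.\<close>

definition crit :: "real \<Rightarrow> real \<Rightarrow> (nat \<Rightarrow> real) \<Rightarrow> bool"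
  where "crit t \<delta> z \<longleftrightarrow> (\<forall>i<K. real q * \<delta> * z i ^ (q - 1) = - P' i t z)"

text \<open>On critical points, a power of \<open>\<delta>\<close> times \<open>w\<close> is a combination of the finitely many monomials in
  the box, with coefficients in \<open>\<real>[t][\<delta>]\<close> and without increase of the degree. Keeping the degree is
  what makes the induction below work.\<close>

definition red :: "nat \<Rightarrow> (real \<Rightarrow> real \<Rightarrow> (nat \<Rightarrow> real) \<Rightarrow> real) \<Rightarrow> bool"
  where "red e w \<longleftrightarrow> (\<exists>E c. (\<forall>\<beta>. e < sum \<beta> {..<K} \<longrightarrow> c \<beta> = 0) \<and>
    (\<forall>t \<delta> z. crit t \<delta> z \<longrightarrow> \<delta> ^ E * w t \<delta> z = (\<Sum>\<beta>\<in>expbox K q. ev2 (c \<beta>) t \<delta> * zmon K \<beta> z)))"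

lemma redI:
  assumes "\<And>\<beta>. e < sum \<beta> {..<K} \<Longrightarrow> c \<beta> = 0"
    and "\<And>t \<delta> z. crit t \<delta> z \<Longrightarrow> \<delta> ^ E * w t \<delta> z = (\<Sum>\<beta>\<in>expbox K q. ev2 (c \<beta>) t \<delta> * zmon K \<beta> z)"
  shows "red e w"
  unfolding red_def using assms by blast

lemma redE:
  assumes "red e w"
  obtains E c where "\<And>\<beta>. e < sum \<beta> {..<K} \<Longrightarrow> c \<beta> = 0"
    and "\<And>t \<delta> z. crit t \<delta> z \<Longrightarrow> \<delta> ^ E * w t \<delta> z = (\<Sum>\<beta>\<in>expbox K q. ev2 (c \<beta>) t \<delta> * zmon K \<beta> z)"
  using assms unfolding red_def by blast

lemma red_mono: "red e w \<Longrightarrow> e \<le> e' \<Longrightarrow> red e' w"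
  unfolding red_def by (meson order_le_less_trans)

lemma red_scale:
  assumes "red e w"
  shows "red e (\<lambda>t \<delta> z. ev2 b t \<delta> * w t \<delta> z)"
proof -
  from assms obtain E c where c: "\<And>\<beta>. e < sum \<beta> {..<K} \<Longrightarrow> c \<beta> = 0"
    "\<And>t \<delta> z. crit t \<delta> z \<Longrightarrow> \<delta> ^ E * w t \<delta> z = (\<Sum>\<beta>\<in>expbox K q. ev2 (c \<beta>) t \<delta> * zmon K \<beta> z)"
    by (rule redE) blast
  show ?thesis
  proof (rule redI[where E = E and c = "\<lambda>\<beta>. b * c \<beta>"])
    fix t \<delta> z assume cr: "crit t \<delta> z"
    have "\<delta> ^ E * (ev2 b t \<delta> * w t \<delta> z) = ev2 b t \<delta> * (\<delta> ^ E * w t \<delta> z)" by simp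
    also have "\<dots> = (\<Sum>\<beta>\<in>expbox K q. ev2 (b * c \<beta>) t \<delta> * zmon K \<beta> z)"
      unfolding c(2)[OF cr] by (simp add: sum_distrib_left mult.assoc)
    finally show "\<delta> ^ E * (ev2 b t \<delta> * w t \<delta> z) = (\<Sum>\<beta>\<in>expbox K q. ev2 (b * c \<beta>) t \<delta> * zmon K \<beta> z)" .
  qed (use c(1) in simp)
qed

lemma red_add:
  assumes "red e w" "red e w'"
  shows "red e (\<lambda>t \<delta> z. w t \<delta> z + w' t \<delta> z)"
proof -
  from assms(1) obtain E c where c: "\<And>\<beta>. e < sum \<beta> {..<K} \<Longrightarrow> c \<beta> = 0"
    "\<And>t \<delta> z. crit t \<delta> z \<Longrightarrow> \<delta> ^ E * w t \<delta> z = (\<Sum>\<beta>\<in>expbox K q. ev2 (c \<beta>) t \<delta> * zmon K \<beta> z)"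
    by (rule redE) blast
  from assms(2) obtain E' c' where c': "\<And>\<beta>. e < sum \<beta> {..<K} \<Longrightarrow> c' \<beta> = 0"
    "\<And>t \<delta> z. crit t \<delta> z \<Longrightarrow> \<delta> ^ E' * w' t \<delta> z = (\<Sum>\<beta>\<in>expbox K q. ev2 (c' \<beta>) t \<delta> * zmon K \<beta> z)"
    by (rule redE) blast
  let ?c = "\<lambda>\<beta>. [:0, 1:] ^ E' * c \<beta> + [:0, 1:] ^ E * c' \<beta>"
  show ?thesis
  proof (rule redI[where E = "E + E'" and c = ?c])
    fix t \<delta> z assume cr: "crit t \<delta> z"
    have "\<delta> ^ (E + E') * (w t \<delta> z + w' t \<delta> z) = \<delta> ^ E' * (\<delta> ^ E * w t \<delta> z) + \<delta> ^ E * (\<delta> ^ E' * w' t \<delta> z)"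
      by (simp add: power_add algebra_simps)
    also have "\<dots> = (\<Sum>\<beta>\<in>expbox K q. ev2 (?c \<beta>) t \<delta> * zmon K \<beta> z)"
      unfolding c(2)[OF cr] c'(2)[OF cr] by (simp add: sum_distrib_left sum.distrib algebra_simps)
    finally show "\<delta> ^ (E + E') * (w t \<delta> z + w' t \<delta> z) = (\<Sum>\<beta>\<in>expbox K q. ev2 (?c \<beta>) t \<delta> * zmon K \<beta> z)" .
  qed (use c(1) c'(1) in simp)
qed

lemma red_0: "red e (\<lambda>t \<delta> z. 0)"
  by (rule redI[where E = 0 and c = "\<lambda>_. 0"]) auto

lemma red_sum: "(\<And>i. i \<in> A \<Longrightarrow> red e (w i)) \<Longrightarrow> red e (\<lambda>t \<delta> z. \<Sum>i\<in>A. w i t \<delta> z)"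
  by (induction A rule: infinite_finite_induct) (auto intro: red_add red_0)

lemma red_divide:
  assumes "red e w'" and "\<And>t \<delta> z. crit t \<delta> z \<Longrightarrow> \<delta> ^ m * w t \<delta> z = w' t \<delta> z"
  shows "red e w"
proof -
  from assms(1) obtain E c where c: "\<And>\<beta>. e < sum \<beta> {..<K} \<Longrightarrow> c \<beta> = 0"
    "\<And>t \<delta> z. crit t \<delta> z \<Longrightarrow> \<delta> ^ E * w' t \<delta> z = (\<Sum>\<beta>\<in>expbox K q. ev2 (c \<beta>) t \<delta> * zmon K \<beta> z)"
    by (rule redE) blast
  show ?thesis
    by (rule redI[where E = "E + m" and c = c]) (use assms(2) c in \<open>simp_all add: power_add mult.assoc\<close>)
qed

lemma red_box:
  assumes "\<beta> \<in> expbox K q" "sum \<beta> {..<K} \<le> e"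
  shows "red e (\<lambda>t \<delta> z. zmon K \<beta> z)"
proof (rule redI[where E = 0 and c = "\<lambda>\<gamma>. if \<gamma> = \<beta> then 1 else 0"])
  fix t \<delta> z
  have "(\<Sum>\<gamma>\<in>expbox K q. ev2 (if \<gamma> = \<beta> then 1 else 0) t \<delta> * zmon K \<gamma> z)
      = (\<Sum>\<gamma>\<in>expbox K q. if \<gamma> = \<beta> then zmon K \<gamma> z else 0)"
    by (intro sum.cong) auto
  then show "\<delta> ^ 0 * zmon K \<beta> z = (\<Sum>\<gamma>\<in>expbox K q. ev2 (if \<gamma> = \<beta> then 1 else 0) t \<delta> * zmon K \<gamma> z)"
    using assms(1) by (simp add: finite_expbox)
qed (use assms(2) in auto)

lemma zmon_upd: "i < K \<Longrightarrow> zmon K \<beta> z = z i ^ \<beta> i * zmon K (\<beta>(i := 0)) z"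
  unfolding zmon_def by (subst (1 2) prod.remove[of _ i]) auto

lemma sum_upd: "i < K \<Longrightarrow> sum \<beta> {..<K} = \<beta> i + sum (\<beta>(i := 0 :: nat)) {..<K}"
  by (subst (1 2) sum.remove[of _ i]) auto

text \<open>Induction on the degree. Multiplying a monomial of the box by \<open>z\<^sub>i\<close> either stays in the box or
  produces \<open>z\<^sub>i\<^bsup>q-1\<^esup>\<close>, which the critical equation trades, at the cost of a factor \<open>\<delta>\<close>, for terms of
  smaller degree.\<close>

lemma PF_imp_red: "PF K d p \<Longrightarrow> red d (\<lambda>t \<delta> z. p t z)"
proof -
  have "PF K d p \<Longrightarrow> d \<le> n \<Longrightarrow> red d (\<lambda>t \<delta> z. p t z)" for n d p
  proof (induction n arbitrary: d p)
    case 0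
    have "PF K d p \<Longrightarrow> d = 0 \<Longrightarrow> red 0 (\<lambda>t \<delta> z. p t z)" for d p
    proof (induction rule: PF.induct)
      case (PF_const d c)
      have "red 0 (\<lambda>t \<delta> z. ev2 [:c:] t \<delta> * zmon K (\<lambda>_. 0) z)"
        by (intro red_scale red_box) (use q in \<open>auto simp: expbox_def\<close>)
      then show ?case by (simp add: zmon_def)
    qed (auto intro: red_add)
    then show ?case using 0 by blast
  next
    case (Suc n)
    show ?case using Suc.prems
    proof (induction rule: PF.induct)
      case (PF_const d c)
      have "red d (\<lambda>t \<delta> z. ev2 [:c:] t \<delta> * zmon K (\<lambda>_. 0) z)"
        by (intro red_scale red_box) (use q in \<open>auto simp: expbox_def\<close>)
      then show ?case by (simp add: zmon_def)
    next
      case (PF_add d p p')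
      then show ?case by (auto intro: red_add)
    next
      case (PF_var d p i)
      have mon: "red (Suc d) (\<lambda>t \<delta> z. z i * zmon K \<beta> z)" if \<beta>: "\<beta> \<in> expbox K q" "sum \<beta> {..<K} \<le> d" for \<beta>
      proof (cases "Suc (\<beta> i) < q - 1")
        case True
        have "z i * zmon K \<beta> z = zmon K (\<beta>(i := Suc (\<beta> i))) z" for z
          using zmon_upd[OF \<open>i < K\<close>, of \<beta> z] zmon_upd[OF \<open>i < K\<close>, of "\<beta>(i := Suc (\<beta> i))" z] by simp
        moreover have "\<beta>(i := Suc (\<beta> i)) \<in> expbox K q"
          using \<beta> True \<open>i < K\<close> by (auto simp: expbox_def)
        moreover have "sum (\<beta>(i := Suc (\<beta> i))) {..<K} \<le> Suc d"
          using \<beta>(2) sum_upd[OF \<open>i < K\<close>, of \<beta>] sum_upd[OF \<open>i < K\<close>, of "\<beta>(i := Suc (\<beta> i))"] by simp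
        ultimately show ?thesis using red_box by simp
      next
        case False
        moreover have "\<beta> i < q - 1" using \<beta> \<open>i < K\<close> by (auto simp: expbox_def)
        ultimately have bi: "\<beta> i = q - 2" "Suc (\<beta> i) = q - 1" using q by auto
        let ?\<gamma> = "\<beta>(i := 0)"
        let ?d = "(q - 2) + sum ?\<gamma> {..<K}"
        have "PF K ?d (\<lambda>t z. P' i t z * zmon K ?\<gamma> z)"
          by (intro PF_mult P' PF_zmon \<open>i < K\<close>)
        moreover have "?d \<le> d" using \<beta>(2) sum_upd[OF \<open>i < K\<close>, of \<beta>] bi by simp
        ultimately have "red ?d (\<lambda>t \<delta> z. P' i t z * zmon K ?\<gamma> z)"
          using PF_var.prems Suc.IH by auto
        then have "red (Suc d) (\<lambda>t \<delta> z. P' i t z * zmon K ?\<gamma> z)"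
          by (rule red_mono) (use \<open>?d \<le> d\<close> in simp)
        from red_scale[OF this, of "[:[:- 1 / real q:]:]"]
        show ?thesis
        proof (rule red_divide[where m = 1])
          fix t \<delta> z assume "crit t \<delta> z"
          then have "real q * \<delta> * z i ^ (q - 1) = - P' i t z" using \<open>i < K\<close> by (auto simp: crit_def)
          then have "\<delta> * z i ^ (q - 1) = - 1 / real q * P' i t z" using q by (simp add: field_simps)
          moreover have "z i * zmon K \<beta> z = z i ^ (q - 1) * zmon K ?\<gamma> z"
            using zmon_upd[OF \<open>i < K\<close>, of \<beta> z] bi by (metis mult.assoc power_Suc)
          ultimately have "\<delta> * (z i * zmon K \<beta> z) = (- 1 / real q * P' i t z) * zmon K ?\<gamma> z"
            by (metis mult.assoc)
          then show "\<delta> ^ 1 * (z i * zmon K \<beta> z) =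
              ev2 [:[:- 1 / real q:]:] t \<delta> * (P' i t z * zmon K ?\<gamma> z)"
            by simp
        qed
      qed
      from PF_var have "red d (\<lambda>t \<delta> z. p t z)" by simp
      then obtain E c where c: "\<And>\<beta>. d < sum \<beta> {..<K} \<Longrightarrow> c \<beta> = 0"
        "\<And>t \<delta> z. crit t \<delta> z \<Longrightarrow> \<delta> ^ E * p t z = (\<Sum>\<beta>\<in>expbox K q. ev2 (c \<beta>) t \<delta> * zmon K \<beta> z)"
        by (rule redE) blast
      have "red (Suc d) (\<lambda>t \<delta> z. \<Sum>\<beta>\<in>expbox K q. ev2 (c \<beta>) t \<delta> * (z i * zmon K \<beta> z))"
      proof (rule red_sum)
        fix \<beta> assume "\<beta> \<in> expbox K q"
        then show "red (Suc d) (\<lambda>t \<delta> z. ev2 (c \<beta>) t \<delta> * (z i * zmon K \<beta> z))"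
        proof (cases "d < sum \<beta> {..<K}")
          case True
          then show ?thesis using c(1)[of \<beta>] by (simp add: red_0)
        next
          case False
          with mon[OF \<open>\<beta> \<in> expbox K q\<close>] show ?thesis by (intro red_scale) simp
        qed
      qed
      then show ?case
      proof (rule red_divide[where m = E])
        fix t \<delta> z assume "crit t \<delta> z"
        from c(2)[OF this] have "z i * (\<delta> ^ E * p t z) = (\<Sum>\<beta>\<in>expbox K q. z i * (ev2 (c \<beta>) t \<delta> * zmon K \<beta> z))"
          by (simp add: sum_distrib_left)
        then show "\<delta> ^ E * (z i * p t z) = (\<Sum>\<beta>\<in>expbox K q. ev2 (c \<beta>) t \<delta> * (z i * zmon K \<beta> z))"
          by (simp add: mult.left_commute)
      qed
    qed
  qed
  then show "PF K d p \<Longrightarrow> red d (\<lambda>t \<delta> z. p t z)" by blast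
qed

text \<open>With \<open>N\<close> monomials in the box, the \<open>N + 1\<close> powers \<open>1, W, \<dots>, W\<^sup>N\<close> reduce to linearly dependent
  vectors.\<close>

lemma critical_values_algebraic:
  assumes "PF K d W"
  shows "\<exists>r (N :: nat). (\<exists>i\<le>N. r i \<noteq> 0) \<and>
    (\<forall>t \<delta> z. crit t \<delta> z \<longrightarrow> (\<Sum>i\<le>N. ev2 (r i) t \<delta> * W t z ^ i) = 0)"
proof -
  have "\<exists>E c. \<forall>t \<delta> z. crit t \<delta> z \<longrightarrow>
      \<delta> ^ E * W t z ^ i = (\<Sum>\<beta>\<in>expbox K q. ev2 (c \<beta>) t \<delta> * zmon K \<beta> z)" for i
    using PF_imp_red[OF PF_power[OF assms, of i]] unfolding red_def by blast
  then obtain E c where c: "\<And>i t \<delta> z. crit t \<delta> z \<Longrightarrow>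
      \<delta> ^ E i * W t z ^ i = (\<Sum>\<beta>\<in>expbox K q. ev2 (c i \<beta>) t \<delta> * zmon K \<beta> z)"
    by metis
  define N where "N = card (expbox K q)"
  obtain r where r: "\<exists>i\<in>{..N}. r i \<noteq> 0" "\<And>\<beta>. \<beta> \<in> expbox K q \<Longrightarrow> (\<Sum>i\<le>N. r i * c i \<beta>) = 0"
    using underdetermined_system_solvable[of "expbox K q" "{..N}" c] finite_expbox by (auto simp: N_def)
  have "(\<Sum>i\<le>N. ev2 (r i * [:0, 1:] ^ E i) t \<delta> * W t z ^ i) = 0" if cr: "crit t \<delta> z" for t \<delta> z
  proof -
    have "(\<Sum>i\<le>N. ev2 (r i * [:0, 1:] ^ E i) t \<delta> * W t z ^ i)
        = (\<Sum>i\<le>N. ev2 (r i) t \<delta> * (\<Sum>\<beta>\<in>expbox K q. ev2 (c i \<beta>) t \<delta> * zmon K \<beta> z))"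
      by (simp add: c[OF cr, symmetric] mult.assoc)
    also have "\<dots> = (\<Sum>\<beta>\<in>expbox K q. ev2 (\<Sum>i\<le>N. r i * c i \<beta>) t \<delta> * zmon K \<beta> z)"
      unfolding sum_distrib_left ev2_sum sum_distrib_right
      by (subst sum.swap) (simp add: mult.assoc)
    also have "\<dots> = 0" using r(2) by simp
    finally show ?thesis .
  qed
  moreover have "\<exists>i\<le>N. r i * [:0, 1:] ^ E i \<noteq> 0" using r(1) by auto
  ultimately show ?thesis by (intro exI[of _ "\<lambda>i. r i * [:0, 1:] ^ E i"] exI[of _ N]) blast
qed

end

text \<open>Dividing by the common power of \<open>\<delta>\<close> keeps the relation nontrivial in the limit \<open>\<delta> \<rightarrow> 0\<close>.\<close>

lemma common_delta_power:
  fixes r :: "nat \<Rightarrow> real poly poly"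
  assumes "\<exists>i\<le>N. r i \<noteq> 0"
  shows "\<exists>e s. (\<forall>i\<le>N. r i = [:0, 1:] ^ e * s i) \<and> (\<exists>i\<le>N. poly (s i) 0 \<noteq> 0)"
proof -
  define A where "A = {i. i \<le> N \<and> r i \<noteq> 0}"
  have A: "finite A" "A \<noteq> {}" using assms by (auto simp: A_def)
  define e where "e = Min ((\<lambda>i. order 0 (r i)) ` A)"
  have "\<exists>s. r i = [:0, 1:] ^ e * s" if "i \<le> N" for i
  proof (cases "i \<in> A")
    case True
    then have "e \<le> order 0 (r i)" unfolding e_def using A by auto
    moreover have "[:- 0, 1:] ^ order 0 (r i) dvd r i" by (rule order_1)
    ultimately have "[:0, 1:] ^ e dvd r i"
      by (metis dvd_trans le_imp_power_dvd minus_zero)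
    then show ?thesis by (auto elim: dvdE)
  qed (use that in \<open>auto simp: A_def\<close>)
  then obtain s where s: "\<And>i. i \<le> N \<Longrightarrow> r i = [:0, 1:] ^ e * s i" by metis
  have "e \<in> (\<lambda>i. order 0 (r i)) ` A"
    unfolding e_def using A by (intro Min_in) auto
  then obtain i where i: "i \<in> A" "order 0 (r i) = e" by auto
  have iN: "i \<le> N" "r i \<noteq> 0" using i(1) by (auto simp: A_def)
  have "poly (s i) 0 \<noteq> 0"
  proof
    assume "poly (s i) 0 = 0"
    then have "[:0, 1:] dvd s i" by (simp add: poly_eq_0_iff_dvd)
    then have "[:0, 1:] ^ Suc e dvd r i"
      unfolding s[OF iN(1)] by (metis mult_dvd_mono dvd_refl power_Suc2)
    then have "[:- 0, 1:] ^ Suc (order 0 (r i)) dvd r i" using i(2) by simp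
    then show False using order_2[OF iN(2), of 0] by blast
  qed
  then show ?thesis using s iN(1) by (intro exI[of _ e] exI[of _ s]) auto
qed

text \<open>The perturbation makes the family coercive.\<close>

lemma perturbed_minimum_exists:
  assumes P: "PF K d P" "\<And>z. P t z \<ge> 0" and \<delta>: "\<delta> > (0::real)" and q: "even q" "q \<noteq> 0"
  shows "\<exists>z. \<forall>y. P t z + \<delta> * (\<Sum>i<K. z i ^ q) \<le> P t y + \<delta> * (\<Sum>i<K. y i ^ q)"
proof -
  define F where "F z = P t z + \<delta> * (\<Sum>i<K. z i ^ q)" for z
  define R where "R = max 1 (F (\<lambda>_. 0) / \<delta>)"
  define S where "S = (\<Pi>\<^sub>E i\<in>UNIV. if i < K then {-R..R} else {0::real})"
  have zero: "(\<lambda>_. 0) \<in> S" by (auto simp: S_def R_def)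
  have "compactin (product_topology (\<lambda>i. euclidean) (UNIV :: nat set)) S"
    unfolding S_def by (subst compactin_PiE) auto
  then have "compact S"
    by (simp add: euclidean_product_topology)
  moreover have "continuous_on S F"
    unfolding F_def
    by (intro continuous_intros PF_continuous[OF P(1)]
        continuous_on_subset[OF continuous_on_product_coordinates]) auto
  ultimately obtain z where z: "z \<in> S" "\<And>y. y \<in> S \<Longrightarrow> F z \<le> F y"
    using continuous_attains_inf[of S F] zero by blast
  have "F z \<le> F y" for y
  proof (cases "\<forall>i<K. \<bar>y i\<bar> \<le> R")
    case True
    define y' where "y' i = (if i < K then y i else 0)" for i
    have "F y' = F y"
      unfolding F_def using PF_cong[OF P(1), of y' y] by (simp add: y'_def)
    moreover have "y' \<in> S" using True by (auto simp: S_def y'_def abs_le_iff)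
    ultimately show ?thesis using z(2) by metis
  next
    case False
    then obtain i where i: "i < K" "\<bar>y i\<bar> > R" by auto
    have "F (\<lambda>_. 0) / \<delta> \<le> R" by (simp add: R_def)
    also have "R \<le> R ^ q" using power_increasing[of 1 q R] q by (auto simp: R_def)
    also have "\<dots> \<le> \<bar>y i\<bar> ^ q" using i(2) by (intro power_mono) (auto simp: R_def)
    also have "\<dots> = y i ^ q" using q by (simp add: power_even_abs)
    also have "\<dots> \<le> (\<Sum>i<K. y i ^ q)"
      using i(1) q by (intro member_le_sum) (auto simp: zero_le_even_power)
    finally have "F (\<lambda>_. 0) \<le> \<delta> * (\<Sum>i<K. y i ^ q)" using \<delta> by (simp add: field_simps)
    also have "\<dots> \<le> F y" using P(2)[of y] by (simp add: F_def)
    finally show ?thesis using z(2)[OF zero] by linarith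
  qed
  then show ?thesis unfolding F_def by blast
qed

text \<open>An elementary elimination. The minimum of \<open>P + \<delta> \<Sum> z\<^sub>i\<^sup>q\<close> is attained at a critical point; there, by
  the critical equations, it equals the value of \<open>W = P - (1/q) \<Sum> z\<^sub>i \<partial>\<^sub>i P\<close>, which does not involve \<open>\<delta>\<close>.
  So it satisfies an algebraic equation over \<open>\<real>[t][\<delta>]\<close>. As \<open>\<delta> \<rightarrow> 0\<close> the minimum tends to the infimum
  of \<open>P\<close>, even if that is not attained.\<close>

theorem infimum_algebraic:
  assumes P: "PF K d P" "\<And>t z. P t z \<ge> 0"
  shows "\<exists>\<rho> (N :: nat). (\<exists>i\<le>N. \<rho> i \<noteq> (0 :: real poly)) \<and>
    (\<forall>t. (\<Sum>i\<le>N. poly (\<rho> i) t * (INF z. P t z) ^ i) = 0)"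
proof -
  \<comment> \<open>Even, for coercivity, and larger than the degree of \<open>P\<close>.\<close>
  define q where "q = 2 * d + 2"
  have q: "even q" "q \<noteq> 0" "q \<ge> 2" by (auto simp: q_def)
  have "\<exists>p'. (\<forall>t z. ((\<lambda>s. P t (z(i := s))) has_field_derivative p' t z) (at (z i))) \<and> PF K (q - 2) p'" for i
  proof -
    obtain p' where p': "\<forall>t z. ((\<lambda>s. P t (z(i := s))) has_field_derivative p' t z) (at (z i))"
      "p' = (\<lambda>t z. 0) \<or> (\<exists>e. d = Suc e \<and> PF K e p')"
      using PF_derivative[OF P(1), of i] by (elim exE conjE)
    have "PF K (q - 2) p'" using p'(2)
    proof (elim disjE exE conjE)
      fix e assume "d = Suc e" "PF K e p'"
      then show ?thesis by (elim PF_mono) (simp add: q_def)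
    qed (simp add: PF_real)
    with p'(1) show ?thesis by blast
  qed
  then obtain P' where deriv: "\<And>i t z. ((\<lambda>s. P t (z(i := s))) has_field_derivative P' i t z) (at (z i))"
    and P': "\<And>i. PF K (q - 2) (P' i)" by metis
  define W where "W t z = P t z + (- 1 / real q) * (\<Sum>i<K. z i * P' i t z)" for t z
  have "PF K q W"
  proof -
    have "PF K (q - 1) (\<lambda>t z. z i * P' i t z)" if "i < K" for i
    proof -
      have "Suc (q - 2) = q - 1" using q(3) by simp
      with PF_var[OF P'[of i] that] show ?thesis by simp
    qed
    then have "PF K (q - 1) (\<lambda>t z. \<Sum>i<K. z i * P' i t z)" by (intro PF_sum) auto
    then have "PF K q (\<lambda>t z. (- 1 / real q) * (\<Sum>i<K. z i * P' i t z))"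
      using PF_mult[OF PF_real[of K 1 "- 1 / real q"], of "q - 1"] q(3) by simp
    moreover have "PF K q P" by (rule PF_mono[OF P(1)]) (simp add: q_def)
    ultimately show ?thesis unfolding W_def by (intro PF_add)
  qed
  from critical_values_algebraic[OF q(3), of K P' q W, OF P' this]
  obtain r N where r: "\<exists>i\<le>(N::nat). r i \<noteq> 0"
    and r0: "\<And>t \<delta> z. crit K q P' t \<delta> z \<Longrightarrow> (\<Sum>i\<le>N. ev2 (r i) t \<delta> * W t z ^ i) = 0"
    by blast
  obtain e s where s: "\<And>i. i \<le> N \<Longrightarrow> r i = [:0, 1:] ^ e * s i" and s0: "\<exists>i\<le>N. poly (s i) 0 \<noteq> 0"
    using common_delta_power[OF r] by blast
  have "(\<Sum>i\<le>N. poly (poly (s i) 0) t * (INF z. P t z) ^ i) = 0" for t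
  proof -
    define v where "v = (INF z. P t z)"
    have bdd: "bdd_below (range (P t))" using P(2) by (intro bdd_belowI[of _ 0]) auto
    have "\<exists>z. \<forall>y. P t z + \<delta> * (\<Sum>i<K. z i ^ q) \<le> P t y + \<delta> * (\<Sum>i<K. y i ^ q)" if "\<delta> > 0" for \<delta>
      using perturbed_minimum_exists[OF P(1) _ that q(1,2)] P(2) by blast
    then obtain Z where Z: "\<And>\<delta> y. \<delta> > 0 \<Longrightarrow>
        P t (Z \<delta>) + \<delta> * (\<Sum>i<K. Z \<delta> i ^ q) \<le> P t y + \<delta> * (\<Sum>i<K. y i ^ q)" by metis
    define V where "V \<delta> = P t (Z \<delta>) + \<delta> * (\<Sum>i<K. Z \<delta> i ^ q)" for \<delta>
    have rel: "(\<Sum>i\<le>N. ev2 (s i) t \<delta> * V \<delta> ^ i) = 0" if \<delta>: "\<delta> > 0" for \<delta>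
    proof -
      have cr: "real q * \<delta> * Z \<delta> i ^ (q - 1) = - P' i t (Z \<delta>)" if i: "i < K" for i
      proof -
        let ?G = "\<lambda>y. P t ((Z \<delta>)(i := y)) + \<delta> * (\<Sum>j<K. ((Z \<delta>)(i := y)) j ^ q)"
        have "((\<lambda>y. ((Z \<delta>)(i := y)) j ^ q) has_field_derivative
            (if j = i then real q * Z \<delta> i ^ (q - 1) else 0)) (at (Z \<delta> i))" for j
          by (auto intro!: derivative_eq_intros)
        then have "((\<lambda>y. \<Sum>j<K. ((Z \<delta>)(i := y)) j ^ q) has_field_derivative
            (\<Sum>j<K. if j = i then real q * Z \<delta> i ^ (q - 1) else 0)) (at (Z \<delta> i))"
          by (intro DERIV_sum)
        then have "((\<lambda>y. \<Sum>j<K. ((Z \<delta>)(i := y)) j ^ q) has_field_derivative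
            real q * Z \<delta> i ^ (q - 1)) (at (Z \<delta> i))"
          using i by simp
        from DERIV_add[OF deriv[of t "Z \<delta>" i] DERIV_cmult[OF this, of \<delta>]]
        have "(?G has_field_derivative (P' i t (Z \<delta>) + \<delta> * (real q * Z \<delta> i ^ (q - 1)))) (at (Z \<delta> i))" .
        moreover have "?G (Z \<delta> i) \<le> ?G y" for y
          using Z[OF \<delta>, of "(Z \<delta>)(i := y)"] by (simp only: fun_upd_triv)
        ultimately have "P' i t (Z \<delta>) + \<delta> * (real q * Z \<delta> i ^ (q - 1)) = 0"
          using DERIV_local_min[of ?G _ "Z \<delta> i" 1] by auto
        then show ?thesis by (simp add: algebra_simps)
      qed
      then have "crit K q P' t \<delta> (Z \<delta>)" by (simp add: crit_def[OF q(3) P'])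
      from r0[OF this] have "(\<Sum>i\<le>N. \<delta> ^ e * (ev2 (s i) t \<delta> * W t (Z \<delta>) ^ i)) = 0"
        by (simp add: s mult.assoc)
      then have "(\<Sum>i\<le>N. ev2 (s i) t \<delta> * W t (Z \<delta>) ^ i) = 0"
        using \<delta> by (simp add: sum_distrib_left[symmetric])
      moreover have "W t (Z \<delta>) = V \<delta>"
      proof -
        have "Z \<delta> i * P' i t (Z \<delta>) = - real q * (\<delta> * Z \<delta> i ^ q)" if "i < K" for i
        proof -
          have "Z \<delta> i * P' i t (Z \<delta>) = - real q * (\<delta> * (Z \<delta> i * Z \<delta> i ^ (q - 1)))"
          proof -
            have "P' i t (Z \<delta>) = - (real q * \<delta> * Z \<delta> i ^ (q - 1))" using cr[OF that] by linarith
            then show ?thesis by simp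
          qed
          also have "Z \<delta> i * Z \<delta> i ^ (q - 1) = Z \<delta> i ^ q"
            using q by (simp add: power_eq_if)
          finally show ?thesis .
        qed
        then have "(\<Sum>i<K. Z \<delta> i * P' i t (Z \<delta>)) = - real q * (\<delta> * (\<Sum>i<K. Z \<delta> i ^ q))"
          by (simp add: sum_distrib_left)
        then show ?thesis using q(2) by (simp add: W_def V_def)
      qed
      ultimately show ?thesis by simp
    qed
    have pow_nn: "(\<Sum>i<K. y i ^ q) \<ge> 0" for y :: "nat \<Rightarrow> real"
      using q by (intro sum_nonneg) (auto simp: zero_le_even_power)
    have "(V \<longlongrightarrow> v) (at_right 0)"
    proof (rule order_tendstoI)
      fix a assume "a < v"
      have low: "v \<le> V \<delta>" if "\<delta> > 0" for \<delta>
        using cINF_lower[OF bdd, of "Z \<delta>"] pow_nn[of "Z \<delta>"] that by (simp add: v_def V_def add_increasing2)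
      show "\<forall>\<^sub>F \<delta> in at_right 0. a < V \<delta>"
        using eventually_at_right_less[of 0]
      proof eventually_elim
        case (elim \<delta>)
        then show ?case using low[of \<delta>] \<open>a < v\<close> by linarith
      qed
    next
      fix a assume "v < a"
      then obtain y where "P t y < a"
        using bdd unfolding v_def by (auto simp: cINF_less_iff)
      have "((\<lambda>\<delta>. P t y + \<delta> * (\<Sum>i<K. y i ^ q)) \<longlongrightarrow> P t y + 0 * (\<Sum>i<K. y i ^ q)) (at_right 0)"
        by (intro tendsto_intros)
      then have "\<forall>\<^sub>F \<delta> in at_right 0. P t y + \<delta> * (\<Sum>i<K. y i ^ q) < a"
        using \<open>P t y < a\<close> by (intro order_tendstoD) auto
      moreover have "\<forall>\<^sub>F \<delta> in at_right (0::real). \<delta> > 0" by (rule eventually_at_right_less)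
      ultimately show "\<forall>\<^sub>F \<delta> in at_right 0. V \<delta> < a"
      proof eventually_elim
        case (elim \<delta>)
        then show ?case using Z[of \<delta> y] unfolding V_def by linarith
      qed
    qed
    moreover have "((\<lambda>\<delta>. ev2 (s i) t \<delta>) \<longlongrightarrow> ev2 (s i) t 0) (at_right 0)" for i
      using isCont_ev2[where r = "s i" and t = t and \<delta> = 0] by (auto simp: isCont_def intro: tendsto_within_subset)
    ultimately have "((\<lambda>\<delta>. \<Sum>i\<le>N. ev2 (s i) t \<delta> * V \<delta> ^ i) \<longlongrightarrow> (\<Sum>i\<le>N. ev2 (s i) t 0 * v ^ i)) (at_right 0)"
      by (intro tendsto_intros)
    moreover have "\<forall>\<^sub>F \<delta> in at_right 0. (\<Sum>i\<le>N. ev2 (s i) t \<delta> * V \<delta> ^ i) = 0"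
      using eventually_at_right_less[of 0] by eventually_elim (simp add: rel)
    ultimately have "((\<lambda>\<delta>::real. 0) \<longlongrightarrow> (\<Sum>i\<le>N. ev2 (s i) t 0 * v ^ i)) (at_right 0)"
      by (rule Lim_transform_eventually)
    from tendsto_unique[OF trivial_limit_at_right_real this tendsto_const]
    have "(\<Sum>i\<le>N. ev2 (s i) t 0 * v ^ i) = 0" .
    then show ?thesis by (simp add: v_def ev2_def)
  qed
  with s0 show ?thesis by (intro exI[of _ "\<lambda>i. poly (s i) 0"] exI[of _ N]) blast
qed

text \<open>Near \<open>0\<close> a polynomial behaves like its lowest term.\<close>

lemma nonzero_poly_lower_bound:
  fixes p :: "real poly"
  assumes "p \<noteq> 0"
  shows "\<exists>c>0. \<exists>a t0. 0 < t0 \<and> t0 \<le> 1 \<and> (\<forall>t. 0 < t \<and> t \<le> t0 \<longrightarrow> \<bar>poly p t\<bar> \<ge> c * t ^ a)"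
proof -
  obtain s where s: "p = [:- 0, 1:] ^ order 0 p * s" "\<not> [:- 0, 1:] dvd s"
    using order_decomp[OF assms, of 0] by blast
  have "poly s 0 \<noteq> 0" using s(2) by (simp add: poly_eq_0_iff_dvd)
  then have "(\<bar>poly s 0\<bar> / 2) < \<bar>poly s 0\<bar>" by simp
  moreover have "((\<lambda>t. \<bar>poly s t\<bar>) \<longlongrightarrow> \<bar>poly s 0\<bar>) (at_right 0)"
    by (intro tendsto_intros)
  ultimately have "\<forall>\<^sub>F t in at_right 0. \<bar>poly s 0\<bar> / 2 < \<bar>poly s t\<bar>"
    by (rule order_tendstoD(1)[rotated])
  then obtain b where b: "b > 0" "\<And>t. 0 < t \<Longrightarrow> t < b \<Longrightarrow> \<bar>poly s 0\<bar> / 2 < \<bar>poly s t\<bar>"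
    by (auto simp: eventually_at_right_field)
  have "\<bar>poly p t\<bar> \<ge> (\<bar>poly s 0\<bar> / 2) * t ^ order 0 p" if "0 < t" "t \<le> min 1 (b / 2)" for t
  proof -
    have "\<bar>poly p t\<bar> = t ^ order 0 p * \<bar>poly s t\<bar>"
      by (subst s(1)) (use that in \<open>simp add: abs_mult power_abs\<close>)
    moreover have "\<bar>poly s 0\<bar> / 2 < \<bar>poly s t\<bar>" using b that by (intro b(2)) auto
    ultimately show ?thesis using that by (simp add: mult.commute mult_right_mono)
  qed
  then show ?thesis
    using \<open>poly s 0 \<noteq> 0\<close> b(1) by (intro exI[of _ "\<bar>poly s 0\<bar> / 2"] conjI exI[of _ "order 0 p"] exI[of _ "min 1 (b / 2)"]) auto
qed

text \<open>In the algebraic equation for the infimum \<open>v\<close>, the lowest coefficient that is not the zero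
  polynomial is a multiple of \<open>v\<close> by a bounded quantity, and it is at least a power of \<open>t\<close>.\<close>

theorem infimum_lower_bound:
  assumes P: "PF K d P" "\<And>t z. P t z \<ge> 0"
    and pos: "\<And>t. 0 < t \<Longrightarrow> t \<le> 1 \<Longrightarrow> (INF z. P t z) > 0"
  shows "\<exists>c>0. \<exists>a t0. 0 < t0 \<and> t0 \<le> 1 \<and> (\<forall>t z. 0 < t \<and> t \<le> t0 \<longrightarrow> P t z \<ge> c * t ^ a)"
proof -
  define v where "v t = (INF z. P t z)" for t
  obtain \<rho> :: "nat \<Rightarrow> real poly" and N :: nat where \<rho>: "\<exists>i\<le>N. \<rho> i \<noteq> 0"
    and rel: "\<And>t. (\<Sum>i\<le>N. poly (\<rho> i) t * v t ^ i) = 0"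
    using infimum_algebraic[OF P] unfolding v_def by blast
  define j where "j = (LEAST i. i \<le> N \<and> \<rho> i \<noteq> 0)"
  have j: "j \<le> N" "\<rho> j \<noteq> 0" using LeastI_ex[OF \<rho>[unfolded Bex_def]] unfolding j_def by auto
  have below: "\<rho> i = 0" if "i < j" for i
    using not_less_Least[of i "\<lambda>i. i \<le> N \<and> \<rho> i \<noteq> 0"] that j unfolding j_def by auto
  obtain c a t0 where c: "c > 0" "0 < t0" "t0 \<le> 1"
    "\<And>t. 0 < t \<Longrightarrow> t \<le> t0 \<Longrightarrow> \<bar>poly (\<rho> j) t\<bar> \<ge> c * t ^ a"
    using nonzero_poly_lower_bound[OF j(2)] by blast
  have "\<exists>B. \<forall>t\<in>{0..1}. \<bar>poly (\<rho> i) t\<bar> \<le> B" for i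
  proof -
    have "compact ((\<lambda>t. poly (\<rho> i) t) ` {0..1})"
      by (intro compact_continuous_image continuous_intros) auto
    then show ?thesis using compact_imp_bounded bounded_iff by (metis imageI real_norm_def)
  qed
  then obtain B where B: "\<And>i t. 0 \<le> t \<Longrightarrow> t \<le> 1 \<Longrightarrow> \<bar>poly (\<rho> i) t\<bar> \<le> B i" by (metis atLeastAtMost_iff)
  define C where "C = 1 + (\<Sum>i\<in>{j<..N}. B i)"
  have Bnn: "B i \<ge> 0" for i using B[of 0 i] by (meson abs_ge_zero order_trans zero_le_one order_refl)
  have C: "C \<ge> 1" unfolding C_def using Bnn by (simp add: sum_nonneg)
  have key: "v t \<ge> min 1 (c / C) * t ^ a" if t: "0 < t" "t \<le> t0" for t
  proof (cases "v t \<le> 1")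
    case False
    have "min 1 (c / C) * t ^ a \<le> 1 * 1"
      using t c C by (intro mult_mono power_le_one) auto
    then show ?thesis using False by linarith
  next
    case True
    have vp: "v t > 0" using pos t c by (auto simp: v_def)
    have "(\<Sum>i\<le>N. poly (\<rho> i) t * v t ^ i) = (\<Sum>i\<in>{j..N}. poly (\<rho> i) t * v t ^ i)"
      using below by (intro sum.mono_neutral_right) auto
    also have "{j..N} = insert j {j<..N}" using j(1) by auto
    also have "(\<Sum>i\<in>insert j {j<..N}. poly (\<rho> i) t * v t ^ i) =
        poly (\<rho> j) t * v t ^ j + (\<Sum>i\<in>{j<..N}. poly (\<rho> i) t * v t ^ i)"
      by simp
    finally have "poly (\<rho> j) t * v t ^ j = - (\<Sum>i\<in>{j<..N}. poly (\<rho> i) t * v t ^ i)"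
      using rel[of t] by simp
    then have "\<bar>poly (\<rho> j) t\<bar> * v t ^ j = \<bar>\<Sum>i\<in>{j<..N}. poly (\<rho> i) t * v t ^ i\<bar>"
      using vp by (metis abs_minus_cancel abs_mult abs_of_pos zero_less_power)
    also have "\<dots> \<le> (\<Sum>i\<in>{j<..N}. \<bar>poly (\<rho> i) t * v t ^ i\<bar>)" by (rule sum_abs)
    also have "\<dots> \<le> (\<Sum>i\<in>{j<..N}. B i * v t ^ Suc j)"
    proof (rule sum_mono)
      fix i assume "i \<in> {j<..N}"
      then have "v t ^ i \<le> v t ^ Suc j" using True vp by (intro power_decreasing) auto
      then show "\<bar>poly (\<rho> i) t * v t ^ i\<bar> \<le> B i * v t ^ Suc j"
        unfolding abs_mult using B[of t i] t c vp Bnn[of i] by (intro mult_mono) auto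
    qed
    also have "\<dots> \<le> C * v t ^ Suc j" using vp by (simp add: C_def sum_distrib_right[symmetric])
    finally have "\<bar>poly (\<rho> j) t\<bar> * v t ^ j \<le> (C * v t) * v t ^ j" by (simp add: mult.assoc)
    then have "\<bar>poly (\<rho> j) t\<bar> \<le> C * v t" using vp by simp
    with c(4)[OF t] have "c * t ^ a \<le> C * v t" by linarith
    then have "c / C * t ^ a \<le> v t" using C by (simp add: field_simps)
    moreover have "min 1 (c / C) * t ^ a \<le> c / C * t ^ a" using t by (intro mult_right_mono) auto
    ultimately show ?thesis by linarith
  qed
  have "v t \<le> P t z" for t z
    unfolding v_def using P(2) by (intro cINF_lower bdd_belowI[of _ 0]) auto
  then have "\<forall>t z. 0 < t \<and> t \<le> t0 \<longrightarrow> min 1 (c / C) * t ^ a \<le> P t z"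
    using key order_trans by blast
  moreover have "min 1 (c / C) > 0" using c C by simp
  ultimately show ?thesis using c(2,3) by blast
qed

section \<open>A Lojasiewicz inequality on the projective closure\<close>

definition parametric_poly :: "nat \<Rightarrow> (real \<Rightarrow> (nat \<Rightarrow> real) \<Rightarrow> real) \<Rightarrow> bool"
  where "parametric_poly K p \<longleftrightarrow> (\<exists>d. PF K d p)"

lemma parametric_poly_add:
  assumes "parametric_poly K p" "parametric_poly K q"
  shows "parametric_poly K (\<lambda>t z. p t z + q t z)"
proof -
  obtain d e where "PF K d p" "PF K e q" using assms by (auto simp: parametric_poly_def)
  then have "PF K (max d e) p" "PF K (max d e) q" by (auto elim: PF_mono)
  then show ?thesis unfolding parametric_poly_def by (blast intro: PF_add)
qed

lemma parametric_poly_mult: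
  "parametric_poly K p \<Longrightarrow> parametric_poly K q \<Longrightarrow> parametric_poly K (\<lambda>t z. p t z * q t z)"
  unfolding parametric_poly_def by (blast intro: PF_mult)

lemma parametric_poly_const: "parametric_poly K (\<lambda>t z. c)"
  unfolding parametric_poly_def by (blast intro: PF_real)

lemma parametric_poly_param: "parametric_poly K (\<lambda>t z. t)"
  unfolding parametric_poly_def by (blast intro: PF_param)

lemma parametric_poly_coord: "i < K \<Longrightarrow> parametric_poly K (\<lambda>t z. z i)"
  unfolding parametric_poly_def by (blast intro: PF_coord)

lemma parametric_poly_diff:
  "parametric_poly K p \<Longrightarrow> parametric_poly K q \<Longrightarrow> parametric_poly K (\<lambda>t z. p t z - q t z)"
  using parametric_poly_add[OF _ parametric_poly_mult[OF parametric_poly_const[of K "-1"]], of p q] by simp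

lemma parametric_poly_square: "parametric_poly K p \<Longrightarrow> parametric_poly K (\<lambda>t z. (p t z)\<^sup>2)"
  unfolding power2_eq_square by (rule parametric_poly_mult)

lemma parametric_poly_sum:
  "(\<And>i. i \<in> A \<Longrightarrow> parametric_poly K (p i)) \<Longrightarrow> parametric_poly K (\<lambda>t z. \<Sum>i\<in>A. p i t z)"
  by (induction A rule: infinite_finite_induct) (auto intro: parametric_poly_const parametric_poly_add)

lemma parametric_poly_eval:
  assumes "\<And>i. \<phi> i < K"
  shows "parametric_poly K (\<lambda>t z. eval_mpoly p (\<chi> i. z (\<phi> i)))"
  unfolding eval_mpoly_eq_ev
proof (induction p rule: ring_induct)
  case (Var i p)
  then show ?case using parametric_poly_mult[OF parametric_poly_coord[OF assms[of i]]] by simp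
qed (auto intro: parametric_poly_const parametric_poly_add)

text \<open>At infinity the homogenization of \<open>f\<close> vanishes, because \<open>2 d\<close> exceeds the degree of \<open>f\<close>. This is
  the reason for the strict inequality between the two.\<close>

lemma homogenize_nonneg:
  fixes f :: "'n::finite real_mpoly" and g :: "nat \<Rightarrow> 'n real_mpoly"
  assumes f: "total_degree f < 2 * d" and g: "\<And>j. j \<in> {1..m} \<Longrightarrow> total_degree (g j) \<le> 2 * e"
    and nn: "\<And>x. x \<in> semialg_set m g \<Longrightarrow> eval_mpoly f x \<ge> 0"
    and y: "\<And>j. j \<in> {1..m} \<Longrightarrow> eval_mpoly (homogenize (2 * e) (g j)) y \<ge> 0"
  shows "eval_mpoly (homogenize (2 * d) f) y \<ge> 0"
proof (cases "y $ None = 0")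
  case True
  have "2 * d - mdeg \<alpha> \<noteq> 0" if "\<alpha> \<in> Poly_Mapping.keys f" for \<alpha>
    using f that total_degree_le_iff[of f "total_degree f"] by force
  then have "eval_mpoly (homogenize (2 * d) f) y = 0"
    unfolding eval_homogenize True by (intro sum.neutral) (auto simp: power_0_left)
  then show ?thesis by simp
next
  case False
  obtain c x where c: "y = c *\<^sub>R hvec x" "c \<noteq> 0" using hvec_decompose[OF False] False by blast
  have pos: "c ^ (2 * l) > 0" for l using c(2) by (simp add: power_mult)
  have "eval_mpoly (g j) x \<ge> 0" if j: "j \<in> {1..m}" for j
    using y[OF j] eval_homogenize_scale[OF g[OF j], of c x] pos[of e] by (simp add: c(1) zero_le_mult_iff)
  then have "eval_mpoly f x \<ge> 0" by (intro nn) (auto simp: semialg_set_def)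
  then show ?thesis
    using eval_homogenize_scale[of f "2 * d" c x] f pos[of d] by (simp add: c(1))
qed

text \<open>On the unit sphere in homogeneous coordinates, let \<open>F\<close> and \<open>G\<^sub>j\<close> be the homogenizations. Slack
  variables turn the question into one about a single family of nonnegative polynomials,
  \<open>(F y + t + u\<^sup>2)\<^sup>2 + \<Sum> (G\<^sub>j y - v\<^sub>j\<^sup>2)\<^sup>2 + (\<bar>y\<bar>\<^sup>2 - 1)\<^sup>2\<close>. It has no zero for \<open>t > 0\<close>, since \<open>F \<ge> 0\<close>
  wherever all \<open>G\<^sub>j \<ge> 0\<close>, and by compactness its infimum is positive, hence at least a power of \<open>t\<close>. At a
  point with \<open>F y \<le> - t\<close> and \<open>\<gamma>\<close> the largest violation of the constraints, suitable slacks give it the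
  value \<open>m \<gamma>\<^sup>2\<close>.\<close>

theorem lojasiewicz_semialgebraic:
  fixes f :: "'n::finite real_mpoly" and g :: "nat \<Rightarrow> 'n real_mpoly"
  assumes m: "m \<ge> 1" and f: "total_degree f < 2 * d"
    and g: "\<And>j. j \<in> {1..m} \<Longrightarrow> total_degree (g j) \<le> 2 * e"
    and nn: "\<And>x. x \<in> semialg_set m g \<Longrightarrow> eval_mpoly f x \<ge> 0"
  shows "\<exists>c>0. \<exists>a. \<forall>\<epsilon> x. 0 < \<epsilon> \<longrightarrow> \<epsilon> \<le> 1 \<longrightarrow> eval_mpoly f x \<le> - \<epsilon> * (1 + (norm x)\<^sup>2) ^ d \<longrightarrow>
    (\<exists>j\<in>{1..m}. eval_mpoly (g j) x \<le> - c * \<epsilon> ^ a * (1 + (norm x)\<^sup>2) ^ e)"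
proof -
  define F where "F = eval_mpoly (homogenize (2 * d) f)"
  define G where "G j = eval_mpoly (homogenize (2 * e) (g j))" for j
  define N where "N = CARD('n option)"
  obtain \<phi> :: "'n option \<Rightarrow> nat" where \<phi>: "bij_betw \<phi> UNIV {0..<N}"
    using ex_bij_betw_finite_nat[of "UNIV :: 'n option set"] by (auto simp: N_def)
  have \<phi>N: "\<phi> i < N" for i using bij_betwE[OF \<phi>] by auto
  have \<phi>_inj: "\<phi> i = \<phi> j \<longleftrightarrow> i = j" for i j using bij_betw_imp_inj_on[OF \<phi>] by (auto simp: inj_on_def)
  define Y :: "(nat \<Rightarrow> real) \<Rightarrow> real ^ 'n option" where "Y z = (\<chi> i. z (\<phi> i))" for z
  define K where "K = N + m + 1"
  define P where "P t z = (F (Y z) + t + (z N)\<^sup>2)\<^sup>2 + (\<Sum>j=1..m. (G j (Y z) - (z (N + j))\<^sup>2)\<^sup>2) +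
      ((\<Sum>i\<in>UNIV. (z (\<phi> i))\<^sup>2) - 1)\<^sup>2" for t z
  have "parametric_poly K P"
    unfolding P_def F_def G_def Y_def
    by (intro parametric_poly_add parametric_poly_square parametric_poly_diff parametric_poly_sum
        parametric_poly_const parametric_poly_param parametric_poly_coord parametric_poly_eval)
      (use \<phi>N in \<open>auto simp: K_def less_Suc_eq add.commute intro: trans_less_add2 less_le_trans[OF \<phi>N]\<close>)
  then obtain D where PF: "PF K D P" by (auto simp: parametric_poly_def)
  have P_nonneg: "P t z \<ge> 0" for t z by (simp add: P_def sum_nonneg)
  have P_pos: "(INF z. P t z) > 0" if t: "0 < t" for t
  proof -
    define \<psi> where "\<psi> y = (max 0 (F y + t))\<^sup>2 + (\<Sum>j=1..m. (max 0 (- G j y))\<^sup>2) + ((norm y)\<^sup>2 - 1)\<^sup>2" for y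
    have le: "\<psi> (Y z) \<le> P t z" for z
    proof -
      have "(max 0 (F (Y z) + t))\<^sup>2 \<le> (F (Y z) + t + (z N)\<^sup>2)\<^sup>2"
        by (cases "F (Y z) + t \<ge> 0") (auto simp: max_def intro!: power_mono)
      moreover have "(max 0 (- G j (Y z)))\<^sup>2 \<le> (G j (Y z) - (z (N + j))\<^sup>2)\<^sup>2" for j
      proof (cases "G j (Y z) \<le> 0")
        case True
        then have "(- G j (Y z))\<^sup>2 \<le> ((z (N + j))\<^sup>2 - G j (Y z))\<^sup>2" by (intro power_mono) auto
        then show ?thesis using True by (simp add: max_def power2_commute)
      qed (auto simp: max_def)
      then have "(\<Sum>j=1..m. (max 0 (- G j (Y z)))\<^sup>2) \<le> (\<Sum>j=1..m. (G j (Y z) - (z (N + j))\<^sup>2)\<^sup>2)"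
        by (intro sum_mono)
      ultimately show ?thesis by (simp add: \<psi>_def P_def norm_vec_sq Y_def)
    qed
    have cont: "continuous_on S \<psi>" for S
      unfolding \<psi>_def F_def G_def by (intro continuous_intros)
    have "compact (cball 0 2 :: (real ^ 'n option) set)" "(cball 0 2 :: (real ^ 'n option) set) \<noteq> {}" by auto
    from continuous_attains_inf[OF this cont]
    obtain y0 where y0: "\<forall>y\<in>cball 0 2. \<psi> y0 \<le> \<psi> y" by (elim bexE)
    have "\<psi> y \<noteq> 0" for y
    proof
      assume "\<psi> y = 0"
      moreover have "(\<Sum>j=1..m. (max 0 (- G j y))\<^sup>2) \<ge> 0" by (intro sum_nonneg) auto
      moreover have "(max 0 (F y + t))\<^sup>2 \<ge> 0" "((norm y)\<^sup>2 - 1)\<^sup>2 \<ge> 0" by auto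
      ultimately have "(max 0 (F y + t))\<^sup>2 = 0" "(\<Sum>j=1..m. (max 0 (- G j y))\<^sup>2) = 0"
        unfolding \<psi>_def by linarith+
      then have "max 0 (F y + t) = 0" "\<And>j. j \<in> {1..m} \<Longrightarrow> max 0 (- G j y) = 0"
        by (simp_all add: sum_nonneg_eq_0_iff)
      then have "F y + t \<le> 0" "\<And>j. j \<in> {1..m} \<Longrightarrow> G j y \<ge> 0"
        by (metis max.cobounded2, metis max.cobounded2 neg_le_0_iff_le)
      moreover from this(2) have "F y \<ge> 0"
        unfolding F_def G_def by (intro homogenize_nonneg[OF f g nn]) auto
      ultimately show False using t by linarith
    qed
    moreover have "\<psi> y \<ge> 0" for y by (simp add: \<psi>_def sum_nonneg)
    ultimately have "\<psi> y0 > 0" by (metis less_eq_real_def)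
    have "min (\<psi> y0) 9 \<le> P t z" for z
    proof (cases "Y z \<in> cball 0 2")
      case True
      then show ?thesis using y0[rule_format, OF True] le[of z] by linarith
    next
      case False
      then have "2 \<le> norm (Y z)" by simp
      then have "2\<^sup>2 \<le> (norm (Y z))\<^sup>2" by (intro power_mono) auto
      then have "3\<^sup>2 \<le> ((norm (Y z))\<^sup>2 - 1)\<^sup>2" by (intro power_mono) auto
      also have "\<dots> \<le> \<psi> (Y z)" by (simp add: \<psi>_def sum_nonneg)
      finally show ?thesis using le[of z] by simp
    qed
    then have "min (\<psi> y0) 9 \<le> (INF z. P t z)" by (intro cINF_greatest) auto
    moreover have "min (\<psi> y0) 9 > 0" using \<open>\<psi> y0 > 0\<close> by simp
    ultimately show ?thesis by linarith
  qed
  obtain c a t0 where c: "c > 0" "0 < t0" "t0 \<le> 1" "\<And>t z. 0 < t \<Longrightarrow> t \<le> t0 \<Longrightarrow> P t z \<ge> c * t ^ a"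
    using infimum_lower_bound[OF PF P_nonneg P_pos] by blast
  define c' where "c' = min 1 (c * t0 ^ a / real m)"
  have c': "c' > 0" using c m by (simp add: c'_def)
  have "\<exists>j\<in>{1..m}. eval_mpoly (g j) x \<le> - c' * \<epsilon> ^ a * (1 + (norm x)\<^sup>2) ^ e"
    if \<epsilon>: "0 < \<epsilon>" "\<epsilon> \<le> 1" and x: "eval_mpoly f x \<le> - \<epsilon> * (1 + (norm x)\<^sup>2) ^ d" for \<epsilon> x
  proof -
    define \<theta> where "\<theta> = 1 + (norm x)\<^sup>2"
    have \<theta>: "\<theta> > 0" by (simp add: \<theta>_def add_pos_nonneg)
    define s where "s = 1 / sqrt \<theta>"
    have s: "s ^ (2 * l) = 1 / \<theta> ^ l" for l using \<theta> by (simp add: s_def power_mult power_divide)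
    define y where "y = s *\<^sub>R hvec x"
    have Fy: "F y = eval_mpoly f x / \<theta> ^ d"
      using eval_homogenize_scale[of f "2 * d" s x] f by (simp add: F_def y_def s)
    have Gy: "G j y = eval_mpoly (g j) x / \<theta> ^ e" if "j \<in> {1..m}" for j
      using eval_homogenize_scale[OF g[OF that], of s x] by (simp add: G_def y_def s)
    have norm_y: "(norm y)\<^sup>2 = 1"
      using \<theta> by (simp add: y_def power_mult_distrib norm_hvec s_def power_divide flip: \<theta>_def)
    \<comment> \<open>The lower bound holds up to \<open>t0\<close> only.\<close>
    define t where "t = t0 * \<epsilon>"
    have t: "0 < t" "t \<le> t0" "t \<le> \<epsilon>" using \<epsilon> c(2,3) by (simp_all add: t_def mult_le_cancel_left1 mult_le_cancel_right1)
    have "F y \<le> - \<epsilon>" using x \<theta> by (simp add: Fy \<theta>_def[symmetric] pos_divide_le_eq)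
    define \<gamma> where "\<gamma> = Max (insert 0 ((\<lambda>j. - G j y) ` {1..m}))"
    have \<gamma>: "\<gamma> \<ge> 0" "\<And>j. j \<in> {1..m} \<Longrightarrow> - G j y \<le> \<gamma>" unfolding \<gamma>_def by (rule Max_ge; simp)+
    define z where "z i = (if i < N then y $ (the_inv \<phi> i) else if i = N then sqrt (- F y - t)
        else sqrt (G (i - N) y + \<gamma>))" for i
    have z_\<phi>: "z (\<phi> i) = y $ i" for i
      using \<phi>N[of i] bij_betw_imp_inj_on[OF \<phi>] by (simp add: z_def the_inv_f_f)
    then have "Y z = y" by (simp add: Y_def vec_eq_iff)
    moreover have "(z N)\<^sup>2 = - F y - t" using \<open>F y \<le> - \<epsilon>\<close> t(3) by (simp add: z_def)
    moreover have "(z (N + j))\<^sup>2 = G j y + \<gamma>" if "j \<in> {1..m}" for j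
      using \<gamma>(2)[OF that] that by (simp add: z_def)
    moreover have "(\<Sum>i\<in>UNIV. (z (\<phi> i))\<^sup>2) = 1"
      using norm_y by (simp add: z_\<phi> norm_vec_sq)
    ultimately have "P t z = real m * \<gamma>\<^sup>2" by (simp add: P_def)
    with c(4)[OF t(1,2), of z] have "c * t ^ a \<le> real m * \<gamma>\<^sup>2" by simp
    then have "c * t0 ^ a / real m * \<epsilon> ^ a \<le> \<gamma>\<^sup>2"
      using m by (simp add: t_def power_mult_distrib field_simps)
    moreover have "c' * \<epsilon> ^ a \<le> c * t0 ^ a / real m * \<epsilon> ^ a"
      using \<epsilon> by (intro mult_right_mono) (auto simp: c'_def)
    ultimately have \<gamma>2: "c' * \<epsilon> ^ a \<le> \<gamma>\<^sup>2" by linarith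
    have "c' * \<epsilon> ^ a \<le> 1 * 1" using \<epsilon> c' by (intro mult_mono power_le_one) (auto simp: c'_def)
    then have \<gamma>1: "c' * \<epsilon> ^ a \<le> \<gamma>"
    proof (cases "\<gamma> \<le> 1")
      case True
      \<comment> \<open>A crude substitute for the square root, which only costs a factor in the exponent.\<close>
      then have "\<gamma>\<^sup>2 \<le> 1 * \<gamma>" using \<gamma>(1) unfolding power2_eq_square by (intro mult_right_mono)
      then show ?thesis using \<gamma>2 by linarith
    qed linarith
    moreover have "c' * \<epsilon> ^ a > 0" using c' \<epsilon> by simp
    ultimately have "\<gamma> \<noteq> 0" by linarith
    moreover have "\<gamma> \<in> insert 0 ((\<lambda>j. - G j y) ` {1..m})" unfolding \<gamma>_def by (intro Max_in) auto
    ultimately obtain j where j: "j \<in> {1..m}" "\<gamma> = - G j y" by blast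
    then have "eval_mpoly (g j) x / \<theta> ^ e \<le> - (c' * \<epsilon> ^ a)" using \<gamma>1 Gy by simp
    then have "eval_mpoly (g j) x \<le> - c' * \<epsilon> ^ a * \<theta> ^ e" using \<theta> by (simp add: pos_divide_le_eq)
    then show ?thesis using j(1) unfolding \<theta>_def by blast
  qed
  then show ?thesis using c' by blast
qed

text \<open>Outside of the unit ball, \<open>f\<close> at \<open>x\<close> is compared with \<open>\<bar>x\<bar>\<^bsup>2d\<^esup> f (x / \<bar>x\<bar>) \<ge> 0\<close>: these are the values of
  the homogenization at \<open>(1, x)\<close> and \<open>(\<bar>x\<bar>, x)\<close>, and the difference is of the order of
  \<open>\<bar>x\<bar>\<^bsup>2d-1\<^esup> (\<bar>x\<bar> - 1)\<close>. So for the ball the exponent of the inequality is \<open>1\<close>.\<close>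

lemma lojasiewicz_ball:
  fixes f :: "'n::finite real_mpoly"
  assumes f: "total_degree f < 2 * d" and nn: "\<And>x. norm x \<le> 1 \<Longrightarrow> eval_mpoly f x \<ge> 0"
  shows "\<exists>c>0. \<forall>\<epsilon> x. 0 < \<epsilon> \<longrightarrow> eval_mpoly f x \<le> - \<epsilon> * (1 + (norm x)\<^sup>2) ^ d \<longrightarrow>
    1 - (norm x)\<^sup>2 \<le> - c * \<epsilon> * (1 + (norm x)\<^sup>2)"
proof -
  define S where "S = 1 + (\<Sum>\<alpha>\<in>Poly_Mapping.keys f. \<bar>Poly_Mapping.lookup f \<alpha>\<bar>) * real (2 * d)"
  have S: "S \<ge> 1" by (simp add: S_def sum_nonneg)
  have "1 - (norm x)\<^sup>2 \<le> - (1 / S) * \<epsilon> * (1 + (norm x)\<^sup>2)"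
    if \<epsilon>: "0 < \<epsilon>" and x: "eval_mpoly f x \<le> - \<epsilon> * (1 + (norm x)\<^sup>2) ^ d" for \<epsilon> x
  proof -
    define s where "s = norm x"
    define \<theta> where "\<theta> = 1 + (norm x)\<^sup>2"
    have \<theta>: "\<theta> > 0" by (simp add: \<theta>_def add_pos_nonneg)
    have d: "d \<ge> 1" using f by (cases d) auto
    have "eval_mpoly f x < 0" using x \<epsilon> \<theta> by (simp add: \<theta>_def[symmetric]) (smt (verit) mult_pos_pos zero_less_power)
    then have s1: "s > 1" using nn[of x] by (force simp: s_def)
    have "eval_mpoly f (x /\<^sub>R s) \<ge> 0" using s1 by (intro nn) (auto simp: s_def divide_simps)
    then have "s ^ (2 * d) * eval_mpoly f (x /\<^sub>R s) \<ge> 0" using s1 by simp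
    moreover have "s ^ (2 * d) * eval_mpoly f (x /\<^sub>R s) - eval_mpoly f x \<le>
       (\<Sum>\<alpha>\<in>Poly_Mapping.keys f. \<bar>Poly_Mapping.lookup f \<alpha>\<bar>) * (real (2 * d) * (s ^ (2 * d - 1) * (s - 1)))"
    proof -
      have "s ^ (2 * d) * eval_mpoly f (x /\<^sub>R s) - eval_mpoly f x =
        (\<Sum>\<alpha>\<in>Poly_Mapping.keys f. Poly_Mapping.lookup f \<alpha> * ((s ^ (2 * d - mdeg \<alpha>) - 1) * mon \<alpha> x))"
      proof -
        have "s ^ (2 * d) * mon \<alpha> (x /\<^sub>R s) = s ^ (2 * d - mdeg \<alpha>) * mon \<alpha> x" if "\<alpha> \<in> Poly_Mapping.keys f" for \<alpha>
        proof -
          have "mdeg \<alpha> \<le> 2 * d" using f that total_degree_le_iff[of f "2 * d"] by auto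
          then have "s ^ (2 * d) = s ^ (2 * d - mdeg \<alpha>) * s ^ mdeg \<alpha>" by (simp flip: power_add)
          moreover have "mon \<alpha> x = s ^ mdeg \<alpha> * mon \<alpha> (x /\<^sub>R s)"
          proof -
            have "s * ((x /\<^sub>R s) $ i) = x $ i" for i using s1 by (simp add: field_simps)
            then have "mon \<alpha> x = (\<Prod>i\<in>UNIV. (s * ((x /\<^sub>R s) $ i)) ^ Poly_Mapping.lookup \<alpha> i)"
              unfolding mon_def by (simp only:)
            also have "\<dots> = s ^ mdeg \<alpha> * mon \<alpha> (x /\<^sub>R s)"
              unfolding power_mult_distrib prod.distrib mon_def mdeg_def power_sum by simp
            finally show ?thesis .
          qed
          ultimately show ?thesis by simp
        qed
        then have "s ^ (2 * d) * eval_mpoly f (x /\<^sub>R s) = (\<Sum>\<alpha>\<in>Poly_Mapping.keys f. Poly_Mapping.lookup f \<alpha> * (s ^ (2 * d - mdeg \<alpha>) * mon \<alpha> x))"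
          unfolding eval_mpoly_mon sum_distrib_left
          by (intro sum.cong refl) (simp add: mult.left_commute)
        then show ?thesis unfolding eval_mpoly_mon by (simp add: sum_subtractf[symmetric] algebra_simps)
      qed
      also have "\<dots> \<le> (\<Sum>\<alpha>\<in>Poly_Mapping.keys f. \<bar>Poly_Mapping.lookup f \<alpha>\<bar> * (real (2 * d) * (s ^ (2 * d - 1) * (s - 1))))"
      proof (rule sum_mono)
        fix \<alpha> assume "\<alpha> \<in> Poly_Mapping.keys f"
        then have deg: "mdeg \<alpha> < 2 * d" using f total_degree_le_iff[of f "total_degree f"] by force
        define l where "l = 2 * d - mdeg \<alpha>"
        have l: "l \<ge> 1" "mdeg \<alpha> + l = 2 * d" using deg by (auto simp: l_def)
        have "\<bar>mon \<alpha> x\<bar> \<le> s ^ mdeg \<alpha>"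
          unfolding mon_def mdeg_def power_sum abs_prod power_abs
          by (intro prod_mono) (auto intro!: power_mono component_le_norm_cart simp: s_def)
        moreover have pow: "s ^ l - 1 \<le> real l * (s ^ (l - 1) * (s - 1))" "s ^ l - 1 \<ge> 0"
        proof -
          have "s ^ l - 1 = (s - 1) * (\<Sum>i<l. s ^ i)" by (rule power_diff_1_eq)
          also have "(\<Sum>i<l. s ^ i) \<le> (\<Sum>i<l. s ^ (l - 1))"
            using s1 by (intro sum_mono power_increasing) auto
          then have "(s - 1) * (\<Sum>i<l. s ^ i) \<le> (s - 1) * (\<Sum>i<l. s ^ (l - 1))"
            using s1 by (intro mult_left_mono) auto
          finally show "s ^ l - 1 \<le> real l * (s ^ (l - 1) * (s - 1))" by (simp add: mult_ac)
          show "s ^ l - 1 \<ge> 0" using s1 by simp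
        qed
        ultimately have "(s ^ l - 1) * \<bar>mon \<alpha> x\<bar> \<le> (real l * (s ^ (l - 1) * (s - 1))) * s ^ mdeg \<alpha>"
          using s1 by (intro mult_mono) auto
        also have "\<dots> = real l * (s ^ (mdeg \<alpha> + (l - 1)) * (s - 1))" by (simp add: power_add mult_ac)
        also have "mdeg \<alpha> + (l - 1) = 2 * d - 1" using l by simp
        also have "real l * (s ^ (2 * d - 1) * (s - 1)) \<le> real (2 * d) * (s ^ (2 * d - 1) * (s - 1))"
          using l s1 by (intro mult_right_mono) auto
        finally have "\<bar>(s ^ l - 1) * mon \<alpha> x\<bar> \<le> real (2 * d) * (s ^ (2 * d - 1) * (s - 1))"
          using pow(2) by (simp add: abs_mult)
        then have "\<bar>Poly_Mapping.lookup f \<alpha>\<bar> * \<bar>(s ^ l - 1) * mon \<alpha> x\<bar> \<le>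
            \<bar>Poly_Mapping.lookup f \<alpha>\<bar> * (real (2 * d) * (s ^ (2 * d - 1) * (s - 1)))"
          by (intro mult_left_mono) auto
        then show "Poly_Mapping.lookup f \<alpha> * ((s ^ (2 * d - mdeg \<alpha>) - 1) * mon \<alpha> x) \<le>
            \<bar>Poly_Mapping.lookup f \<alpha>\<bar> * (real (2 * d) * (s ^ (2 * d - 1) * (s - 1)))"
          unfolding l_def abs_mult[symmetric] by (rule order_trans[OF abs_ge_self])
      qed
      finally show ?thesis by (simp add: sum_distrib_right)
    qed
    moreover have "(\<Sum>\<alpha>\<in>Poly_Mapping.keys f. \<bar>Poly_Mapping.lookup f \<alpha>\<bar>) * (real (2 * d) * (s ^ (2 * d - 1) * (s - 1)))
        \<le> S * (s ^ (2 * d - 1) * (s - 1))"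
      unfolding mult.assoc[symmetric] using s1 by (intro mult_right_mono) (auto simp: S_def)
    moreover have "s ^ (2 * d - 1) * (s - 1) \<le> \<theta> ^ (d - 1) * (s\<^sup>2 - 1)"
    proof -
      have "2 * d - 1 = Suc (2 * (d - 1))" using d by simp
      then have "s ^ (2 * d - 1) * (s - 1) = (s\<^sup>2) ^ (d - 1) * (s * (s - 1))"
        by (simp add: power_mult mult_ac)
      also have "\<dots> \<le> \<theta> ^ (d - 1) * (s * (s - 1))"
        using s1 by (intro mult_right_mono power_mono) (auto simp: \<theta>_def s_def)
      also have "\<dots> \<le> \<theta> ^ (d - 1) * (s\<^sup>2 - 1)"
        using s1 \<theta> by (intro mult_left_mono) (auto simp: power2_eq_square algebra_simps)
      finally show ?thesis .
    qed
    ultimately have "- eval_mpoly f x \<le> S * (\<theta> ^ (d - 1) * (s\<^sup>2 - 1))"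
      using S by (smt (verit) mult_left_mono)
    then have "\<epsilon> * \<theta> ^ d \<le> S * (\<theta> ^ (d - 1) * (s\<^sup>2 - 1))" using x by (simp add: \<theta>_def)
    moreover have "\<theta> ^ d = \<theta> ^ (d - 1) * \<theta>" using d by (cases d) auto
    ultimately have "\<theta> ^ (d - 1) * (\<epsilon> * \<theta>) \<le> \<theta> ^ (d - 1) * (S * (s\<^sup>2 - 1))" by (simp add: mult_ac)
    then have "\<epsilon> * \<theta> \<le> S * (s\<^sup>2 - 1)" using \<theta> by simp
    then show ?thesis using S by (simp add: \<theta>_def s_def field_simps)
  qed
  then show ?thesis using S by (intro exI[of _ "1 / S"]) auto
qed

section \<open>Polynomial step functions\<close>

lemma Bernstein_variance:
  assumes "n \<ge> 1"
  shows "(\<Sum>k\<le>n. (real k / real n - x)\<^sup>2 * Bernstein n k x) = x * (1 - x) / real n"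
proof -
  have "(\<Sum>k\<le>n. (real k - real n * x)\<^sup>2 * Bernstein n k x) =
      (\<Sum>k\<le>n. real k * (real k - 1) * Bernstein n k x) + (1 - 2 * real n * x) * (\<Sum>k\<le>n. real k * Bernstein n k x)
      + (real n * x)\<^sup>2 * (\<Sum>k\<le>n. Bernstein n k x)"
    unfolding sum_distrib_left sum.distrib[symmetric]
    by (intro sum.cong refl) (simp add: power2_eq_square algebra_simps)
  also have "\<dots> = real n * x * (1 - x)"
    unfolding sum_kk_Bernstein sum_k_Bernstein sum_Bernstein by (simp add: power2_eq_square algebra_simps)
  finally have 1: "(\<Sum>k\<le>n. (real k - real n * x)\<^sup>2 * Bernstein n k x) = real n * x * (1 - x)" .
  have "(real k / real n - x)\<^sup>2 * Bernstein n k x = (real k - real n * x)\<^sup>2 * Bernstein n k x / (real n)\<^sup>2" for k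
    using assms by (simp add: power2_eq_square field_simps)
  then have "(\<Sum>k\<le>n. (real k / real n - x)\<^sup>2 * Bernstein n k x) = real n * x * (1 - x) / (real n)\<^sup>2"
    unfolding 1[symmetric] by (simp add: sum_divide_distrib)
  then show ?thesis using assms by (simp add: power2_eq_square)
qed

lemma Bernstein_tail:
  assumes "n \<ge> 1" "0 \<le> x" "x \<le> 1" "\<tau> > 0"
  shows "(\<Sum>k | k \<le> n \<and> \<bar>real k / real n - x\<bar> \<ge> \<tau>. Bernstein n k x) \<le> 1 / (4 * real n * \<tau>\<^sup>2)"
proof -
  let ?A = "{k. k \<le> n \<and> \<bar>real k / real n - x\<bar> \<ge> \<tau>}"
  have "\<tau>\<^sup>2 * (\<Sum>k\<in>?A. Bernstein n k x) \<le> (\<Sum>k\<in>?A. (real k / real n - x)\<^sup>2 * Bernstein n k x)"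
    unfolding sum_distrib_left
  proof (intro sum_mono mult_right_mono Bernstein_nonneg assms)
    fix k assume "k \<in> ?A"
    then have "\<tau>\<^sup>2 \<le> \<bar>real k / real n - x\<bar>\<^sup>2" using assms(4) by (intro power_mono) auto
    then show "\<tau>\<^sup>2 \<le> (real k / real n - x)\<^sup>2" by simp
  qed
  also have "\<dots> \<le> (\<Sum>k\<le>n. (real k / real n - x)\<^sup>2 * Bernstein n k x)"
    using Bernstein_nonneg[OF assms(2,3)] by (intro sum_mono2) auto
  also have "\<dots> = x * (1 - x) / real n" by (rule Bernstein_variance[OF assms(1)])
  also have "\<dots> \<le> (1 / 4) / real n"
  proof (rule divide_right_mono)
    have "(x - 1 / 2)\<^sup>2 \<ge> 0" by simp
    then show "x * (1 - x) \<le> 1 / 4" by (simp add: power2_eq_square algebra_simps)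
  qed simp
  finally show ?thesis using assms by (simp add: field_simps)
qed

text \<open>\<open>q\<close> is the probability that a binomial frequency with
  mean \<open>(1 - t) / 2\<close> is at least \<open>1/2 - \<eta>/4\<close>. By Chebyshev's inequality it is nearly \<open>1\<close> for \<open>t \<le> 0\<close> and
  nearly \<open>0\<close> for \<open>t \<ge> \<eta>\<close>; the threshold lies halfway between the two means.\<close>

lemma Bernstein_step:
  assumes n: "n \<ge> 1" and \<eta>: "0 < \<eta>" "\<eta> \<le> 1" and large: "real n \<ge> 8 / \<eta> ^ 3"
    and t: "\<bar>t\<bar> \<le> 1"
  defines "q \<equiv> (\<Sum>k | k \<le> n \<and> real k / real n \<ge> 1 / 2 - \<eta> / 4. Bernstein n k ((1 - t) / 2))"
  shows "0 \<le> q" "q \<le> 1" "t \<le> 0 \<Longrightarrow> q \<ge> 1 / 2" "t * q\<^sup>2 \<le> \<eta>"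
proof -
  define x where "x = (1 - t) / 2"
  have x: "0 \<le> x" "x \<le> 1" using t by (auto simp: x_def abs_le_iff)
  let ?A = "{k. k \<le> n \<and> real k / real n \<ge> 1 / 2 - \<eta> / 4}"
  let ?T = "{k. k \<le> n \<and> \<bar>real k / real n - x\<bar> \<ge> \<eta> / 4}"
  have q: "q = (\<Sum>k\<in>?A. Bernstein n k x)" by (simp add: q_def x_def)
  have nn: "Bernstein n k x \<ge> 0" for k by (rule Bernstein_nonneg[OF x])
  have fin: "finite ?A" "finite ?T" by (auto intro: finite_subset[of _ "{..n}"])
  have tail: "(\<Sum>k\<in>?T. Bernstein n k x) \<le> \<eta> / 2"
  proof -
    have "(\<Sum>k\<in>?T. Bernstein n k x) \<le> 1 / (4 * real n * (\<eta> / 4)\<^sup>2)"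
      using \<eta> by (intro Bernstein_tail n x) auto
    also have "\<dots> = 4 / (real n * \<eta>\<^sup>2)" by (simp add: power2_eq_square)
    also have "\<dots> \<le> \<eta> / 2"
    proof -
      have "8 \<le> real n * \<eta> ^ 3" using large \<eta> by (simp add: field_simps)
      then have "8 \<le> real n * \<eta>\<^sup>2 * \<eta>" by (simp add: power2_eq_square power3_eq_cube mult.assoc)
      then show ?thesis using n \<eta> by (simp add: field_simps)
    qed
    finally show ?thesis .
  qed
  show "0 \<le> q" unfolding q using nn by (intro sum_nonneg)
  have "q \<le> (\<Sum>k\<le>n. Bernstein n k x)" unfolding q using nn by (intro sum_mono2) auto
  then show q1: "q \<le> 1" by simp
  show "q \<ge> 1 / 2" if "t \<le> 0"
  proof -
    have "(\<Sum>k\<le>n. Bernstein n k x) \<le> (\<Sum>k\<in>?A \<union> ?T. Bernstein n k x)"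
    proof (rule sum_mono2)
      have "x \<ge> 1 / 2" using that by (simp add: x_def)
      then have "\<bar>real k / real n - x\<bar> \<ge> \<eta> / 4" if "\<not> real k / real n \<ge> 1 / 2 - \<eta> / 4" for k
        using that abs_ge_minus_self[of "real k / real n - x"] by linarith
      then show "{..n} \<subseteq> ?A \<union> ?T" by blast
    qed (use fin nn in auto)
    also have "\<dots> \<le> q + (\<Sum>k\<in>?T. Bernstein n k x)"
      unfolding q by (subst sum.union_inter[symmetric]) (use fin nn in \<open>auto intro!: sum_nonneg\<close>)
    finally show ?thesis using tail \<eta> by simp
  qed
  show "t * q\<^sup>2 \<le> \<eta>"
  proof (cases "t \<le> \<eta>")
    case True
    have "q\<^sup>2 \<le> 1" using \<open>0 \<le> q\<close> q1 by (simp add: power_le_one)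
    then show ?thesis
      using True \<eta> by (smt (verit) mult_left_le mult_nonneg_nonneg mult_nonpos_nonneg zero_le_power2)
  next
    case False
    have "x \<le> 1 / 2 - \<eta> / 2" using False by (simp add: x_def field_simps)
    then have "\<bar>real k / real n - x\<bar> \<ge> \<eta> / 4" if "real k / real n \<ge> 1 / 2 - \<eta> / 4" for k
      using that abs_ge_self[of "real k / real n - x"] \<eta> by linarith
    then have "?A \<subseteq> ?T" by blast
    then have "q \<le> (\<Sum>k\<in>?T. Bernstein n k x)" unfolding q using fin nn by (intro sum_mono2) auto
    then have "q \<le> \<eta> / 2" using tail by linarith
    have "t * q\<^sup>2 \<le> 1 * (q * 1)" unfolding power2_eq_square
      using t False \<eta> \<open>0 \<le> q\<close> q1 by (intro mult_mono) (auto simp: abs_le_iff)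
    then show ?thesis using \<open>q \<le> \<eta> / 2\<close> \<eta> by simp
  qed
qed

lemma total_degree_Const_mult: "total_degree p \<le> d \<Longrightarrow> total_degree (Const c * p) \<le> d"
  using total_degree_mult[of "Const c" 0 p d] by simp

lemma total_degree_diff: "total_degree p \<le> d \<Longrightarrow> total_degree q \<le> d \<Longrightarrow> total_degree (p - q) \<le> d"
  using total_degree_add[of p d "- q"] by (simp add: total_degree_le_iff keys.rep_eq)

lemma total_degree_theta_power: "total_degree ((theta :: 'n::finite real_mpoly) ^ k) \<le> 2 * k"
  using total_degree_power[OF total_degree_theta, of k, where 'a = 'n] by simp

lemma eval_theta_power: "eval_mpoly (theta ^ k) x = (1 + (norm x)\<^sup>2) ^ k"
  using eval_theta[of x] by (simp add: eval_mpoly_eq_ev)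

text \<open>The step function of \<open>t = g / (B \<theta>\<^sup>e)\<close>, cleared of denominators: its square is a multiplier for the
  constraint \<open>g\<close> that is at least \<open>1/4\<close> where \<open>g \<le> 0\<close> and makes a contribution of at most \<open>\<eta>\<close> where
  \<open>g \<ge> 0\<close>. A power of \<open>1 - g\<close> would do this as well, but its maximum would be exponential in its
  degree.\<close>

lemma step_polynomial:
  fixes g :: "'n::finite real_mpoly"
  assumes deg: "total_degree g \<le> 2 * e" and B: "B > 0" "\<And>x. \<bar>eval_mpoly g x\<bar> \<le> B * (1 + (norm x)\<^sup>2) ^ e"
    and n: "n \<ge> 1" and \<eta>: "0 < \<eta>" "\<eta> \<le> 1" and large: "real n \<ge> 8 / \<eta> ^ 3"
  shows "\<exists>Q. total_degree Q \<le> 2 * e * n \<and> (\<forall>x. \<exists>q t. eval_mpoly Q x = (1 + (norm x)\<^sup>2) ^ (e * n) * q \<and>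
    eval_mpoly g x = B * t * (1 + (norm x)\<^sup>2) ^ e \<and> \<bar>t\<bar> \<le> 1 \<and> 0 \<le> q \<and> q \<le> 1 \<and> (t \<le> 0 \<longrightarrow> q \<ge> 1 / 2) \<and> t * q\<^sup>2 \<le> \<eta>)"
proof -
  define X where "X = Const (1 / 2) * (theta ^ e - Const (1 / B) * g)"
  define X' where "X' = Const (1 / 2) * (theta ^ e + Const (1 / B) * g)"
  define A where "A = {k. k \<le> n \<and> real k / real n \<ge> 1 / 2 - \<eta> / 4}"
  define Q where "Q = (\<Sum>k\<in>A. Const (real (n choose k)) * (X ^ k * X' ^ (n - k)))"
  have X: "total_degree X \<le> 2 * e" "total_degree X' \<le> 2 * e"
    unfolding X_def X'_def
    by (intro total_degree_Const_mult total_degree_diff total_degree_add total_degree_theta_power deg)+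
  have "total_degree Q \<le> 2 * e * n"
    unfolding Q_def
  proof (intro total_degree_sum total_degree_Const_mult)
    fix k assume "k \<in> A"
    then have "k * (2 * e) + (n - k) * (2 * e) = 2 * e * n"
      by (simp add: A_def add_mult_distrib[symmetric])
    then show "total_degree (X ^ k * X' ^ (n - k)) \<le> 2 * e * n"
      using total_degree_mult[OF total_degree_power[OF X(1), of k] total_degree_power[OF X(2), of "n - k"]] by simp
  qed
  moreover have "\<exists>q t. eval_mpoly Q x = (1 + (norm x)\<^sup>2) ^ (e * n) * q \<and>
    eval_mpoly g x = B * t * (1 + (norm x)\<^sup>2) ^ e \<and> \<bar>t\<bar> \<le> 1 \<and> 0 \<le> q \<and> q \<le> 1 \<and> (t \<le> 0 \<longrightarrow> q \<ge> 1 / 2) \<and> t * q\<^sup>2 \<le> \<eta>" for x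
  proof -
    define \<theta> where "\<theta> = (1 + (norm x)\<^sup>2) ^ e"
    have \<theta>: "\<theta> > 0" by (simp add: \<theta>_def add_pos_nonneg)
    define t where "t = eval_mpoly g x / (B * \<theta>)"
    have g: "eval_mpoly g x = B * t * \<theta>" using B \<theta> by (simp add: t_def)
    have t: "\<bar>t\<bar> \<le> 1" using B(2)[of x] B(1) \<theta> by (simp add: t_def abs_mult \<theta>_def[symmetric])
    define q where "q = (\<Sum>k\<in>A. Bernstein n k ((1 - t) / 2))"
    have XX: "eval_mpoly X x = \<theta> * ((1 - t) / 2)" "eval_mpoly X' x = \<theta> * (1 - (1 - t) / 2)"
      using g B eval_theta_power[of e x]
      by (simp_all add: X_def X'_def eval_mpoly_eq_ev \<theta>_def[symmetric] field_simps)
    have "eval_mpoly Q x = (\<Sum>k\<in>A. real (n choose k) * (eval_mpoly X x ^ k * eval_mpoly X' x ^ (n - k)))"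
      by (simp add: Q_def eval_mpoly_eq_ev)
    also have "\<dots> = (\<Sum>k\<in>A. real (n choose k) * ((\<theta> * ((1 - t) / 2)) ^ k * (\<theta> * (1 - (1 - t) / 2)) ^ (n - k)))"
      by (simp only: XX)
    also have "\<dots> = (\<Sum>k\<in>A. \<theta> ^ n * Bernstein n k ((1 - t) / 2))"
    proof (intro sum.cong refl)
      fix k assume "k \<in> A"
      then have "\<theta> ^ n = \<theta> ^ k * \<theta> ^ (n - k)" by (simp add: A_def flip: power_add)
      then show "real (n choose k) * ((\<theta> * ((1 - t) / 2)) ^ k * (\<theta> * (1 - (1 - t) / 2)) ^ (n - k)) =
          \<theta> ^ n * Bernstein n k ((1 - t) / 2)"
        by (simp only: Bernstein_def power_mult_distrib mult_ac)
    qed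
    also have "\<dots> = \<theta> ^ n * q" by (simp add: q_def sum_distrib_left)
    also have "\<theta> ^ n = (1 + (norm x)\<^sup>2) ^ (e * n)" by (simp add: \<theta>_def power_mult)
    finally have "eval_mpoly Q x = (1 + (norm x)\<^sup>2) ^ (e * n) * q" .
    then show ?thesis
      using Bernstein_step[OF n \<eta> large t] g t unfolding q_def A_def \<theta>_def by blast
  qed
  ultimately show ?thesis by blast
qed

section \<open>The representation with its complexity\<close>

lemma polynomial_growth_bound:
  fixes p :: "'n::finite real_mpoly"
  assumes "total_degree p \<le> 2 * d"
  shows "\<exists>M>0. \<forall>x. \<bar>eval_mpoly p x\<bar> \<le> M * (1 + (norm x)\<^sup>2) ^ d"
proof -
  define M where "M = 1 + (\<Sum>\<alpha>\<in>Poly_Mapping.keys p. \<bar>Poly_Mapping.lookup p \<alpha>\<bar>)"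
  have "\<bar>eval_mpoly p x\<bar> \<le> M * (1 + (norm x)\<^sup>2) ^ d" for x
  proof -
    define s where "s = norm (hvec x)"
    have s: "s\<^sup>2 = 1 + (norm x)\<^sup>2" by (simp add: s_def norm_hvec)
    have "1\<^sup>2 \<le> s\<^sup>2" unfolding s by simp
    then have s1: "1 \<le> s" by (rule power2_le_imp_le) (simp add: s_def)
    have mon: "\<bar>mon \<alpha> x\<bar> \<le> (1 + (norm x)\<^sup>2) ^ d" if "\<alpha> \<in> Poly_Mapping.keys p" for \<alpha>
    proof -
      have "(norm x)\<^sup>2 \<le> s\<^sup>2" using s by simp
      then have "norm x \<le> s" by (rule power2_le_imp_le) (simp add: s_def)
      then have "\<bar>x $ i\<bar> \<le> s" for i using component_le_norm_cart[of x i] by linarith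
      then have "\<bar>mon \<alpha> x\<bar> \<le> s ^ mdeg \<alpha>"
        unfolding mon_def mdeg_def power_sum abs_prod power_abs by (intro prod_mono) (auto intro: power_mono)
      also have "\<dots> \<le> s ^ (2 * d)"
        using s1 that assms by (intro power_increasing) (auto simp: total_degree_le_iff)
      finally show ?thesis by (simp add: power_mult s)
    qed
    have "\<bar>eval_mpoly p x\<bar> \<le> (\<Sum>\<alpha>\<in>Poly_Mapping.keys p. \<bar>Poly_Mapping.lookup p \<alpha> * mon \<alpha> x\<bar>)"
      unfolding eval_mpoly_mon by (rule sum_abs)
    also have "\<dots> \<le> (\<Sum>\<alpha>\<in>Poly_Mapping.keys p. \<bar>Poly_Mapping.lookup p \<alpha>\<bar> * (1 + (norm x)\<^sup>2) ^ d)"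
      unfolding abs_mult by (intro sum_mono mult_left_mono mon) auto
    also have "\<dots> \<le> M * (1 + (norm x)\<^sup>2) ^ d"
      by (simp add: M_def sum_distrib_right[symmetric] distrib_right)
    finally show ?thesis .
  qed
  moreover have "M > 0" by (simp add: M_def add_pos_nonneg sum_nonneg)
  ultimately show ?thesis by blast
qed

lemma common_growth_bound:
  fixes g :: "nat \<Rightarrow> 'n::finite real_mpoly"
  assumes "\<And>j. j \<in> {1..m} \<Longrightarrow> total_degree (g j) \<le> 2 * e"
  shows "\<exists>B>0. \<forall>j\<in>{1..m}. \<forall>x. \<bar>eval_mpoly (g j) x\<bar> \<le> B * (1 + (norm x)\<^sup>2) ^ e"
proof -
  have "\<forall>j\<in>{1..m}. \<exists>M>0. \<forall>x. \<bar>eval_mpoly (g j) x\<bar> \<le> M * (1 + (norm x)\<^sup>2) ^ e"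
    using polynomial_growth_bound[OF assms] by blast
  then obtain M where M: "\<And>j. j \<in> {1..m} \<Longrightarrow> M j > 0"
    "\<And>j x. j \<in> {1..m} \<Longrightarrow> \<bar>eval_mpoly (g j) x\<bar> \<le> M j * (1 + (norm x)\<^sup>2) ^ e"
    by metis
  define B where "B = 1 + (\<Sum>j=1..m. M j)"
  have MB: "M j \<le> B" if "j \<in> {1..m}" for j
    using member_le_sum[of j "{1..m}" M] that M(1) by (force simp: B_def less_imp_le)
  have "\<bar>eval_mpoly (g j) x\<bar> \<le> B * (1 + (norm x)\<^sup>2) ^ e" if "j \<in> {1..m}" for j x
  proof -
    have "M j * (1 + (norm x)\<^sup>2) ^ e \<le> B * (1 + (norm x)\<^sup>2) ^ e"
      using MB[OF that] by (intro mult_right_mono) auto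
    then show ?thesis using M(2)[OF that, of x] by linarith
  qed
  moreover have "(\<Sum>j=1..m. M j) \<ge> 0" using M(1) by (intro sum_nonneg) (simp add: less_imp_le)
  ultimately show ?thesis by (intro exI[of _ B]) (auto simp: B_def)
qed

text \<open>\<open>F\<close> is the value of \<open>f / \<theta>\<^sup>d\<close> at a point, and \<open>u\<^sub>j\<close> that of the \<open>j\<close>-th constraint times its
  multiplier. Where \<open>F \<le> - \<epsilon>/2\<close>, one strongly violated constraint outweighs \<open>F\<close>; elsewhere the
  penalties cost at most \<open>\<epsilon>/4\<close>.\<close>

lemma penalized_bounds:
  fixes u :: "nat \<Rightarrow> real"
  assumes m: "m \<ge> 1" and \<epsilon>: "0 < \<epsilon>" "\<epsilon> \<le> 1" and L: "L > 0"
    and \<eta>: "0 \<le> \<eta>" "real m * L * \<eta> \<le> \<epsilon> / 4"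
    and F: "\<bar>F\<bar> \<le> M"
    and u: "\<And>j. j \<in> {1..m} \<Longrightarrow> u j \<le> \<eta>" "\<And>j. j \<in> {1..m} \<Longrightarrow> - 1 \<le> u j"
    and bad: "F \<le> - (\<epsilon> / 2) \<Longrightarrow> \<exists>j\<in>{1..m}. L * u j \<le> - M"
  shows "\<epsilon> / 4 \<le> F + \<epsilon> - L * (\<Sum>j=1..m. u j)" and "F + \<epsilon> - L * (\<Sum>j=1..m. u j) \<le> M + 1 + L * real m"
proof -
  have others: "L * (\<Sum>j\<in>A. u j) \<le> \<epsilon> / 4" if A: "A \<subseteq> {1..m}" for A
  proof -
    have "(\<Sum>j\<in>A. u j) \<le> (\<Sum>j\<in>A. \<eta>)" using A u(1) by (intro sum_mono) auto
    also have "\<dots> = real (card A) * \<eta>" by simp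
    also have "\<dots> \<le> real m * \<eta>"
      using card_mono[OF _ A] \<eta>(1) by (intro mult_right_mono) auto
    finally have "L * (\<Sum>j\<in>A. u j) \<le> L * (real m * \<eta>)" using L by (intro mult_left_mono) auto
    then show ?thesis using \<eta>(2) by (simp add: mult_ac)
  qed
  show "\<epsilon> / 4 \<le> F + \<epsilon> - L * (\<Sum>j=1..m. u j)"
  proof (cases "F \<le> - (\<epsilon> / 2)")
    case False
    then show ?thesis using others[OF order_refl] by linarith
  next
    case True
    from bad[OF this] obtain j where j: "j \<in> {1..m}" "L * u j \<le> - M" by (elim bexE)
    have "(\<Sum>j=1..m. u j) = u j + (\<Sum>i\<in>{1..m} - {j}. u i)" using j(1) by (simp add: sum.remove)
    then have "L * (\<Sum>j=1..m. u j) = L * u j + L * (\<Sum>i\<in>{1..m} - {j}. u i)" by (simp add: distrib_left)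
    moreover have "L * (\<Sum>i\<in>{1..m} - {j}. u i) \<le> \<epsilon> / 4" using others[of "{1..m} - {j}"] by simp
    ultimately show ?thesis using j(2) F \<epsilon> by linarith
  qed
  have "- real m = (\<Sum>j=1..m. - 1 :: real)" by simp
  also have "\<dots> \<le> (\<Sum>j=1..m. u j)" using u(2) by (intro sum_mono) auto
  finally have "L * (- real m) \<le> L * (\<Sum>j=1..m. u j)" using L by (intro mult_left_mono) auto
  then show "F + \<epsilon> - L * (\<Sum>j=1..m. u j) \<le> M + 1 + L * real m" using F \<epsilon> by simp
qed

text \<open>With \<open>1/\<epsilon>\<close> as the unit, \<open>L\<close> has order \<open>a\<close>, the accuracy \<open>\<eta>\<close> of the steps order \<open>- (a + 1)\<close>, their
  degree \<open>n\<close> and with it \<open>K\<close> order \<open>3 (a + 1)\<close>, and the ratio of the bounds for \<open>p\<close> order \<open>a + 1\<close>. Reznick's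
  theorem needs \<open>k\<close> of order \<open>2 \<cdot> 3 (a + 1) + (a + 1) = 7 (a + 1)\<close>.\<close>

theorem representation_from_lojasiewicz:
  fixes f :: "'n::finite real_mpoly" and g :: "nat \<Rightarrow> 'n real_mpoly"
  assumes m: "m \<ge> 1" and f: "total_degree f < 2 * d" and e: "e \<ge> 1"
    and g: "\<And>j. j \<in> {1..m} \<Longrightarrow> total_degree (g j) \<le> 2 * e"
    and c: "c > 0"
    and loj: "\<And>\<epsilon> x. 0 < \<epsilon> \<Longrightarrow> \<epsilon> \<le> 1 \<Longrightarrow> eval_mpoly f x \<le> - \<epsilon> * (1 + (norm x)\<^sup>2) ^ d \<Longrightarrow>
      \<exists>j\<in>{1..m}. eval_mpoly (g j) x \<le> - c * \<epsilon> ^ a * (1 + (norm x)\<^sup>2) ^ e"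
  shows "\<exists>C>0. \<forall>\<epsilon>. 0 < \<epsilon> \<longrightarrow> \<epsilon> \<le> 1 \<longrightarrow> (\<forall>k::nat. real k \<ge> C * (1 / \<epsilon>) ^ (7 * (a + 1)) \<longrightarrow>
      has_sos_rep m g (2 * (k + d)) (theta ^ k * (f + Const \<epsilon> * theta ^ d)))"
proof -
  have d: "d \<ge> 1" using f by (cases d) auto
  obtain M where M: "M > 0" "\<And>x. \<bar>eval_mpoly f x\<bar> \<le> M * (1 + (norm x)\<^sup>2) ^ d"
    using polynomial_growth_bound[of f d] f by auto
  obtain B where B: "B > 0" "\<And>j x. j \<in> {1..m} \<Longrightarrow> \<bar>eval_mpoly (g j) x\<bar> \<le> B * (1 + (norm x)\<^sup>2) ^ e"
    using common_growth_bound[of m g e] g by auto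
  \<comment> \<open>Large enough for a violation \<open>c (\<epsilon>/2)\<^sup>a / B\<close>, weighted by \<open>1/4\<close>, to outweigh \<open>M\<close>.\<close>
  define l where "l = 1 + 4 * M * B * 2 ^ a / c"
  have l: "l \<ge> 1" using M B c by (simp add: l_def)
  \<comment> \<open>\<open>C1\<close> bounds \<open>K\<close> and \<open>C2\<close> the ratio of the bounds for \<open>p\<close>, up to powers of \<open>1/\<epsilon>\<close>.\<close>
  define C1 where "C1 = real (3 * e + d) * (9 * (4 * real m * l) ^ 3)"
  define C2 where "C2 = 4 * (M + 1 + l * real m)"
  define C where "C = (1 + 1152 * real CARD('n option) * C2) * C1\<^sup>2"
  have ml: "4 * real m * l \<ge> 1"
  proof -
    have "1 * 1 \<le> (4 * real m) * l" using m l by (intro mult_mono) auto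
    then show ?thesis by simp
  qed
  have C1: "C1 \<ge> 1"
  proof -
    have "1 * (1 * 1) \<le> real (3 * e + d) * (9 * (4 * real m * l) ^ 3)"
      using d ml by (intro mult_mono) (auto intro: one_le_power)
    then show ?thesis by (simp add: C1_def)
  qed
  have C2: "C2 > 0" using M l by (simp add: C2_def add_pos_nonneg)
  have "C > 0" using C1 C2 by (simp add: C_def add_pos_nonneg)
  moreover have "has_sos_rep m g (2 * (k + d)) (theta ^ k * (f + Const \<epsilon> * theta ^ d))"
    if \<epsilon>: "0 < \<epsilon>" "\<epsilon> \<le> 1" and k: "real k \<ge> C * (1 / \<epsilon>) ^ (7 * (a + 1))" for \<epsilon> k
  proof -
    define r where "r = 1 / \<epsilon>"
    have r: "r \<ge> 1" "\<epsilon> = 1 / r" using \<epsilon> by (simp_all add: r_def)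
    define L where "L = l * r ^ a"
    have L: "L \<ge> 1"
    proof -
      have "1 * 1 \<le> l * r ^ a" using l r by (intro mult_mono one_le_power) auto
      then show ?thesis by (simp add: L_def)
    qed
    \<comment> \<open>The \<open>m\<close> penalties together then lower the value by at most \<open>\<epsilon>/4\<close>.\<close>
    define \<eta> where "\<eta> = \<epsilon> / (4 * real m * L)"
    have mL: "4 * real m * L \<ge> 1"
    proof -
      have "1 * 1 \<le> (4 * real m) * L" using m L by (intro mult_mono) auto
      then show ?thesis by simp
    qed
    have \<eta>: "0 < \<eta>" "\<eta> \<le> 1"
    proof -
      show "0 < \<eta>" unfolding \<eta>_def using \<epsilon> mL by (intro divide_pos_pos) linarith+
      show "\<eta> \<le> 1" unfolding \<eta>_def using \<epsilon> mL by (subst divide_le_eq_1_pos) linarith+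
    qed
    have inv_\<eta>: "1 / \<eta> = 4 * real m * l * r ^ (a + 1)"
      using \<epsilon> by (simp add: \<eta>_def L_def r_def power_divide field_simps)
    define n where "n = nat \<lceil>8 / \<eta> ^ 3\<rceil>"
    have "8 / \<eta> ^ 3 > 0" using \<eta> by simp
    then have n: "n \<ge> 1" "real n \<ge> 8 / \<eta> ^ 3" "real n \<le> 8 / \<eta> ^ 3 + 1"
      unfolding n_def by linarith+
    have n_le: "real n \<le> 9 * (4 * real m * l) ^ 3 * r ^ (3 * (a + 1))"
    proof -
      have "1 \<le> 1 / \<eta> ^ 3" using \<eta> by (simp add: power_le_one)
      then have "real n \<le> 9 * (1 / \<eta>) ^ 3" using n(3) by (simp add: power_one_over)
      also have "\<dots> = 9 * (4 * real m * l) ^ 3 * r ^ (3 * (a + 1))"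
        unfolding inv_\<eta> by (simp only: power_mult_distrib mult.assoc power_mult[symmetric] mult.commute[of "a + 1"])
      finally show ?thesis .
    qed
    have "\<forall>j\<in>{1..m}. \<exists>Q. total_degree Q \<le> 2 * e * n \<and> (\<forall>x. \<exists>q t. eval_mpoly Q x = (1 + (norm x)\<^sup>2) ^ (e * n) * q \<and>
      eval_mpoly (g j) x = B * t * (1 + (norm x)\<^sup>2) ^ e \<and> \<bar>t\<bar> \<le> 1 \<and> 0 \<le> q \<and> q \<le> 1 \<and> (t \<le> 0 \<longrightarrow> q \<ge> 1 / 2) \<and> t * q\<^sup>2 \<le> \<eta>)"
      using step_polynomial[OF g B(1) B(2) n(1) \<eta> n(2)] by blast
    then obtain Q where Q: "\<And>j. j \<in> {1..m} \<Longrightarrow> total_degree (Q j) \<le> 2 * e * n"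
      and Q_val: "\<And>j x. j \<in> {1..m} \<Longrightarrow> \<exists>q t. eval_mpoly (Q j) x = (1 + (norm x)\<^sup>2) ^ (e * n) * q \<and>
        eval_mpoly (g j) x = B * t * (1 + (norm x)\<^sup>2) ^ e \<and> \<bar>t\<bar> \<le> 1 \<and> 0 \<le> q \<and> q \<le> 1 \<and> (t \<le> 0 \<longrightarrow> q \<ge> 1 / 2) \<and> t * q\<^sup>2 \<le> \<eta>"
      by (metis (no_types, lifting))
    \<comment> \<open>\<open>2 K0\<close> bounds the degree of \<open>(Q j)\<^sup>2 g\<^sub>j\<close>.\<close>
    define K0 where "K0 = 2 * e * n + e"
    define K where "K = K0 + d"
    define s where "s j = Const (L / B) * (theta ^ d * (Q j)\<^sup>2)" for j
    define p where "p = theta ^ K0 * (f + Const \<epsilon> * theta ^ d) - (\<Sum>j=1..m. s j * g j)"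
    have deg_sg: "total_degree (s j * g j) \<le> 2 * K" if "j \<in> {1..m}" for j
    proof -
      have "total_degree (s j) \<le> 2 * d + 2 * (2 * e * n)"
        unfolding s_def by (intro total_degree_Const_mult total_degree_mult total_degree_theta_power total_degree_power Q that)
      from total_degree_mult[OF this g[OF that]] show ?thesis
        by (rule order_trans) (simp add: K_def K0_def)
    qed
    have deg_main: "total_degree (f + Const \<epsilon> * theta ^ d) \<le> 2 * d"
      using f by (intro total_degree_add total_degree_Const_mult total_degree_theta_power) auto
    have deg_p: "total_degree p \<le> 2 * K"
      unfolding p_def
    proof (intro total_degree_diff total_degree_sum deg_sg)
      show "total_degree (theta ^ K0 * (f + Const \<epsilon> * theta ^ d)) \<le> 2 * K"
        using total_degree_mult[OF total_degree_theta_power[of K0] deg_main] by (simp add: K_def)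
    qed
    have p_bounds: "\<epsilon> / 4 * (1 + (norm x)\<^sup>2) ^ K \<le> eval_mpoly p x \<and>
        eval_mpoly p x \<le> (M + 1 + L * real m) * (1 + (norm x)\<^sup>2) ^ K" for x
    proof -
      define \<theta> where "\<theta> = 1 + (norm x)\<^sup>2"
      have \<theta>: "\<theta> > 0" by (simp add: \<theta>_def add_pos_nonneg)
      have "\<forall>j\<in>{1..m}. \<exists>q t. eval_mpoly (Q j) x = \<theta> ^ (e * n) * q \<and>
          eval_mpoly (g j) x = B * t * \<theta> ^ e \<and> \<bar>t\<bar> \<le> 1 \<and> 0 \<le> q \<and> q \<le> 1 \<and> (t \<le> 0 \<longrightarrow> q \<ge> 1 / 2) \<and> t * q\<^sup>2 \<le> \<eta>"
        using Q_val[of _ x] unfolding \<theta>_def by (intro ballI)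
      from bchoice[OF this] obtain q where "\<forall>j\<in>{1..m}. \<exists>t. eval_mpoly (Q j) x = \<theta> ^ (e * n) * q j \<and>
          eval_mpoly (g j) x = B * t * \<theta> ^ e \<and> \<bar>t\<bar> \<le> 1 \<and> 0 \<le> q j \<and> q j \<le> 1 \<and> (t \<le> 0 \<longrightarrow> q j \<ge> 1 / 2) \<and> t * (q j)\<^sup>2 \<le> \<eta>"
        by (elim exE)
      from bchoice[OF this] obtain t where "\<forall>j\<in>{1..m}. eval_mpoly (Q j) x = \<theta> ^ (e * n) * q j \<and>
          eval_mpoly (g j) x = B * t j * \<theta> ^ e \<and> \<bar>t j\<bar> \<le> 1 \<and> 0 \<le> q j \<and> q j \<le> 1 \<and> (t j \<le> 0 \<longrightarrow> q j \<ge> 1 / 2) \<and> t j * (q j)\<^sup>2 \<le> \<eta>"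
        by (elim exE)
      then have qt: "eval_mpoly (Q j) x = \<theta> ^ (e * n) * q j" "eval_mpoly (g j) x = B * t j * \<theta> ^ e"
        "\<bar>t j\<bar> \<le> 1" "0 \<le> q j" "q j \<le> 1" "t j \<le> 0 \<Longrightarrow> q j \<ge> 1 / 2" "t j * (q j)\<^sup>2 \<le> \<eta>"
        if "j \<in> {1..m}" for j
        using that by simp_all
      define F where "F = eval_mpoly f x / \<theta> ^ d"
      define u where "u j = t j * (q j)\<^sup>2" for j
      have f_F: "eval_mpoly f x = F * \<theta> ^ d" using \<theta> by (simp add: F_def)
      have sg: "eval_mpoly (s j * g j) x = \<theta> ^ K * (L * u j)" if "j \<in> {1..m}" for j
      proof -
        have "eval_mpoly (s j * g j) x = L / B * (eval_mpoly theta x ^ d * (eval_mpoly (Q j) x)\<^sup>2) * eval_mpoly (g j) x"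
          by (simp add: s_def eval_mpoly_eq_ev)
        also have "\<dots> = L / B * (\<theta> ^ d * (\<theta> ^ (e * n) * q j)\<^sup>2) * (B * t j * \<theta> ^ e)"
          by (simp only: qt(1,2)[OF that] eval_theta \<theta>_def)
        also have "(\<theta> ^ (e * n) * q j)\<^sup>2 = \<theta> ^ (2 * e * n) * (q j)\<^sup>2"
          by (simp add: power_mult_distrib power_mult[symmetric] mult_ac)
        also have "L / B * (\<theta> ^ d * (\<theta> ^ (2 * e * n) * (q j)\<^sup>2)) * (B * t j * \<theta> ^ e) = \<theta> ^ K * (L * u j)"
          using B(1) by (simp add: K_def K0_def power_add u_def)
        finally show ?thesis .
      qed
      have "eval_mpoly p x = \<theta> ^ K0 * (F * \<theta> ^ d + \<epsilon> * \<theta> ^ d) - (\<Sum>j=1..m. eval_mpoly (s j * g j) x)"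
      proof -
        have "eval_mpoly p x = eval_mpoly theta x ^ K0 * (eval_mpoly f x + \<epsilon> * eval_mpoly theta x ^ d)
            - (\<Sum>j=1..m. eval_mpoly (s j * g j) x)"
          by (simp add: p_def eval_mpoly_eq_ev)
        then show ?thesis by (simp only: f_F eval_theta \<theta>_def)
      qed
      also have "(\<Sum>j=1..m. eval_mpoly (s j * g j) x) = \<theta> ^ K * (L * (\<Sum>j=1..m. u j))"
        by (simp add: sg sum_distrib_left)
      also have "\<theta> ^ K0 * (F * \<theta> ^ d + \<epsilon> * \<theta> ^ d) = \<theta> ^ K * (F + \<epsilon>)"
        by (simp add: K_def power_add algebra_simps)
      finally have p: "eval_mpoly p x = \<theta> ^ K * (F + \<epsilon> - L * (\<Sum>j=1..m. u j))"
        by (simp add: right_diff_distrib)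
      have u_low: "- 1 \<le> u j" if "j \<in> {1..m}" for j
      proof -
        have "\<bar>t j\<bar> * (q j)\<^sup>2 \<le> 1 * 1"
          using qt(3-5)[OF that] by (intro mult_mono power_le_one) auto
        then have "\<bar>u j\<bar> \<le> 1" by (simp add: u_def abs_mult)
        then show ?thesis by linarith
      qed
      have F_le: "\<bar>F\<bar> \<le> M"
        using M(2)[of x] \<theta> by (simp add: F_def \<theta>_def[symmetric] pos_divide_le_eq)
      have bad: "\<exists>j\<in>{1..m}. L * u j \<le> - M" if "F \<le> - (\<epsilon> / 2)"
      proof -
        have "eval_mpoly f x \<le> - (\<epsilon> / 2) * (1 + (norm x)\<^sup>2) ^ d"
          unfolding f_F \<theta>_def[symmetric] using that \<theta> by (intro mult_right_mono) auto
        then obtain j where j: "j \<in> {1..m}" "eval_mpoly (g j) x \<le> - c * (\<epsilon> / 2) ^ a * \<theta> ^ e"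
          using loj[of "\<epsilon> / 2" x] \<epsilon> by (auto simp: \<theta>_def)
        then have "B * t j * \<theta> ^ e \<le> - c * (\<epsilon> / 2) ^ a * \<theta> ^ e" using qt(2)[OF j(1)] by simp
        then have Bt: "B * t j \<le> - c * (\<epsilon> / 2) ^ a" by (rule mult_right_le_imp_le) (use \<theta> in simp)
        have "c * (\<epsilon> / 2) ^ a > 0" using c \<epsilon> by simp
        with Bt have "B * t j < 0" by linarith
        then have "t j \<le> 0" using B(1) by (simp add: mult_less_0_iff)
        then have "(1 / 2)\<^sup>2 \<le> (q j)\<^sup>2" using qt(6)[OF j(1)] by (intro power_mono) auto
        then have "t j * (q j)\<^sup>2 \<le> t j * (1 / 4)"
          using \<open>t j \<le> 0\<close> by (intro mult_left_mono_neg) (simp_all add: power2_eq_square)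
        then have "L * u j \<le> L * (t j / 4)" using L by (simp add: u_def)
        also have "\<dots> = L / (4 * B) * (B * t j)" using B(1) by simp
        also have "\<dots> \<le> L / (4 * B) * (- c * (\<epsilon> / 2) ^ a)"
          using Bt L B(1) by (intro mult_left_mono) auto
        also have "\<dots> = - (l * c / (4 * B * 2 ^ a))"
          using \<epsilon> by (simp add: L_def r_def power_divide)
        also have "\<dots> \<le> - M"
        proof -
          have "4 * M * B * 2 ^ a / c \<le> l" by (simp add: l_def)
          then show ?thesis using c B(1) by (simp add: field_simps)
        qed
        finally show ?thesis using j(1) by blast
      qed
      have \<eta>L: "real m * L * \<eta> \<le> \<epsilon> / 4" using m L by (simp add: \<eta>_def)
      have L0: "L > 0" using L by linarith
      have u_up: "u j \<le> \<eta>" if "j \<in> {1..m}" for j using qt(7)[OF that] by (simp add: u_def)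
      note pb = penalized_bounds[OF m \<epsilon> L0 less_imp_le[OF \<eta>(1)] \<eta>L F_le, of u, OF u_up u_low bad]
      have "\<theta> ^ K * (\<epsilon> / 4) \<le> eval_mpoly p x"
        unfolding p using pb(1) \<theta> by (intro mult_left_mono) auto
      moreover have "eval_mpoly p x \<le> \<theta> ^ K * (M + 1 + L * real m)"
        unfolding p using pb(2) \<theta> by (intro mult_left_mono) auto
      ultimately show ?thesis by (simp add: \<theta>_def mult.commute)
    qed
    have K1: "K \<ge> 1" using d by (simp add: K_def)
    have K_le: "real K \<le> C1 * r ^ (3 * (a + 1))"
    proof -
      have "K \<le> (3 * e + d) * n"
      proof -
        have "e \<le> e * n" "d \<le> d * n" using n(1) by simp_all
        moreover have "(3 * e + d) * n = 3 * (e * n) + d * n" "2 * e * n = 2 * (e * n)"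
          by (simp_all add: algebra_simps)
        ultimately show ?thesis unfolding K_def K0_def by linarith
      qed
      then have "real K \<le> real (3 * e + d) * real n" by (metis of_nat_le_iff of_nat_mult)
      also have "\<dots> \<le> real (3 * e + d) * (9 * (4 * real m * l) ^ 3 * r ^ (3 * (a + 1)))"
        by (intro mult_left_mono n_le) auto
      finally show ?thesis by (simp add: C1_def mult.assoc)
    qed
    define R where "R = 2 * real CARD('n option) * (24 * real K)\<^sup>2 * (M + 1 + L * real m) / (\<epsilon> / 4)"
    have k_large: "real K0 + R \<le> real k"
    proof -
      have ratio: "(M + 1 + L * real m) / (\<epsilon> / 4) \<le> C2 * r ^ (a + 1)"
      proof -
        have "M + 1 \<le> (M + 1) * r ^ a"
          using mult_left_mono[OF one_le_power[OF r(1), of a], of "M + 1"] M(1) by simp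
        then have "M + 1 + L * real m \<le> (M + 1 + l * real m) * r ^ a"
          by (simp add: L_def algebra_simps)
        then have "(M + 1 + L * real m) * (4 * r) \<le> (M + 1 + l * real m) * r ^ a * (4 * r)"
          using r by (intro mult_right_mono) auto
        moreover have "(M + 1 + L * real m) / (\<epsilon> / 4) = (M + 1 + L * real m) * (4 * r)"
          by (simp add: r_def)
        moreover have "C2 * r ^ (a + 1) = (M + 1 + l * real m) * r ^ a * (4 * r)"
          by (simp add: C2_def)
        ultimately show ?thesis by linarith
      qed
      have "2 * real CARD('n option) * (24 * real K)\<^sup>2 = 1152 * real CARD('n option) * (real K)\<^sup>2"
        by (simp add: power_mult_distrib)
      then have "R = 1152 * real CARD('n option) * (real K)\<^sup>2 * ((M + 1 + L * real m) / (\<epsilon> / 4))"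
        unfolding R_def by (simp only: times_divide_eq_right)
      also have "\<dots> \<le> 1152 * real CARD('n option) * (real K)\<^sup>2 * (C2 * r ^ (a + 1))"
        using ratio by (intro mult_left_mono) auto
      finally have R_le: "R \<le> 1152 * real CARD('n option) * (real K)\<^sup>2 * (C2 * r ^ (a + 1))" .
      have "real K0 \<le> real K * 1" by (simp add: K_def)
      also have "\<dots> \<le> real K * real K" using K1 by (intro mult_left_mono) auto
      also have "\<dots> \<le> (real K)\<^sup>2 * r ^ (a + 1)"
        using mult_left_mono[OF one_le_power[OF r(1), of "a + 1"], of "(real K)\<^sup>2"] by (simp add: power2_eq_square)
      finally have "real K0 + R \<le> (1 + 1152 * real CARD('n option) * C2) * (real K)\<^sup>2 * r ^ (a + 1)"
        using R_le by (simp add: algebra_simps)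
      also have "\<dots> \<le> (1 + 1152 * real CARD('n option) * C2) * (C1 * r ^ (3 * (a + 1)))\<^sup>2 * r ^ (a + 1)"
        using K_le C2 r by (intro mult_right_mono mult_left_mono power_mono) auto
      also have "\<dots> = C * (r ^ (3 * (a + 1)) * r ^ (3 * (a + 1)) * r ^ (a + 1))"
        by (simp only: C_def power_mult_distrib power2_eq_square mult_ac)
      also have "r ^ (3 * (a + 1)) * r ^ (3 * (a + 1)) * r ^ (a + 1) = r ^ (7 * (a + 1))"
        by (simp only: power_add[symmetric]) simp
      also have "C * r ^ (7 * (a + 1)) \<le> real k" using k by (simp add: r_def)
      finally show ?thesis .
    qed
    have "R \<ge> 0" using M L \<epsilon> by (simp add: R_def)
    then have K0k: "K0 \<le> k" using k_large by linarith
    define k' where "k' = k - K0"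
    have kk: "k = k' + K0" using K0k by (simp add: k'_def)
    have k'_large: "real k' \<ge> R" using k_large by (simp add: kk)
    have "L * real m \<ge> 0" using L by simp
    then have "\<epsilon> / 4 \<le> M + 1 + L * real m" using \<epsilon> M(1) by linarith
    then have "sosf (k' + K) (\<lambda>x. (1 + (norm x)\<^sup>2) ^ k' * eval_mpoly p x)"
      using p_bounds \<epsilon> K1 k'_large unfolding R_def
      by (intro sosf_positive_polynomial[OF deg_p, of "\<epsilon> / 4" "M + 1 + L * real m"]) auto
    then obtain \<sigma>0 where \<sigma>0: "is_sos \<sigma>0" "total_degree \<sigma>0 \<le> 2 * (k' + K)"
      "\<And>x. eval_mpoly \<sigma>0 x = (1 + (norm x)\<^sup>2) ^ k' * eval_mpoly p x"
      by (auto simp: sosf_def)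
    have \<sigma>0_eq: "\<sigma>0 = theta ^ k' * p"
      by (rule eval_mpoly_inject) (simp add: \<sigma>0(3) eval_theta_power[symmetric], simp add: eval_mpoly_eq_ev)
    define \<sigma> where "\<sigma> j = (if j = 0 then \<sigma>0 else if j \<in> {1..m} then theta ^ k' * s j else 0)" for j
    have "theta ^ k * (f + Const \<epsilon> * theta ^ d) = \<sigma> 0 + (\<Sum>j\<in>{1..m}. \<sigma> j * g j)"
    proof -
      have "(\<Sum>j\<in>{1..m}. \<sigma> j * g j) = theta ^ k' * (\<Sum>j=1..m. s j * g j)"
        unfolding sum_distrib_left by (intro sum.cong refl) (simp add: \<sigma>_def mult.assoc)
      then have "\<sigma> 0 + (\<Sum>j\<in>{1..m}. \<sigma> j * g j) = theta ^ k' * (p + (\<Sum>j=1..m. s j * g j))"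
        by (simp add: \<sigma>_def \<sigma>0_eq distrib_left)
      also have "p + (\<Sum>j=1..m. s j * g j) = theta ^ K0 * (f + Const \<epsilon> * theta ^ d)" by (simp add: p_def)
      finally show ?thesis by (simp add: kk power_add mult.assoc)
    qed
    moreover have "is_sos (\<sigma> j)" if "j \<in> {0..m}" for j
      unfolding \<sigma>_def s_def using \<sigma>0(1) L B(1)
      by (auto intro!: is_sos_mult is_sos_power is_sos_theta is_sos_Const is_sos_square is_sos_0)
    moreover have "total_degree (\<sigma> 0) \<le> 2 * (k + d)"
      using \<sigma>0(2) by (simp add: \<sigma>_def kk K_def add_ac)
    moreover have "total_degree (\<sigma> j * g j) \<le> 2 * (k + d)" if "j \<in> {1..m}" for j
    proof -
      have "\<sigma> j * g j = theta ^ k' * (s j * g j)" using that by (simp add: \<sigma>_def mult.assoc)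
      then show ?thesis
        using total_degree_mult[OF total_degree_theta_power[of k'] deg_sg[OF that]] by (simp add: kk K_def)
    qed
    ultimately show ?thesis unfolding has_sos_rep_def by blast
  qed
  ultimately show ?thesis by blast
qed

lemma has_sos_rep_add_sos:
  assumes "has_sos_rep m g D p" "is_sos q" "total_degree q \<le> D"
  shows "has_sos_rep m g D (p + q)"
proof -
  obtain \<sigma> where \<sigma>: "\<forall>j\<in>{0..m}. is_sos (\<sigma> j)" "total_degree (\<sigma> 0) \<le> D"
    "\<forall>j\<in>{1..m}. total_degree (\<sigma> j * g j) \<le> D" "p = \<sigma> 0 + (\<Sum>j\<in>{1..m}. \<sigma> j * g j)"
    using assms(1) unfolding has_sos_rep_def by blast
  have "(\<Sum>j\<in>{1..m}. (\<sigma>(0 := \<sigma> 0 + q)) j * g j) = (\<Sum>j\<in>{1..m}. \<sigma> j * g j)"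
    by (intro sum.cong) auto
  then show ?thesis
    unfolding has_sos_rep_def using \<sigma> assms(2,3)
    by (intro exI[of _ "\<sigma>(0 := \<sigma> 0 + q)"]) (auto intro: is_sos_add total_degree_add)
qed

lemma has_sos_rep_sos:
  assumes "is_sos p" "total_degree p \<le> D"
  shows "has_sos_rep m g D p"
  unfolding has_sos_rep_def using assms
  by (intro exI[of _ "\<lambda>j. if j = 0 then p else 0"]) (auto simp: is_sos_0)

text \<open>\<open>\<theta>\<^sup>d\<close> is an interior point of the cone of sums of squares of degree \<open>2 d\<close>.\<close>

lemma perturbation_sos:
  fixes f :: "'n::finite real_mpoly"
  assumes f: "total_degree f \<le> 2 * d"
  shows "\<exists>\<epsilon>1\<ge>1. \<forall>\<epsilon>\<ge>\<epsilon>1. is_sos (f + Const \<epsilon> * theta ^ d)"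
proof -
  let ?H = "homogenize (2 * d) f"
  define \<epsilon>1 where "\<epsilon>1 = 1 + (\<Sum>\<alpha>\<in>Poly_Mapping.keys ?H. \<bar>Poly_Mapping.lookup ?H \<alpha>\<bar>)"
  have "is_sos (f + Const \<epsilon> * theta ^ d)" if "\<epsilon> \<ge> \<epsilon>1" for \<epsilon>
  proof -
    have "sosf d (\<lambda>x. eval_mpoly ?H (hvec x) + \<epsilon> * (1 + (norm x)\<^sup>2) ^ d)"
      using that by (intro sosf_form_absorbed hom_homogenize f) (simp add: \<epsilon>1_def)
    then obtain p where p: "is_sos p" "\<And>x. eval_mpoly p x = eval_mpoly f x + \<epsilon> * (1 + (norm x)\<^sup>2) ^ d"
      by (auto simp: sosf_def eval_homogenize_hvec)
    have "p = f + Const \<epsilon> * theta ^ d"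
      by (rule eval_mpoly_inject) (simp add: p(2) eval_theta_power[symmetric], simp add: eval_mpoly_eq_ev)
    then show ?thesis using p(1) by simp
  qed
  moreover have "\<epsilon>1 \<ge> 1" by (simp add: \<epsilon>1_def sum_nonneg)
  ultimately show ?thesis by blast
qed

text \<open>For \<open>\<epsilon> > 1\<close> the lower bound on \<open>k\<close> may be weak. For large \<open>\<epsilon>\<close> no multipliers are needed at all, and
  in between the representation for \<open>\<epsilon> = 1\<close> is used, plus the sum of squares \<open>(\<epsilon> - 1) \<theta>\<^bsup>k+d\<^esup>\<close>; the
  constant is enlarged so that \<open>k\<close> suffices for \<open>\<epsilon> = 1\<close>.\<close>

lemma complexity_all_epsilon:
  fixes f :: "'n::finite real_mpoly"
  assumes f: "total_degree f < 2 * d" and C: "C > 0" and s: "real b \<le> s"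
    and small: "\<And>\<epsilon> k. 0 < \<epsilon> \<Longrightarrow> \<epsilon> \<le> 1 \<Longrightarrow> real k \<ge> C * (1 / \<epsilon>) ^ b \<Longrightarrow>
      has_sos_rep m g (2 * (k + d)) (theta ^ k * (f + Const \<epsilon> * theta ^ d))"
  shows "\<exists>cbar>0. \<forall>\<epsilon>>0. \<forall>k::nat. real k \<ge> cbar * \<epsilon> powr (- s) \<longrightarrow>
      has_sos_rep m g (2 * (k + d)) (theta ^ k * (f + Const \<epsilon> * theta ^ d))"
proof -
  have s0: "s \<ge> 0" using s of_nat_0_le_iff[of b, where 'a = real] by linarith
  obtain \<epsilon>1 where \<epsilon>1: "\<epsilon>1 \<ge> 1" "\<And>\<epsilon>. \<epsilon> \<ge> \<epsilon>1 \<Longrightarrow> is_sos (f + Const \<epsilon> * theta ^ d)"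
    using perturbation_sos[of f d] f by auto
  have \<epsilon>1s: "\<epsilon>1 powr s \<ge> 1" using \<epsilon>1(1) s0 by (simp add: ge_one_powr_ge_zero)
  define cbar where "cbar = C * \<epsilon>1 powr s"
  have "cbar > 0" using C \<epsilon>1(1) by (simp add: cbar_def)
  moreover have "has_sos_rep m g (2 * (k + d)) (theta ^ k * (f + Const \<epsilon> * theta ^ d))"
    if \<epsilon>: "\<epsilon> > 0" and k: "real k \<ge> cbar * \<epsilon> powr (- s)" for \<epsilon> and k :: nat
  proof -
    consider "\<epsilon> \<le> 1" | "1 \<le> \<epsilon>" "\<epsilon> \<le> \<epsilon>1" | "\<epsilon>1 \<le> \<epsilon>" by linarith
    then show ?thesis
    proof cases
      case 1
      have "(1 / \<epsilon>) ^ b = (1 / \<epsilon>) powr real b" using \<epsilon> by (simp add: powr_realpow)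
      also have "\<dots> \<le> (1 / \<epsilon>) powr s" using 1 \<epsilon> s by (intro powr_mono) auto
      also have "\<dots> = \<epsilon> powr (- s)" using \<epsilon> by (simp add: powr_minus powr_divide field_simps)
      finally have "C * (1 / \<epsilon>) ^ b \<le> C * \<epsilon> powr (- s)" using C by (intro mult_left_mono) auto
      also have "\<dots> = (C * 1) * \<epsilon> powr (- s)" by simp
      also have "\<dots> \<le> cbar * \<epsilon> powr (- s)"
        unfolding cbar_def using C \<epsilon>1s by (intro mult_right_mono mult_left_mono) auto
      finally show ?thesis using small[OF \<epsilon> 1, of k] k by linarith
    next
      case 2
      have "\<epsilon> powr s \<le> \<epsilon>1 powr s" using 2 s0 by (intro powr_mono2) auto
      then have "1 \<le> \<epsilon>1 powr s * \<epsilon> powr (- s)" using \<epsilon> by (simp add: powr_minus field_simps)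
      then have "C * 1 \<le> C * (\<epsilon>1 powr s * \<epsilon> powr (- s))" using C by (intro mult_left_mono) auto
      then have "C * (1 / 1) ^ b \<le> real k" using k by (simp add: cbar_def mult.assoc)
      then have rep: "has_sos_rep m g (2 * (k + d)) (theta ^ k * (f + Const 1 * theta ^ d))"
        by (intro small) auto
      have "theta ^ k * (f + Const \<epsilon> * theta ^ d) =
          theta ^ k * (f + Const 1 * theta ^ d) + Const (\<epsilon> - 1) * theta ^ (k + d)"
      proof -
        have "theta ^ k * (f + (A + B) * theta ^ d) = theta ^ k * (f + A * theta ^ d) + B * (theta ^ k * theta ^ d)" for A B
          by (simp add: algebra_simps)
        from this[of "Const 1" "Const (\<epsilon> - 1)"] show ?thesis
          unfolding Const_add[symmetric] power_add by simp
      qed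
      moreover have "is_sos (Const (\<epsilon> - 1) * theta ^ (k + d))"
        using 2 by (intro is_sos_mult is_sos_Const is_sos_power is_sos_theta) auto
      moreover have "total_degree (Const (\<epsilon> - 1) * theta ^ (k + d)) \<le> 2 * (k + d)"
        by (intro total_degree_Const_mult total_degree_theta_power)
      ultimately show ?thesis using has_sos_rep_add_sos[OF rep] by simp
    next
      case 3
      have "total_degree (f + Const \<epsilon> * theta ^ d) \<le> 2 * d"
        using f by (intro total_degree_add total_degree_Const_mult total_degree_theta_power) auto
      from total_degree_mult[OF total_degree_theta_power[of k] this]
      show ?thesis
        using \<epsilon>1(2)[OF 3] by (intro has_sos_rep_sos is_sos_mult is_sos_power is_sos_theta) simp_all
    qed
  qed
  ultimately show ?thesis by blast
qed

theorem corollary1: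
  fixes f :: "'n::finite real_mpoly" and g :: "nat \<Rightarrow> 'n real_mpoly" and m :: nat
  assumes "m \<ge> 1"
    and "interior (semialg_set m g) \<noteq> {}"
    and "\<forall>x\<in>semialg_set m g. eval_mpoly f x \<ge> 0"
  shows "(\<exists>cbar>0. \<exists>c>0. \<forall>\<epsilon>>0. \<forall>k::nat. real k \<ge> cbar * \<epsilon> powr (- c) \<longrightarrow>
            has_sos_rep m g (2 * (k + half_deg f))
              (theta ^ k * (f + Const \<epsilon> * theta ^ half_deg f))) \<and>
         (m = 1 \<and> g 1 = 1 - norm_sq \<longrightarrow>
           (\<exists>cbar>0. \<forall>\<epsilon>>0. \<forall>k::nat. real k \<ge> cbar * \<epsilon> powr (- 65) \<longrightarrow>
            has_sos_rep m g (2 * (k + half_deg f))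
              (theta ^ k * (f + Const \<epsilon> * theta ^ half_deg f))))"
proof (intro conjI impI)
  have f: "total_degree f < 2 * half_deg f" by (simp add: half_deg_def)
  define e where "e = 1 + (\<Sum>j\<in>{1..m}. total_degree (g j))"
  have g: "total_degree (g j) \<le> 2 * e" if "j \<in> {1..m}" for j
    using member_le_sum[of j "{1..m}" "\<lambda>j. total_degree (g j)"] that by (simp add: e_def)
  have "\<exists>c>0. \<exists>a. \<forall>\<epsilon> x. 0 < \<epsilon> \<longrightarrow> \<epsilon> \<le> 1 \<longrightarrow> eval_mpoly f x \<le> - \<epsilon> * (1 + (norm x)\<^sup>2) ^ half_deg f \<longrightarrow>
      (\<exists>j\<in>{1..m}. eval_mpoly (g j) x \<le> - c * \<epsilon> ^ a * (1 + (norm x)\<^sup>2) ^ e)"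
    by (rule lojasiewicz_semialgebraic[OF assms(1) f]) (use g assms(3) in auto)
  then obtain c a where c: "c > 0" "\<And>\<epsilon> x. 0 < \<epsilon> \<Longrightarrow> \<epsilon> \<le> 1 \<Longrightarrow> eval_mpoly f x \<le> - \<epsilon> * (1 + (norm x)\<^sup>2) ^ half_deg f \<Longrightarrow>
      \<exists>j\<in>{1..m}. eval_mpoly (g j) x \<le> - c * \<epsilon> ^ a * (1 + (norm x)\<^sup>2) ^ e"
    by blast
  obtain C where C: "C > 0" "\<And>\<epsilon> k. 0 < \<epsilon> \<Longrightarrow> \<epsilon> \<le> 1 \<Longrightarrow> real k \<ge> C * (1 / \<epsilon>) ^ (7 * (a + 1)) \<Longrightarrow>
      has_sos_rep m g (2 * (k + half_deg f)) (theta ^ k * (f + Const \<epsilon> * theta ^ half_deg f))"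
    using representation_from_lojasiewicz[OF assms(1) f _ g c] by (auto simp: e_def)
  have "\<exists>cbar>0. \<forall>\<epsilon>>0. \<forall>k::nat. real k \<ge> cbar * \<epsilon> powr (- real (7 * (a + 1))) \<longrightarrow>
      has_sos_rep m g (2 * (k + half_deg f)) (theta ^ k * (f + Const \<epsilon> * theta ^ half_deg f))"
    by (rule complexity_all_epsilon[OF f C(1), where b = "7 * (a + 1)"]) (use C(2) in auto)
  moreover have "real (7 * (a + 1)) > 0" by simp
  ultimately show "\<exists>cbar>0. \<exists>c>0. \<forall>\<epsilon>>0. \<forall>k::nat. real k \<ge> cbar * \<epsilon> powr (- c) \<longrightarrow>
      has_sos_rep m g (2 * (k + half_deg f)) (theta ^ k * (f + Const \<epsilon> * theta ^ half_deg f))"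
    by blast
next
  assume ball: "m = 1 \<and> g 1 = 1 - norm_sq"
  have f: "total_degree f < 2 * half_deg f" by (simp add: half_deg_def)
  have eval_g: "eval_mpoly (g 1) x = 1 - (norm x)\<^sup>2" for x
    using ball eval_norm_sq[of x] by (simp add: eval_mpoly_eq_ev)
  have "total_degree (g 1) \<le> 2 * 1"
  proof -
    have "g 1 = Const 2 - theta" using ball Const_add[of 1 1, where 'a = 'n] by (simp add: theta_def Const_def)
    then show ?thesis using total_degree_theta by (auto intro!: total_degree_diff)
  qed
  then have g: "total_degree (g j) \<le> 2 * 1" if "j \<in> {1..m}" for j using that ball by auto
  have "eval_mpoly f x \<ge> 0" if "norm x \<le> 1" for x
    using assms(3) that ball eval_g[of x] by (auto simp: semialg_set_def power_le_one)
  then obtain c where c: "c > 0" "\<And>\<epsilon> x. 0 < \<epsilon> \<Longrightarrow> eval_mpoly f x \<le> - \<epsilon> * (1 + (norm x)\<^sup>2) ^ half_deg f \<Longrightarrow>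
      1 - (norm x)\<^sup>2 \<le> - c * \<epsilon> * (1 + (norm x)\<^sup>2)"
    using lojasiewicz_ball[OF f] by blast
  have loj: "\<exists>j\<in>{1..m}. eval_mpoly (g j) x \<le> - c * \<epsilon> ^ 1 * (1 + (norm x)\<^sup>2) ^ 1"
    if "0 < \<epsilon>" "\<epsilon> \<le> 1" "eval_mpoly f x \<le> - \<epsilon> * (1 + (norm x)\<^sup>2) ^ half_deg f" for \<epsilon> x
    using c(2)[OF that(1,3)] ball eval_g[of x] by (intro bexI[of _ 1]) auto
  obtain C where C: "C > 0" "\<And>\<epsilon> k. 0 < \<epsilon> \<Longrightarrow> \<epsilon> \<le> 1 \<Longrightarrow> real k \<ge> C * (1 / \<epsilon>) ^ (7 * (1 + 1)) \<Longrightarrow>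
      has_sos_rep m g (2 * (k + half_deg f)) (theta ^ k * (f + Const \<epsilon> * theta ^ half_deg f))"
    using representation_from_lojasiewicz[OF assms(1) f order_refl g c(1) loj] by blast
  show "\<exists>cbar>0. \<forall>\<epsilon>>0. \<forall>k::nat. real k \<ge> cbar * \<epsilon> powr (- 65) \<longrightarrow>
      has_sos_rep m g (2 * (k + half_deg f)) (theta ^ k * (f + Const \<epsilon> * theta ^ half_deg f))"
    by (rule complexity_all_epsilon[OF f C(1), where b = "7 * (1 + 1)"]) (use C(2) in auto)
qed

end
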